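(* Let $(\mathcal{B},\mathbb{E},\mathfrak{s})$ be an extriangulated category, and let $((\mathcal{S},\mathcal{T}),(\mathcal{U},\mathcal{V}))$ be a twin cotorsion pair on $\mathcal{B}$ with associated subcategories $\mathcal{W}=\mathcal{T}\cap\mathcal{U}$, $\mathcal{B}^-=\operatorname{CoCone}(\mathcal{W},\mathcal{S})$, $\mathcal{B}^+=\operatorname{Cone}(\mathcal{V},\mathcal{W})$ and $\mathcal{H}=\mathcal{B}^-\cap\mathcal{B}^+$. If $\mathcal{H}=\mathcal{B}^-$ or $\mathcal{H}=\mathcal{B}^+$, then the heart $\overline{\mathcal{H}}=\mathcal{H}/[\mathcal{W}]$ is quasi-abelian.
   Context: **Extriangulated categories (Nakaoka--Palu).** Let $\mathcal{B}$ be an additive category and $\mathbb{E}\colon\mathcal{B}^{\mathrm{op}}\times\mathcal{B}\to\mathsf{Ab}$ a biadditive functor. An element $\delta\in\mathbb{E}(C,A)$ is an extension. For $f\colon A\to X$ and $g\colon Y\to C$ put $f_*\delta=\mathbb{E}(C,f)(\delta)\in\mathbb{E}(C,X)$ and $g^*\delta=\mathbb{E}(g,A)(\delta)\in\mathbb{E}(Y,A)$. A morphism of extensions from $\delta\in\mathbb{E}(C,A)$ to $\delta'\in\mathbb{E}(D,B)$ is a pair $(f\colon A\to B,\,h\colon C\to D)$ with $f_*\delta=h^*\delta'$. Two sequences $A\xrightarrow{a}B\xrightarrow{b}C$ and $A\xrightarrow{a'}B'\xrightarrow{b'}C$ are equivalent if there is an isomorphism $g\colon B\to B'$ with $ga=a'$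 and $b'g=b$; $[A\xrightarrow{a}B\xrightarrow{b}C]$ denotes the equivalence class. Let $\mathfrak{s}$ assign to each extension $\delta\in\mathbb{E}(C,A)$ an equivalence class $\mathfrak{s}(\delta)=[A\xrightarrow{a}B\xrightarrow{b}C]$; one says that $\delta$ is realised by $A\xrightarrow{a}B\xrightarrow{b}C$. $\mathfrak{s}$ is a realisation of $\mathbb{E}$ if, whenever $\mathfrak{s}(\delta)=[A\xrightarrow{a}B\xrightarrow{b}C]$, $\mathfrak{s}(\delta')=[A'\xrightarrow{a'}B'\xrightarrow{b'}C']$ and $(f,h)\colon\delta\to\delta'$ is a morphism of extensions, there is $g\colon B\to B'$ with $ga=a'f$ and $b'g=hb$ (then $(f,g,h)$ realises $(f,h)$). It is additive if (i) $0\in\mathbb{E}(C,A)$ is realised by the split sequence $A\to A\oplus C\to C$ for all $A,C$, and (ii) if $\delta\in\mathbb{E}(C,A)$ and $\delta'\in\mathbb{E}(C',A')$ are realised by $A\xrightarrow{a}B\xrightarrow{b}C$ and $A'\xrightarrow{a'}B'\xrightarrow{b'}C'$ respectively, then $\delta\oplus\delta'=(i_A)_*(p_C)^*\delta+(i_{A'})_*(p_{C'})^*\delta'\in\mathbb{E}(C\oplus C',A\oplus A')$ is realised by $A\oplus A'\xrightarrow{a\oplus a'}B\oplus B'\xrightarrow{b\oplus b'}C\oplus C'$, where $i$ and $p$ denote the canonical inclusions and projections. $(\mathcal{B},\mathbb{E},\mathfrak{s})$ is an extriangulated category if: (ET1) $\mathbb{E}$ is biadditive; (ET2) $\mathfrak{s}$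 is an additive realisation of $\mathbb{E}$; (ET3) if $\mathfrak{s}(\delta)=[A\xrightarrow{a}B\xrightarrow{b}C]$, $\mathfrak{s}(\delta')=[A'\xrightarrow{a'}B'\xrightarrow{b'}C']$ and $f\colon A\to A'$, $g\colon B\to B'$ satisfy $ga=a'f$, then there is $h\colon C\to C'$ with $f_*\delta=h^*\delta'$ and $hb=b'g$; (ET3$^{\mathrm{op}}$) dually, if $g\colon B\to B'$, $h\colon C\to C'$ satisfy $hb=b'g$, then there is $f\colon A\to A'$ with $f_*\delta=h^*\delta'$ and $ga=a'f$; (ET4) if $\delta\in\mathbb{E}(D,A)$ and $\delta'\in\mathbb{E}(F,B)$ are realised by $A\xrightarrow{a}B\xrightarrow{a'}D$ and $B\xrightarrow{b}C\xrightarrow{b'}F$, then there are an object $E$, an extension $\delta''\in\mathbb{E}(E,A)$ realised by $A\xrightarrow{c}C\xrightarrow{c'}E$, and morphisms $d\colon D\to E$, $e\colon E\to F$ with $c=ba$, $c'b=da'$, $ec'=b'$, $\mathfrak{s}((a')_*\delta')=[D\xrightarrow{d}E\xrightarrow{e}F]$, $d^*\delta''=\delta$ and $a_*\delta''=e^*\delta'$; (ET4$^{\mathrm{op}}$) the dual of (ET4). A conflation is a sequence $A\to B\to C$ that realises some extension in $\mathbb{E}(C,A)$. **Twin cotorsion pairs.** For full subcategories $\mathcal{X},\mathcal{Y}$ of $\mathcal{B}$ closed under isomorphisms: $\operatorname{Cone}(\mathcal{Y},\mathcal{X})$ is the full subcategory of objects $Z$ admitting a conflation $Y\to X\to Z$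 with $X\in\mathcal{X}$, $Y\in\mathcal{Y}$; $\operatorname{CoCone}(\mathcal{Y},\mathcal{X})$ is the full subcategory of objects $Z$ admitting a conflation $Z\to Y\to X$ with $X\in\mathcal{X}$, $Y\in\mathcal{Y}$. A pair $(\mathcal{U},\mathcal{V})$ of full additive subcategories closed under direct summands is a cotorsion pair on $\mathcal{B}$ if $\mathbb{E}(\mathcal{U},\mathcal{V})=0$ (i.e. $\mathbb{E}(U,V)=0$ for all $U\in\mathcal{U}$, $V\in\mathcal{V}$) and $\mathcal{B}=\operatorname{Cone}(\mathcal{V},\mathcal{U})=\operatorname{CoCone}(\mathcal{V},\mathcal{U})$. If $(\mathcal{S},\mathcal{T})$ and $(\mathcal{U},\mathcal{V})$ are cotorsion pairs on $\mathcal{B}$, then $((\mathcal{S},\mathcal{T}),(\mathcal{U},\mathcal{V}))$ is a twin cotorsion pair on $\mathcal{B}$ if $\mathbb{E}(\mathcal{S},\mathcal{V})=0$ (equivalently $\mathcal{S}\subseteq\mathcal{U}$, equivalently $\mathcal{V}\subseteq\mathcal{T}$). **Heart.** $\mathcal{W},\mathcal{B}^-,\mathcal{B}^+,\mathcal{H}$ are regarded as full subcategories of $\mathcal{B}$. $[\mathcal{W}]$ is the ideal of morphisms factoring through an object of $\mathcal{W}$. The heart is the additive quotient $\overline{\mathcal{H}}=\mathcal{H}/[\mathcal{W}]$ (objects of $\mathcal{H}$, morphism groups $\mathcal{B}(X,Y)/[\mathcal{W}](X,Y)$). It is known (Liu--Nakaoka) that $\overline{\mathcal{H}}$ is semi-abelian,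 in particular preabelian (additive, with all kernels and cokernels); here a preabelian category is semi-abelian if every morphism $f$ can be written as $f=ip$ with $i$ a monomorphism and $p$ a cokernel, and also as $f=i'p'$ with $i'$ a kernel and $p'$ an epimorphism. **Quasi-abelian.** A preabelian category is left quasi-abelian if cokernels (morphisms that are a cokernel of some morphism) are stable under pullback, right quasi-abelian if kernels are stable under pushout, and quasi-abelian if it is both left and right quasi-abelian. *)

theory Defs
  imports "HOL-Algebra.Coset"
begin

text \<open>
  Abelian groups (morphism groups and extension groups) are HOL-Algebra groups, which are written
  multiplicatively: \<open>\<otimes>\<close> is the sum of two morphisms or extensions and \<open>\<one>\<close> is zero.
  Composition of morphisms is \<open>g \<cdot> f\<close> (first f, then g).
\<close>

section \<open>Additive categories\<close>

record ('o, 'm) cat =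
  Obj :: "'o set"
  Hom :: "'o \<Rightarrow> 'o \<Rightarrow> 'm monoid"
  idm :: "'o \<Rightarrow> 'm"
  cmp :: "'m \<Rightarrow> 'm \<Rightarrow> 'm"  (infixl "\<cdot>\<index>" 70)

abbreviation Mor :: "('o, 'm) cat \<Rightarrow> 'o \<Rightarrow> 'o \<Rightarrow> 'm set" where
  "Mor C X Y \<equiv> carrier (Hom C X Y)"

abbreviation zero_mor :: "('o, 'm) cat \<Rightarrow> 'o \<Rightarrow> 'o \<Rightarrow> 'm" where
  "zero_mor C X Y \<equiv> \<one>\<^bsub>Hom C X Y\<^esub>"

text \<open>Morphism sets are disjoint, so that a morphism determines its source and its target.\<close>

locale preadditive_category =
  fixes C :: "('o, 'm) cat" (structure)
  assumes hom_group: "\<lbrakk>X \<in> Obj C; Y \<in> Obj C\<rbrakk> \<Longrightarrow> comm_group (Hom C X Y)"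
    and hom_disjoint: "\<lbrakk>X \<in> Obj C; Y \<in> Obj C; X' \<in> Obj C; Y' \<in> Obj C;
          f \<in> Mor C X Y; f \<in> Mor C X' Y'\<rbrakk> \<Longrightarrow> X = X' \<and> Y = Y'"
    and id_closed: "X \<in> Obj C \<Longrightarrow> idm C X \<in> Mor C X X"
    and cmp_closed: "\<lbrakk>X \<in> Obj C; Y \<in> Obj C; Z \<in> Obj C; f \<in> Mor C X Y; g \<in> Mor C Y Z\<rbrakk>
          \<Longrightarrow> g \<cdot> f \<in> Mor C X Z"
    and cmp_id_right: "\<lbrakk>X \<in> Obj C; Y \<in> Obj C; f \<in> Mor C X Y\<rbrakk> \<Longrightarrow> f \<cdot> idm C X = f"
    and cmp_id_left: "\<lbrakk>X \<in> Obj C; Y \<in> Obj C; f \<in> Mor C X Y\<rbrakk> \<Longrightarrow> idm C Y \<cdot> f = f"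
    and cmp_assoc: "\<lbrakk>W \<in> Obj C; X \<in> Obj C; Y \<in> Obj C; Z \<in> Obj C;
          f \<in> Mor C W X; g \<in> Mor C X Y; h \<in> Mor C Y Z\<rbrakk> \<Longrightarrow> (h \<cdot> g) \<cdot> f = h \<cdot> (g \<cdot> f)"
    and cmp_add_right: "\<lbrakk>X \<in> Obj C; Y \<in> Obj C; Z \<in> Obj C;
          f \<in> Mor C X Y; f' \<in> Mor C X Y; g \<in> Mor C Y Z\<rbrakk>
          \<Longrightarrow> g \<cdot> (f \<otimes>\<^bsub>Hom C X Y\<^esub> f') = (g \<cdot> f) \<otimes>\<^bsub>Hom C X Z\<^esub> (g \<cdot> f')"
    and cmp_add_left: "\<lbrakk>X \<in> Obj C; Y \<in> Obj C; Z \<in> Obj C;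
          f \<in> Mor C X Y; g \<in> Mor C Y Z; g' \<in> Mor C Y Z\<rbrakk>
          \<Longrightarrow> (g \<otimes>\<^bsub>Hom C Y Z\<^esub> g') \<cdot> f = (g \<cdot> f) \<otimes>\<^bsub>Hom C X Z\<^esub> (g' \<cdot> f)"

definition zero_object :: "('o, 'm) cat \<Rightarrow> 'o \<Rightarrow> bool" where
  "zero_object C Z \<longleftrightarrow> Z \<in> Obj C \<and>
     (\<forall>X \<in> Obj C. (\<exists>!f. f \<in> Mor C X Z) \<and> (\<exists>!f. f \<in> Mor C Z X))"

text \<open>\<open>P\<close> is a direct sum of \<open>X\<close> and \<open>Y\<close> with inclusions \<open>i, j\<close> and projections \<open>p, q\<close>.\<close>

definition is_biproduct ::
    "('o, 'm) cat \<Rightarrow> 'o \<Rightarrow> 'o \<Rightarrow> 'o \<Rightarrow> 'm \<Rightarrow> 'm \<Rightarrow> 'm \<Rightarrow> 'm \<Rightarrow> bool" where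
  "is_biproduct C X Y P i j p q \<longleftrightarrow>
     X \<in> Obj C \<and> Y \<in> Obj C \<and> P \<in> Obj C \<and>
     i \<in> Mor C X P \<and> j \<in> Mor C Y P \<and> p \<in> Mor C P X \<and> q \<in> Mor C P Y \<and>
     p \<cdot>\<^bsub>C\<^esub> i = idm C X \<and> q \<cdot>\<^bsub>C\<^esub> j = idm C Y \<and>
     p \<cdot>\<^bsub>C\<^esub> j = zero_mor C Y X \<and> q \<cdot>\<^bsub>C\<^esub> i = zero_mor C X Y \<and>
     (i \<cdot>\<^bsub>C\<^esub> p) \<otimes>\<^bsub>Hom C P P\<^esub> (j \<cdot>\<^bsub>C\<^esub> q) = idm C P"

locale additive_category = preadditive_category +
  assumes ex_zero_object: "\<exists>Z. zero_object C Z"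
    and ex_biproduct: "\<lbrakk>X \<in> Obj C; Y \<in> Obj C\<rbrakk> \<Longrightarrow> \<exists>P i j p q. is_biproduct C X Y P i j p q"

definition is_iso :: "('o, 'm) cat \<Rightarrow> 'o \<Rightarrow> 'o \<Rightarrow> 'm \<Rightarrow> bool" where
  "is_iso C X Y f \<longleftrightarrow> f \<in> Mor C X Y \<and>
     (\<exists>g \<in> Mor C Y X. g \<cdot>\<^bsub>C\<^esub> f = idm C X \<and> f \<cdot>\<^bsub>C\<^esub> g = idm C Y)"


section \<open>Quasi-abelian categories\<close>

text \<open>\<open>k : K \<rightarrow> X\<close> is a kernel, respectively \<open>c : Y \<rightarrow> Q\<close> is a cokernel, of \<open>f : X \<rightarrow> Y\<close>.\<close>

definition is_kernel_of :: "('o, 'm) cat \<Rightarrow> 'o \<Rightarrow> 'o \<Rightarrow> 'm \<Rightarrow> 'o \<Rightarrow> 'm \<Rightarrow> bool" where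
  "is_kernel_of C X Y f K k \<longleftrightarrow>
     K \<in> Obj C \<and> k \<in> Mor C K X \<and> f \<cdot>\<^bsub>C\<^esub> k = zero_mor C K Y \<and>
     (\<forall>Z \<in> Obj C. \<forall>g \<in> Mor C Z X. f \<cdot>\<^bsub>C\<^esub> g = zero_mor C Z Y \<longrightarrow>
        (\<exists>!u. u \<in> Mor C Z K \<and> k \<cdot>\<^bsub>C\<^esub> u = g))"

definition is_cokernel_of :: "('o, 'm) cat \<Rightarrow> 'o \<Rightarrow> 'o \<Rightarrow> 'm \<Rightarrow> 'o \<Rightarrow> 'm \<Rightarrow> bool" where
  "is_cokernel_of C X Y f Q c \<longleftrightarrow>
     Q \<in> Obj C \<and> c \<in> Mor C Y Q \<and> c \<cdot>\<^bsub>C\<^esub> f = zero_mor C X Q \<and>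
     (\<forall>Z \<in> Obj C. \<forall>g \<in> Mor C Y Z. g \<cdot>\<^bsub>C\<^esub> f = zero_mor C X Z \<longrightarrow>
        (\<exists>!u. u \<in> Mor C Q Z \<and> u \<cdot>\<^bsub>C\<^esub> c = g))"

text \<open>\<open>k : K \<rightarrow> X\<close> is a kernel of some morphism; \<open>c : Y \<rightarrow> Q\<close> is a cokernel of some morphism.\<close>

definition is_kernel :: "('o, 'm) cat \<Rightarrow> 'o \<Rightarrow> 'o \<Rightarrow> 'm \<Rightarrow> bool" where
  "is_kernel C K X k \<longleftrightarrow> (\<exists>Y \<in> Obj C. \<exists>f \<in> Mor C X Y. is_kernel_of C X Y f K k)"

definition is_cokernel :: "('o, 'm) cat \<Rightarrow> 'o \<Rightarrow> 'o \<Rightarrow> 'm \<Rightarrow> bool" where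
  "is_cokernel C Y Q c \<longleftrightarrow> (\<exists>X \<in> Obj C. \<exists>f \<in> Mor C X Y. is_cokernel_of C X Y f Q c)"

text \<open>\<open>p : P \<rightarrow> X\<close>, \<open>q : P \<rightarrow> Y\<close> is a pullback of \<open>f : X \<rightarrow> Z\<close>, \<open>g : Y \<rightarrow> Z\<close>.\<close>

definition is_pullback ::
    "('o, 'm) cat \<Rightarrow> 'o \<Rightarrow> 'o \<Rightarrow> 'o \<Rightarrow> 'm \<Rightarrow> 'm \<Rightarrow> 'o \<Rightarrow> 'm \<Rightarrow> 'm \<Rightarrow> bool" where
  "is_pullback C X Y Z f g P p q \<longleftrightarrow>
     P \<in> Obj C \<and> p \<in> Mor C P X \<and> q \<in> Mor C P Y \<and> f \<cdot>\<^bsub>C\<^esub> p = g \<cdot>\<^bsub>C\<^esub> q \<and>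
     (\<forall>T \<in> Obj C. \<forall>u \<in> Mor C T X. \<forall>v \<in> Mor C T Y. f \<cdot>\<^bsub>C\<^esub> u = g \<cdot>\<^bsub>C\<^esub> v \<longrightarrow>
        (\<exists>!w. w \<in> Mor C T P \<and> p \<cdot>\<^bsub>C\<^esub> w = u \<and> q \<cdot>\<^bsub>C\<^esub> w = v))"

text \<open>\<open>p : X \<rightarrow> P\<close>, \<open>q : Y \<rightarrow> P\<close> is a pushout of \<open>f : Z \<rightarrow> X\<close>, \<open>g : Z \<rightarrow> Y\<close>.\<close>

definition is_pushout ::
    "('o, 'm) cat \<Rightarrow> 'o \<Rightarrow> 'o \<Rightarrow> 'o \<Rightarrow> 'm \<Rightarrow> 'm \<Rightarrow> 'o \<Rightarrow> 'm \<Rightarrow> 'm \<Rightarrow> bool" where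
  "is_pushout C X Y Z f g P p q \<longleftrightarrow>
     P \<in> Obj C \<and> p \<in> Mor C X P \<and> q \<in> Mor C Y P \<and> p \<cdot>\<^bsub>C\<^esub> f = q \<cdot>\<^bsub>C\<^esub> g \<and>
     (\<forall>T \<in> Obj C. \<forall>u \<in> Mor C X T. \<forall>v \<in> Mor C Y T. u \<cdot>\<^bsub>C\<^esub> f = v \<cdot>\<^bsub>C\<^esub> g \<longrightarrow>
        (\<exists>!w. w \<in> Mor C P T \<and> w \<cdot>\<^bsub>C\<^esub> p = u \<and> w \<cdot>\<^bsub>C\<^esub> q = v))"

locale preabelian_category = additive_category +
  assumes ex_kernel: "\<lbrakk>X \<in> Obj C; Y \<in> Obj C; f \<in> Mor C X Y\<rbrakk> \<Longrightarrow> \<exists>K k. is_kernel_of C X Y f K k"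
    and ex_cokernel: "\<lbrakk>X \<in> Obj C; Y \<in> Obj C; f \<in> Mor C X Y\<rbrakk> \<Longrightarrow> \<exists>Q c. is_cokernel_of C X Y f Q c"

locale left_quasi_abelian_category = preabelian_category +
  assumes cokernel_pullback:
    "\<lbrakk>X \<in> Obj C; Y \<in> Obj C; Z \<in> Obj C; c \<in> Mor C X Z; g \<in> Mor C Y Z;
      is_cokernel C X Z c; is_pullback C X Y Z c g P p q\<rbrakk> \<Longrightarrow> is_cokernel C P Y q"

locale right_quasi_abelian_category = preabelian_category +
  assumes kernel_pushout:
    "\<lbrakk>X \<in> Obj C; Y \<in> Obj C; Z \<in> Obj C; k \<in> Mor C Z X; g \<in> Mor C Z Y;
      is_kernel C Z X k; is_pushout C X Y Z k g P p q\<rbrakk> \<Longrightarrow> is_kernel C Y P q"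

locale quasi_abelian_category = left_quasi_abelian_category + right_quasi_abelian_category


section \<open>Extriangulated categories\<close>

text \<open>
  \<open>Ext E D A\<close> is the group \<open>\<bbbE>(D, A)\<close>. For \<open>g : D' \<rightarrow> D\<close> and \<open>f : A \<rightarrow> A'\<close>,
  \<open>Emap E g f\<close> is the map \<open>\<bbbE>(g, f) : \<bbbE>(D, A) \<rightarrow> \<bbbE>(D', A')\<close>.
\<close>

record ('o, 'm, 'e) bifun =
  Ext :: "'o \<Rightarrow> 'o \<Rightarrow> 'e monoid"
  Emap :: "'m \<Rightarrow> 'm \<Rightarrow> 'e \<Rightarrow> 'e"

locale biadditive_functor = additive_category B
  for B :: "('o, 'm) cat" (structure) +
  fixes E :: "('o, 'm, 'e) bifun"
  assumes ext_group: "\<lbrakk>D \<in> Obj B; A \<in> Obj B\<rbrakk> \<Longrightarrow> comm_group (Ext E D A)"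
    and Emap_hom: "\<lbrakk>D \<in> Obj B; D' \<in> Obj B; A \<in> Obj B; A' \<in> Obj B;
          g \<in> Mor B D' D; f \<in> Mor B A A'\<rbrakk> \<Longrightarrow> Emap E g f \<in> hom (Ext E D A) (Ext E D' A')"
    and Emap_id: "\<lbrakk>D \<in> Obj B; A \<in> Obj B; \<delta> \<in> carrier (Ext E D A)\<rbrakk>
          \<Longrightarrow> Emap E (idm B D) (idm B A) \<delta> = \<delta>"
    and Emap_cmp: "\<lbrakk>D \<in> Obj B; D' \<in> Obj B; D'' \<in> Obj B; A \<in> Obj B; A' \<in> Obj B; A'' \<in> Obj B;
          g \<in> Mor B D' D; g' \<in> Mor B D'' D'; f \<in> Mor B A A'; f' \<in> Mor B A' A'';
          \<delta> \<in> carrier (Ext E D A)\<rbrakk>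
          \<Longrightarrow> Emap E (g \<cdot> g') (f' \<cdot> f) \<delta> = Emap E g' f' (Emap E g f \<delta>)"
    and Emap_add_left: "\<lbrakk>D \<in> Obj B; D' \<in> Obj B; A \<in> Obj B; A' \<in> Obj B;
          g \<in> Mor B D' D; g' \<in> Mor B D' D; f \<in> Mor B A A'; \<delta> \<in> carrier (Ext E D A)\<rbrakk>
          \<Longrightarrow> Emap E (g \<otimes>\<^bsub>Hom B D' D\<^esub> g') f \<delta> = Emap E g f \<delta> \<otimes>\<^bsub>Ext E D' A'\<^esub> Emap E g' f \<delta>"
    and Emap_add_right: "\<lbrakk>D \<in> Obj B; D' \<in> Obj B; A \<in> Obj B; A' \<in> Obj B;
          g \<in> Mor B D' D; f \<in> Mor B A A'; f' \<in> Mor B A A'; \<delta> \<in> carrier (Ext E D A)\<rbrakk>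
          \<Longrightarrow> Emap E g (f \<otimes>\<^bsub>Hom B A A'\<^esub> f') \<delta> = Emap E g f \<delta> \<otimes>\<^bsub>Ext E D' A'\<^esub> Emap E g f' \<delta>"

text \<open>
  For \<open>\<delta> \<in> \<bbbE>(D, A)\<close>, \<open>push B E D f \<delta>\<close> is \<open>f\<^sub>* \<delta> = \<bbbE>(D, f)(\<delta>)\<close> and
  \<open>pull B E A g \<delta>\<close> is \<open>g\<^sup>* \<delta> = \<bbbE>(g, A)(\<delta>)\<close>.
\<close>

definition push :: "('o, 'm) cat \<Rightarrow> ('o, 'm, 'e) bifun \<Rightarrow> 'o \<Rightarrow> 'm \<Rightarrow> 'e \<Rightarrow> 'e" where
  "push B E D f \<delta> = Emap E (idm B D) f \<delta>"

definition pull :: "('o, 'm) cat \<Rightarrow> ('o, 'm, 'e) bifun \<Rightarrow> 'o \<Rightarrow> 'm \<Rightarrow> 'e \<Rightarrow> 'e" where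
  "pull B E A g \<delta> = Emap E g (idm B A) \<delta>"

text \<open>
  A sequence \<open>A \<rightarrow> M \<rightarrow> D\<close> with fixed ends is the pair of its two morphisms; they determine \<open>M\<close>.
\<close>

definition sequences :: "('o, 'm) cat \<Rightarrow> 'o \<Rightarrow> 'o \<Rightarrow> ('m \<times> 'm) set" where
  "sequences B A D = {(a, b). \<exists>M \<in> Obj B. a \<in> Mor B A M \<and> b \<in> Mor B M D}"

definition seq_equiv :: "('o, 'm) cat \<Rightarrow> 'o \<Rightarrow> 'o \<Rightarrow> ('m \<times> 'm) rel" where
  "seq_equiv B A D = {((a, b), (a', b')). \<exists>M \<in> Obj B. \<exists>M' \<in> Obj B.
     a \<in> Mor B A M \<and> b \<in> Mor B M D \<and> a' \<in> Mor B A M' \<and> b' \<in> Mor B M' D \<and>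
     (\<exists>g. is_iso B M M' g \<and> g \<cdot>\<^bsub>B\<^esub> a = a' \<and> b' \<cdot>\<^bsub>B\<^esub> g = b)}"

text \<open>\<open>s D A \<delta>\<close> is the class of sequences \<open>A \<rightarrow> M \<rightarrow> D\<close> assigned to \<open>\<delta> \<in> \<bbbE>(D, A)\<close>.\<close>

type_synonym ('o, 'm, 'e) seq_assignment = "'o \<Rightarrow> 'o \<Rightarrow> 'e \<Rightarrow> ('m \<times> 'm) set"

text \<open>\<open>\<delta> \<in> \<bbbE>(D, A)\<close> is realised by \<open>A \<rightarrow> M \<rightarrow> D\<close>, with morphisms \<open>a\<close> and \<open>b\<close>.\<close>

definition realised_by :: "('o, 'm) cat \<Rightarrow> ('o, 'm, 'e) bifun \<Rightarrow> ('o, 'm, 'e) seq_assignment \<Rightarrow>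
    'e \<Rightarrow> 'o \<Rightarrow> 'm \<Rightarrow> 'o \<Rightarrow> 'm \<Rightarrow> 'o \<Rightarrow> bool" where
  "realised_by B E s \<delta> A a M b D \<longleftrightarrow>
     A \<in> Obj B \<and> M \<in> Obj B \<and> D \<in> Obj B \<and> \<delta> \<in> carrier (Ext E D A) \<and>
     a \<in> Mor B A M \<and> b \<in> Mor B M D \<and> s D A \<delta> = seq_equiv B A D `` {(a, b)}"

definition conflation :: "('o, 'm) cat \<Rightarrow> ('o, 'm, 'e) bifun \<Rightarrow> ('o, 'm, 'e) seq_assignment \<Rightarrow>
    'o \<Rightarrow> 'm \<Rightarrow> 'o \<Rightarrow> 'm \<Rightarrow> 'o \<Rightarrow> bool" where
  "conflation B E s A a M b D \<longleftrightarrow> (\<exists>\<delta>. realised_by B E s \<delta> A a M b D)"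

text \<open>\<open>(f, h)\<close> is a morphism of extensions from \<open>\<delta> \<in> \<bbbE>(D, A)\<close> to \<open>\<delta>' \<in> \<bbbE>(D', A')\<close>.\<close>

definition ext_morphism :: "('o, 'm) cat \<Rightarrow> ('o, 'm, 'e) bifun \<Rightarrow>
    'o \<Rightarrow> 'o \<Rightarrow> 'e \<Rightarrow> 'o \<Rightarrow> 'o \<Rightarrow> 'e \<Rightarrow> 'm \<Rightarrow> 'm \<Rightarrow> bool" where
  "ext_morphism B E D A \<delta> D' A' \<delta>' f h \<longleftrightarrow>
     f \<in> Mor B A A' \<and> h \<in> Mor B D D' \<and> push B E D f \<delta> = pull B E A' h \<delta>'"

locale realisation = biadditive_functor B E
  for B :: "('o, 'm) cat" (structure) and E :: "('o, 'm, 'e) bifun" +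
  fixes s :: "('o, 'm, 'e) seq_assignment"
  assumes s_class: "\<lbrakk>D \<in> Obj B; A \<in> Obj B; \<delta> \<in> carrier (Ext E D A)\<rbrakk>
          \<Longrightarrow> s D A \<delta> \<in> sequences B A D // seq_equiv B A D"
    and s_realises: "\<lbrakk>realised_by B E s \<delta> A a M b D; realised_by B E s \<delta>' A' a' M' b' D';
          ext_morphism B E D A \<delta> D' A' \<delta>' f h\<rbrakk>
          \<Longrightarrow> \<exists>g \<in> Mor B M M'. g \<cdot> a = a' \<cdot> f \<and> b' \<cdot> g = h \<cdot> b"

text \<open>
  Direct sums are determined only up to isomorphism; the two conditions below are imposed for
  every choice of direct sums.
\<close>

locale additive_realisation = realisation B E s
  for B :: "('o, 'm) cat" (structure) and E :: "('o, 'm, 'e) bifun"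
    and s :: "('o, 'm, 'e) seq_assignment" +
  assumes s_zero: "is_biproduct B A D P i j p q
          \<Longrightarrow> realised_by B E s \<one>\<^bsub>Ext E D A\<^esub> A i P q D"
    and s_sum: "\<lbrakk>realised_by B E s \<delta> A a M b D; realised_by B E s \<delta>' A' a' M' b' D';
          is_biproduct B A A' AA iA iA' pA pA'; is_biproduct B M M' MM iM iM' pM pM';
          is_biproduct B D D' DD iD iD' pD pD'\<rbrakk>
          \<Longrightarrow> realised_by B E s
                (push B E DD iA (pull B E A pD \<delta>)
                   \<otimes>\<^bsub>Ext E DD AA\<^esub> push B E DD iA' (pull B E A' pD' \<delta>'))
                AA ((iM \<cdot> a \<cdot> pA) \<otimes>\<^bsub>Hom B AA MM\<^esub> (iM' \<cdot> a' \<cdot> pA'))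
                MM ((iD \<cdot> b \<cdot> pM) \<otimes>\<^bsub>Hom B MM DD\<^esub> (iD' \<cdot> b' \<cdot> pM'))
                DD"

locale extriangulated_category = additive_realisation B E s
  for B :: "('o, 'm) cat" (structure) and E :: "('o, 'm, 'e) bifun"
    and s :: "('o, 'm, 'e) seq_assignment" +
  assumes ET3: "\<lbrakk>realised_by B E s \<delta> A a M b D; realised_by B E s \<delta>' A' a' M' b' D';
          f \<in> Mor B A A'; g \<in> Mor B M M'; g \<cdot> a = a' \<cdot> f\<rbrakk>
          \<Longrightarrow> \<exists>h. ext_morphism B E D A \<delta> D' A' \<delta>' f h \<and> h \<cdot> b = b' \<cdot> g"
    and ET3_op: "\<lbrakk>realised_by B E s \<delta> A a M b D; realised_by B E s \<delta>' A' a' M' b' D';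
          g \<in> Mor B M M'; h \<in> Mor B D D'; h \<cdot> b = b' \<cdot> g\<rbrakk>
          \<Longrightarrow> \<exists>f. ext_morphism B E D A \<delta> D' A' \<delta>' f h \<and> g \<cdot> a = a' \<cdot> f"
    and ET4: "\<lbrakk>realised_by B E s \<delta> A a M a' D; realised_by B E s \<delta>' M b N b' F\<rbrakk>
          \<Longrightarrow> \<exists>G \<delta>'' c c' d e.
                realised_by B E s \<delta>'' A c N c' G \<and> d \<in> Mor B D G \<and> e \<in> Mor B G F \<and>
                c = b \<cdot> a \<and> c' \<cdot> b = d \<cdot> a' \<and> e \<cdot> c' = b' \<and>
                realised_by B E s (push B E F a' \<delta>') D d G e F \<and>
                pull B E A d \<delta>'' = \<delta> \<and> push B E G a \<delta>'' = pull B E M e \<delta>'"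
    and ET4_op: "\<lbrakk>realised_by B E s \<delta> D a' M a A; realised_by B E s \<delta>' F b' N b M\<rbrakk>
          \<Longrightarrow> \<exists>G \<delta>'' c c' d e.
                realised_by B E s \<delta>'' G c' N c A \<and> d \<in> Mor B G D \<and> e \<in> Mor B F G \<and>
                c = a \<cdot> b \<and> b \<cdot> c' = a' \<cdot> d \<and> c' \<cdot> e = b' \<and>
                realised_by B E s (pull B E F a' \<delta>') F e G d D \<and>
                push B E A d \<delta>'' = \<delta> \<and> pull B E G a \<delta>'' = push B E M e \<delta>'"


section \<open>Twin cotorsion pairs\<close>

text \<open>A full subcategory is given by its set of objects.\<close>

definition Cone :: "('o, 'm) cat \<Rightarrow> ('o, 'm, 'e) bifun \<Rightarrow> ('o, 'm, 'e) seq_assignment \<Rightarrow>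
    'o set \<Rightarrow> 'o set \<Rightarrow> 'o set" where
  "Cone B E s \<Y> \<X> = {Z \<in> Obj B. \<exists>Y \<in> \<Y>. \<exists>X \<in> \<X>. \<exists>a b. conflation B E s Y a X b Z}"

definition CoCone :: "('o, 'm) cat \<Rightarrow> ('o, 'm, 'e) bifun \<Rightarrow> ('o, 'm, 'e) seq_assignment \<Rightarrow>
    'o set \<Rightarrow> 'o set \<Rightarrow> 'o set" where
  "CoCone B E s \<Y> \<X> = {Z \<in> Obj B. \<exists>Y \<in> \<Y>. \<exists>X \<in> \<X>. \<exists>a b. conflation B E s Z a Y b X}"

definition full_subcategory :: "('o, 'm) cat \<Rightarrow> 'o set \<Rightarrow> ('o, 'm) cat" where
  "full_subcategory B \<U> = B\<lparr>Obj := \<U>\<rparr>"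

definition closed_under_summands :: "('o, 'm) cat \<Rightarrow> 'o set \<Rightarrow> bool" where
  "closed_under_summands B \<U> \<longleftrightarrow>
     (\<forall>X Y P i j p q. is_biproduct B X Y P i j p q \<and> P \<in> \<U> \<longrightarrow> X \<in> \<U> \<and> Y \<in> \<U>)"

definition additive_summand_closed :: "('o, 'm) cat \<Rightarrow> 'o set \<Rightarrow> bool" where
  "additive_summand_closed B \<U> \<longleftrightarrow>
     \<U> \<subseteq> Obj B \<and> additive_category (full_subcategory B \<U>) \<and> closed_under_summands B \<U>"

definition ext_vanish :: "('o, 'm, 'e) bifun \<Rightarrow> 'o set \<Rightarrow> 'o set \<Rightarrow> bool" where
  "ext_vanish E \<U> \<V> \<longleftrightarrow> (\<forall>U \<in> \<U>. \<forall>V \<in> \<V>. carrier (Ext E U V) = {\<one>\<^bsub>Ext E U V\<^esub>})"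

definition cotorsion_pair :: "('o, 'm) cat \<Rightarrow> ('o, 'm, 'e) bifun \<Rightarrow> ('o, 'm, 'e) seq_assignment \<Rightarrow>
    'o set \<Rightarrow> 'o set \<Rightarrow> bool" where
  "cotorsion_pair B E s \<U> \<V> \<longleftrightarrow>
     additive_summand_closed B \<U> \<and> additive_summand_closed B \<V> \<and> ext_vanish E \<U> \<V> \<and>
     Obj B = Cone B E s \<V> \<U> \<and> Obj B = CoCone B E s \<V> \<U>"

definition twin_cotorsion_pair :: "('o, 'm) cat \<Rightarrow> ('o, 'm, 'e) bifun \<Rightarrow>
    ('o, 'm, 'e) seq_assignment \<Rightarrow> 'o set \<Rightarrow> 'o set \<Rightarrow> 'o set \<Rightarrow> 'o set \<Rightarrow> bool" where
  "twin_cotorsion_pair B E s \<S> \<T> \<U> \<V> \<longleftrightarrow>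
     cotorsion_pair B E s \<S> \<T> \<and> cotorsion_pair B E s \<U> \<V> \<and> ext_vanish E \<S> \<V>"


section \<open>Ideals and additive quotients\<close>

definition factoring :: "('o, 'm) cat \<Rightarrow> 'o set \<Rightarrow> 'o \<Rightarrow> 'o \<Rightarrow> 'm set" where
  "factoring B \<W> X Y = {g \<cdot>\<^bsub>B\<^esub> f | f g Z. Z \<in> \<W> \<and> f \<in> Mor B X Z \<and> g \<in> Mor B Z Y}"

text \<open>
  The morphism groups of the quotient are the quotient groups of HOL-Algebra, whose elements are
  cosets. The composite of two cosets is the union of the cosets of all composites of
  representatives; when \<open>factoring B \<W>\<close> is an ideal, these cosets all coincide.
\<close>

definition additive_quotient :: "('o, 'm) cat \<Rightarrow> 'o set \<Rightarrow> 'o set \<Rightarrow> ('o, 'm set) cat" where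
  "additive_quotient B \<H> \<W> = \<lparr>
     Obj = \<H>,
     Hom = (\<lambda>X Y. Hom B X Y Mod factoring B \<W> X Y),
     idm = (\<lambda>X. factoring B \<W> X X #>\<^bsub>Hom B X X\<^esub> idm B X),
     cmp = (\<lambda>\<Gamma> \<Phi>. \<Union>{factoring B \<W> X Z #>\<^bsub>Hom B X Z\<^esub> (g \<cdot>\<^bsub>B\<^esub> f) | X Y Z f g.
              X \<in> \<H> \<and> Y \<in> \<H> \<and> Z \<in> \<H> \<and> f \<in> \<Phi> \<inter> Mor B X Y \<and> g \<in> \<Gamma> \<inter> Mor B Y Z})\<rparr>"

end

theory Submission
  imports Defs
begin

text \<open>
  By passing to the opposite category one may assume \<open>\<H> = \<B>\<^sup>-\<close>. This class has an orthogonality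
  description: \<open>X \<in> \<B>\<^sup>-\<close> iff every morphism \<open>X \<rightarrow> T\<close> with \<open>T \<in> \<T>\<close> pulls \<open>\<bbbE>(T, \<V>)\<close> back to zero. Call an
  extension \<open>\<delta> \<in> \<bbbE>(Y, A)\<close> good if every \<open>\<phi> : A \<rightarrow> T\<close> with \<open>T \<in> \<T>\<close> kills it, \<open>\<phi>\<^sub>* \<delta> = 0\<close>. Good extensions are stable
  under pullback and pushforward, \<open>\<B>\<^sup>-\<close> is closed under them, and if \<open>A \<rightarrow> N \<rightarrow> Y\<close> realises a good
  extension in \<open>\<B>\<^sup>-\<close>, then \<open>N \<rightarrow> Y\<close> is a cokernel of \<open>A \<rightarrow> N\<close> in the heart. Adding to the target of
  \<open>f : A \<rightarrow> X\<close> an object of \<open>\<W>\<close>, which does not change its class, turns \<open>f\<close> into the inflation of a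
  good conflation; so up to isomorphism all cokernels arise in this way, and pulling back good conflations
  gives pullbacks in the heart. Likewise the kernels are, up to isomorphism, the deflations \<open>K \<rightarrow> X\<close>
  with cocone in \<open>\<V>\<close>, and these are preserved by pushout along good inflations, by (ET4).
\<close>

section \<open>Preadditive categories\<close>

text \<open>The bridge from the quotient to the extension groups is a test by extensions. Let X in
  \<open>Bminus\<close> have a conflation X -> N -> S with class \<open>\<delta>\<close>, N in
  \<open>\<W>\<close> and S in \<open>\<S>\<close>: a morphism out of X factors through
  \<open>\<W>\<close> exactly when it pushes \<open>\<delta>\<close> to zero. Dually, for Y in
  \<open>Bplus\<close> with V -> N -> Y, a morphism into Y factors through \<open>\<W>\<close>
  exactly when it pulls that class back to zero. Under the hypothesis every object of the heart has
  both conflations, so uniqueness in the heart becomes a chase in exact sequences of extension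
  groups. The obstacle is that diagrams in the heart commute only up to morphisms through
  \<open>\<W>\<close>. Such an error is extended along a good inflation, or lifted along a morphism
  to whose source an approximation from \<open>\<W>\<close> has been added; the diagram then
  commutes strictly in \<open>B\<close>, where realisations apply. Kernels need a further
  correction: a deflation pulled back along X -> Y may start outside \<open>Bminus\<close>, and is
  composed with another deflation with cocone in \<open>\<V>\<close> to return there. Existence of
  kernels and cokernels in the heart is proved, not presupposed.\<close>

context preadditive_category
begin

text \<open>Disjoint morphism sets let each arrow carry its own ends. Typing conditions then become
  equations on \<open>src\<close> and \<open>tgt\<close> that the simplifier discharges, and sums
  and negatives need no objects as indices.\<close>

definition mor :: "'m \<Rightarrow> bool" where
  "mor f \<longleftrightarrow> (\<exists>X \<in> Obj C. \<exists>Y \<in> Obj C. f \<in> Mor C X Y)"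

definition src :: "'m \<Rightarrow> 'o" where
  "src f = (THE X. X \<in> Obj C \<and> (\<exists>Y \<in> Obj C. f \<in> Mor C X Y))"

definition tgt :: "'m \<Rightarrow> 'o" where
  "tgt f = (THE Y. Y \<in> Obj C \<and> (\<exists>X \<in> Obj C. f \<in> Mor C X Y))"

definition add :: "'m \<Rightarrow> 'm \<Rightarrow> 'm"  (infixl "\<boxplus>" 65) where
  "f \<boxplus> g = f \<otimes>\<^bsub>Hom C (src f) (tgt f)\<^esub> g"

definition neg :: "'m \<Rightarrow> 'm" where
  "neg f = inv\<^bsub>Hom C (src f) (tgt f)\<^esub> f"

lemma Mor_src_tgt:
  assumes "X \<in> Obj C" "Y \<in> Obj C" "f \<in> Mor C X Y"
  shows "mor f" "src f = X" "tgt f = Y"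
proof -
  show "mor f" using assms mor_def by blast
  show "src f = X" unfolding src_def
    by (rule the_equality) (use assms hom_disjoint in blast)+
  show "tgt f = Y" unfolding tgt_def
    by (rule the_equality) (use assms hom_disjoint in blast)+
qed

lemma Mor_iff [simp]:
  "\<lbrakk>X \<in> Obj C; Y \<in> Obj C\<rbrakk> \<Longrightarrow> f \<in> Mor C X Y \<longleftrightarrow> mor f \<and> src f = X \<and> tgt f = Y"
  by (metis Mor_src_tgt mor_def)

lemma src_obj [simp]: "mor f \<Longrightarrow> src f \<in> Obj C"
  and tgt_obj [simp]: "mor f \<Longrightarrow> tgt f \<in> Obj C"
  by (metis Mor_src_tgt mor_def)+

lemma mor_Mor: "mor f \<Longrightarrow> f \<in> Mor C (src f) (tgt f)"
  by simp

lemma mor_id [simp]: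
  assumes "X \<in> Obj C" shows "mor (idm C X)" "src (idm C X) = X" "tgt (idm C X) = X"
  using id_closed[OF assms] assms by simp_all

lemma mor_zero [simp]:
  assumes "X \<in> Obj C" "Y \<in> Obj C"
  shows "mor (zero_mor C X Y)" "src (zero_mor C X Y) = X" "tgt (zero_mor C X Y) = Y"
proof -
  interpret comm_group "Hom C X Y" by (rule hom_group[OF assms])
  have "zero_mor C X Y \<in> Mor C X Y" by (rule one_closed)
  then show "mor (zero_mor C X Y)" "src (zero_mor C X Y) = X" "tgt (zero_mor C X Y) = Y"
    by (rule Mor_src_tgt[OF assms])+
qed

lemma mor_cmp [simp]:
  assumes "mor f" "mor g" "src g = tgt f"
  shows "mor (g \<cdot> f)" "src (g \<cdot> f) = src f" "tgt (g \<cdot> f) = tgt g"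
proof -
  have "g \<cdot> f \<in> Mor C (src f) (tgt g)"
    using assms cmp_closed[of "src f" "tgt f" "tgt g" f g] by simp
  then show "mor (g \<cdot> f)" "src (g \<cdot> f) = src f" "tgt (g \<cdot> f) = tgt g"
    using assms by simp_all
qed

lemma cmp_ids [simp]:
  "mor f \<Longrightarrow> X = src f \<Longrightarrow> f \<cdot> idm C X = f"
  "mor f \<Longrightarrow> X = tgt f \<Longrightarrow> idm C X \<cdot> f = f"
  using cmp_id_right[of "src f" "tgt f" f] cmp_id_left[of "src f" "tgt f" f] by simp_all

lemma assoc [simp]:
  "\<lbrakk>mor f; mor g; mor h; src g = tgt f; src h = tgt g\<rbrakk> \<Longrightarrow> (h \<cdot> g) \<cdot> f = h \<cdot> (g \<cdot> f)"
  using cmp_assoc[of "src f" "tgt f" "tgt g" "tgt h" f g h] by simp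

lemma mult_add [simp]:
  "\<lbrakk>mor f; src f = X; tgt f = Y\<rbrakk> \<Longrightarrow> f \<otimes>\<^bsub>Hom C X Y\<^esub> g = f \<boxplus> g"
  by (auto simp: add_def)

lemma inv_neg [simp]: "\<lbrakk>mor f; src f = X; tgt f = Y\<rbrakk> \<Longrightarrow> inv\<^bsub>Hom C X Y\<^esub> f = neg f"
  by (auto simp: neg_def)

lemma mor_add [simp]:
  assumes "mor f" "mor g" "src g = src f" "tgt g = tgt f"
  shows "mor (f \<boxplus> g)" "src (f \<boxplus> g) = src f" "tgt (f \<boxplus> g) = tgt f"
proof -
  interpret comm_group "Hom C (src f) (tgt f)" by (rule hom_group) (use assms in auto)
  have "f \<boxplus> g \<in> Mor C (src f) (tgt f)"
    unfolding add_def using assms by (intro m_closed) auto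
  then show "mor (f \<boxplus> g)" "src (f \<boxplus> g) = src f" "tgt (f \<boxplus> g) = tgt f"
    using assms by simp_all
qed

lemma mor_neg [simp]:
  assumes "mor f"
  shows "mor (neg f)" "src (neg f) = src f" "tgt (neg f) = tgt f"
proof -
  interpret comm_group "Hom C (src f) (tgt f)" by (rule hom_group) (use assms in auto)
  have "neg f \<in> Mor C (src f) (tgt f)"
    unfolding neg_def using assms by (intro inv_closed) auto
  then show "mor (neg f)" "src (neg f) = src f" "tgt (neg f) = tgt f"
    using assms by simp_all
qed

lemma add_comm: "\<lbrakk>mor f; mor g; src g = src f; tgt g = tgt f\<rbrakk> \<Longrightarrow> f \<boxplus> g = g \<boxplus> f"
  using comm_group.axioms(1)[OF hom_group, of "src f" "tgt f"]
    comm_monoid.m_comm[of "Hom C (src f) (tgt f)" f g] by simp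

lemma add_assoc:
  assumes "mor f" "mor g" "mor h" "src g = src f" "tgt g = tgt f" "src h = src f" "tgt h = tgt f"
  shows "f \<boxplus> g \<boxplus> h = f \<boxplus> (g \<boxplus> h)"
proof -
  interpret comm_group "Hom C (src f) (tgt f)" by (rule hom_group) (use assms in auto)
  show ?thesis using m_assoc[of f g h] assms by simp
qed

lemma add_left_comm:
  assumes "mor f" "mor g" "mor h" "src g = src f" "tgt g = tgt f" "src h = src f" "tgt h = tgt f"
  shows "f \<boxplus> (g \<boxplus> h) = g \<boxplus> (f \<boxplus> h)"
  using assms add_assoc[of f g h] add_assoc[of g f h] add_comm[of f g] by simp

lemmas add_ac = add_assoc add_comm add_left_comm

lemma add_zero [simp]:
  assumes "mor f" "X = src f" "Y = tgt f"
  shows "f \<boxplus> zero_mor C X Y = f" "zero_mor C X Y \<boxplus> f = f"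
proof -
  interpret comm_group "Hom C (src f) (tgt f)" by (rule hom_group) (use assms in auto)
  show "f \<boxplus> zero_mor C X Y = f" using assms by (metis add_def r_one mor_Mor)
  then show "zero_mor C X Y \<boxplus> f = f" using add_comm[of f "zero_mor C X Y"] assms by simp
qed

lemma add_neg [simp]:
  assumes "mor f"
  shows "f \<boxplus> neg f = zero_mor C (src f) (tgt f)" "neg f \<boxplus> f = zero_mor C (src f) (tgt f)"
proof -
  interpret comm_group "Hom C (src f) (tgt f)" by (rule hom_group) (use assms in auto)
  show "f \<boxplus> neg f = zero_mor C (src f) (tgt f)" using assms by (metis add_def neg_def r_inv mor_Mor)
  then show "neg f \<boxplus> f = zero_mor C (src f) (tgt f)" using add_comm[of f "neg f"] assms by simp
qed

lemma add_neg_cancel: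
  assumes "mor f" "mor g" "src g = src f" "tgt g = tgt f"
  shows "f \<boxplus> (g \<boxplus> neg f) = g" "f \<boxplus> (neg f \<boxplus> g) = g" "f \<boxplus> neg g \<boxplus> g = f"
proof -
  show 1: "f \<boxplus> (neg f \<boxplus> g) = g"
    using add_assoc[of f "neg f" g] assms by simp
  then show "f \<boxplus> (g \<boxplus> neg f) = g" using add_comm[of g "neg f"] assms by simp
  show "f \<boxplus> neg g \<boxplus> g = f"
    using add_assoc[of f "neg g" g] add_neg(2)[of g] add_zero(1)[of f] assms mor_neg[of g] by metis
qed

lemma distrib_left [simp]:
  "\<lbrakk>mor f; mor f'; mor g; src f' = src f; tgt f' = tgt f; src g = tgt f\<rbrakk>
     \<Longrightarrow> g \<cdot> (f \<boxplus> f') = g \<cdot> f \<boxplus> g \<cdot> f'"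
  using cmp_add_right[of "src f" "tgt f" "tgt g" f f' g] by simp

lemma distrib_right [simp]:
  "\<lbrakk>mor f; mor g; mor g'; src g' = src g; tgt g' = tgt g; src g = tgt f\<rbrakk>
     \<Longrightarrow> (g \<boxplus> g') \<cdot> f = g \<cdot> f \<boxplus> g' \<cdot> f"
  using cmp_add_left[of "src f" "tgt f" "tgt g" f g g'] by simp

lemma add_self_zero:
  assumes "mor f" "f \<boxplus> f = f" shows "f = zero_mor C (src f) (tgt f)"
  using add_assoc[of f f "neg f"] add_zero(1)[of f] add_neg(1)[of f] assms by (metis mor_neg)

text \<open>Additivity of composition makes the composite equal to its own double, and in a group
  only zero has this property.\<close>

lemma cmp_zero [simp]:
  assumes "mor g" "Y = src g" "X \<in> Obj C" shows "g \<cdot> zero_mor C X Y = zero_mor C X (tgt g)"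
proof -
  have "g \<cdot> zero_mor C X Y = g \<cdot> zero_mor C X Y \<boxplus> g \<cdot> zero_mor C X Y"
    using distrib_left[of "zero_mor C X Y" "zero_mor C X Y" g] add_zero(1)[of "zero_mor C X Y" X Y]
      mor_zero[of X Y] assms by (metis src_obj)
  from add_self_zero[OF _ this[symmetric]] show ?thesis using assms by simp
qed

lemma zero_cmp [simp]:
  assumes "mor f" "Y = tgt f" "Z \<in> Obj C" shows "zero_mor C Y Z \<cdot> f = zero_mor C (src f) Z"
proof -
  have "zero_mor C Y Z \<cdot> f = zero_mor C Y Z \<cdot> f \<boxplus> zero_mor C Y Z \<cdot> f"
    using distrib_right[of f "zero_mor C Y Z" "zero_mor C Y Z"] add_zero(1)[of "zero_mor C Y Z" Y Z]
      mor_zero[of Y Z] assms by (metis tgt_obj)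
  from add_self_zero[OF _ this[symmetric]] show ?thesis using assms by simp
qed

lemma neg_unique:
  assumes "mor f" "mor g" "src g = src f" "tgt g = tgt f"
    "f \<boxplus> g = zero_mor C (src f) (tgt f)"
  shows "g = neg f"
  using add_neg_cancel(2)[of "neg f" g] add_assoc[of "neg f" f g] assms by simp

lemma cmp_neg [simp]:
  assumes "mor f" "mor g" "src g = tgt f"
  shows "g \<cdot> neg f = neg (g \<cdot> f)" "neg g \<cdot> f = neg (g \<cdot> f)"
proof -
  show "g \<cdot> neg f = neg (g \<cdot> f)"
    using distrib_left[of f "neg f" g] assms by (intro neg_unique) (simp_all del: distrib_left)
  show "neg g \<cdot> f = neg (g \<cdot> f)"
    using distrib_right[of f g "neg g"] assms by (intro neg_unique) (simp_all del: distrib_right)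
qed

lemma neg_neg [simp]: "mor f \<Longrightarrow> neg (neg f) = f"
  by (rule neg_unique[symmetric]) simp_all

lemma neg_zero [simp]:
  "X \<in> Obj C \<Longrightarrow> Y \<in> Obj C \<Longrightarrow> neg (zero_mor C X Y) = zero_mor C X Y"
  by (rule neg_unique[symmetric]) simp_all

text \<open>A single equation between morphisms, unlike the universal property, passes directly to
  an additive quotient.\<close>

lemma zero_object_iff_id:
  assumes "Z \<in> Obj C" shows "zero_object C Z \<longleftrightarrow> idm C Z = zero_mor C Z Z"
proof
  assume "zero_object C Z"
  then have "\<exists>!f. f \<in> Mor C Z Z" using assms zero_object_def by metis
  then show "idm C Z = zero_mor C Z Z" using assms by (metis Mor_iff mor_id mor_zero)
next
  assume id: "idm C Z = zero_mor C Z Z"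
  have "f = zero_mor C X Z" if "X \<in> Obj C" "f \<in> Mor C X Z" for f X
    using that assms id cmp_ids(2)[of f Z] zero_cmp[of f Z Z] by (metis Mor_iff)
  moreover have "f = zero_mor C Z X" if "X \<in> Obj C" "f \<in> Mor C Z X" for f X
    using that assms id cmp_ids(1)[of f Z] cmp_zero[of f Z Z] by (metis Mor_iff)
  moreover have "zero_mor C X Z \<in> Mor C X Z" "zero_mor C Z X \<in> Mor C Z X" if "X \<in> Obj C" for X
    using that assms by simp_all
  ultimately show "zero_object C Z"
    unfolding zero_object_def using assms by blast
qed

lemma biproductD:
  assumes "is_biproduct C X Y P i j p q"
  shows "X \<in> Obj C" "Y \<in> Obj C" "P \<in> Obj C"
    "mor i" "src i = X" "tgt i = P" "mor j" "src j = Y" "tgt j = P"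
    "mor p" "src p = P" "tgt p = X" "mor q" "src q = P" "tgt q = Y"
    "p \<cdot> i = idm C X" "q \<cdot> j = idm C Y" "p \<cdot> j = zero_mor C Y X" "q \<cdot> i = zero_mor C X Y"
    "i \<cdot> p \<boxplus> j \<cdot> q = idm C P"
  using assms unfolding is_biproduct_def by auto

lemma biproductI:
  assumes "X \<in> Obj C" "Y \<in> Obj C" "P \<in> Obj C"
    "mor i" "src i = X" "tgt i = P" "mor j" "src j = Y" "tgt j = P"
    "mor p" "src p = P" "tgt p = X" "mor q" "src q = P" "tgt q = Y"
    "p \<cdot> i = idm C X" "q \<cdot> j = idm C Y" "p \<cdot> j = zero_mor C Y X" "q \<cdot> i = zero_mor C X Y"
    "i \<cdot> p \<boxplus> j \<cdot> q = idm C P"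
  shows "is_biproduct C X Y P i j p q"
  using assms unfolding is_biproduct_def by auto

lemma biproduct_commute:
  assumes "is_biproduct C X Y P i j p q" shows "is_biproduct C Y X P j i q p"
proof -
  note b [simp] = biproductD[OF assms]
  show ?thesis by (rule biproductI) (simp_all add: add_comm[of "j \<cdot> q" "i \<cdot> p"])
qed

lemma biproduct_zero:
  assumes "X \<in> Obj C" "zero_object C Z"
  shows "is_biproduct C X Z X (idm C X) (zero_mor C Z X) (idm C X) (zero_mor C X Z)"
proof -
  have "Z \<in> Obj C" "idm C Z = zero_mor C Z Z"
    using assms zero_object_def zero_object_iff_id by metis+
  then show ?thesis using assms(1) by (intro biproductI) simp_all
qed

text \<open>The change of coordinates \<open>(x, y) \<mapsto> (x, y + f x)\<close> on a direct sum.\<close>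

lemma biproduct_shear:
  assumes "is_biproduct C X Y P i j p q" "mor f" "src f = X" "tgt f = Y"
  shows "is_biproduct C X Y P (i \<boxplus> j \<cdot> f) j p (q \<boxplus> neg (f \<cdot> p))"
proof -
  note b [simp] = biproductD[OF assms(1)]
  have 1 [simp]: "p \<cdot> (j \<cdot> f) = zero_mor C X X" "q \<cdot> (j \<cdot> f) = f"
    using assoc[of f j p] assoc[of f j q] assms by (simp_all del: assoc)
  have "i \<cdot> p \<boxplus> j \<cdot> (f \<cdot> p) \<boxplus> (j \<cdot> q \<boxplus> neg (j \<cdot> (f \<cdot> p))) =
        i \<cdot> p \<boxplus> j \<cdot> q \<boxplus> (j \<cdot> (f \<cdot> p) \<boxplus> neg (j \<cdot> (f \<cdot> p)))"
    using assms(2-) by (simp add: add_ac del: b(20) add_neg)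
  also have "\<dots> = idm C P" using assms(2-) by (simp add: biproductD[OF assms(1)])
  finally show ?thesis using assms(2-) by (intro biproductI) simp_all
qed

text \<open>Needed to turn a conflation isomorphic to a split one into a direct sum with prescribed
  inclusion and projection.\<close>

lemma biproduct_iso:
  assumes "is_biproduct C X Y P i j p q" "mor g" "src g = P" "tgt g = P'"
    "mor h" "src h = P'" "tgt h = P" "h \<cdot> g = idm C P" "g \<cdot> h = idm C P'"
  shows "is_biproduct C X Y P' (g \<cdot> i) (g \<cdot> j) (p \<cdot> h) (q \<cdot> h)"
proof -
  note b [simp] = biproductD[OF assms(1)]
  note [simp] = assms(2-)
  have P' [simp]: "P' \<in> Obj C" using tgt_obj[of g] by simp
  have hg [simp]: "h \<cdot> (g \<cdot> x) = x" if "mor x" "tgt x = P" for x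
    using assoc[of x g h] that by (simp del: assoc)
  have "g \<cdot> (i \<cdot> (p \<cdot> h)) \<boxplus> g \<cdot> (j \<cdot> (q \<cdot> h)) = g \<cdot> ((i \<cdot> p \<boxplus> j \<cdot> q) \<cdot> h)"
    by (simp del: b(20))
  also have "\<dots> = idm C P'" by simp
  finally show ?thesis by (intro biproductI) simp_all
qed

lemma iso_inverse:
  assumes "is_iso C X Y f" "X \<in> Obj C" "Y \<in> Obj C"
  shows "mor f" "src f = X" "tgt f = Y"
    and "\<exists>g. mor g \<and> src g = Y \<and> tgt g = X \<and> g \<cdot> f = idm C X \<and> f \<cdot> g = idm C Y"
  using assms unfolding is_iso_def by auto

end

section \<open>Opposite categories\<close>

text \<open>Arrows keep their type and only ends and composites are reversed. The double opposite is
  literally the original record, so dual statements arise by rewriting, without any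
  transport.\<close>

definition op_cat :: "('o, 'm) cat \<Rightarrow> ('o, 'm) cat" where
  "op_cat C = \<lparr>Obj = Obj C, Hom = (\<lambda>X Y. Hom C Y X), idm = idm C, cmp = (\<lambda>g f. f \<cdot>\<^bsub>C\<^esub> g)\<rparr>"

lemma op_cat_simps [simp]:
  "Obj (op_cat C) = Obj C" "Hom (op_cat C) X Y = Hom C Y X" "idm (op_cat C) = idm C"
  "g \<cdot>\<^bsub>op_cat C\<^esub> f = f \<cdot>\<^bsub>C\<^esub> g"
  by (simp_all add: op_cat_def)

lemma op_op_cat [simp]: "op_cat (op_cat C) = C"
  by (simp add: op_cat_def)

lemma preadditive_category_op:
  assumes "preadditive_category C" shows "preadditive_category (op_cat C)"
proof -
  interpret preadditive_category C by fact
  show ?thesis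
  proof (rule preadditive_category.intro)
    fix W X Y Z f g h
    assume "W \<in> Obj (op_cat C)" "X \<in> Obj (op_cat C)" "Y \<in> Obj (op_cat C)" "Z \<in> Obj (op_cat C)"
      "f \<in> Mor (op_cat C) W X" "g \<in> Mor (op_cat C) X Y" "h \<in> Mor (op_cat C) Y Z"
    then show "h \<cdot>\<^bsub>op_cat C\<^esub> g \<cdot>\<^bsub>op_cat C\<^esub> f = h \<cdot>\<^bsub>op_cat C\<^esub> (g \<cdot>\<^bsub>op_cat C\<^esub> f)"
      by simp
  qed (simp_all add: hom_group)
qed

lemma zero_object_op [simp]: "zero_object (op_cat C) Z \<longleftrightarrow> zero_object C Z"
  by (auto simp: zero_object_def)

lemma is_biproduct_op:
  "is_biproduct (op_cat C) X Y P i j p q \<longleftrightarrow> is_biproduct C X Y P p q i j"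
  by (auto simp: is_biproduct_def)

lemma additive_category_op:
  assumes "additive_category C" shows "additive_category (op_cat C)"
proof -
  interpret additive_category C by fact
  interpret op: preadditive_category "op_cat C"
    by (rule preadditive_category_op) (rule preadditive_category_axioms)
  show ?thesis
  proof
    show "\<exists>Z. zero_object (op_cat C) Z" using ex_zero_object by simp
    show "\<exists>P i j p q. is_biproduct (op_cat C) X Y P i j p q"
      if "X \<in> Obj (op_cat C)" "Y \<in> Obj (op_cat C)" for X Y
      using ex_biproduct[of X Y] that unfolding is_biproduct_op by simp metis
  qed
qed

lemma is_iso_op: "is_iso (op_cat C) X Y f \<longleftrightarrow> is_iso C Y X f"
  by (auto simp: is_iso_def)

lemma is_kernel_of_op: "is_kernel_of (op_cat C) X Y f K k \<longleftrightarrow> is_cokernel_of C Y X f K k"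
  by (simp add: is_kernel_of_def is_cokernel_of_def)

lemma is_cokernel_of_op: "is_cokernel_of (op_cat C) X Y f K k \<longleftrightarrow> is_kernel_of C Y X f K k"
  by (simp add: is_kernel_of_def is_cokernel_of_def)

lemma is_kernel_op: "is_kernel (op_cat C) K X k \<longleftrightarrow> is_cokernel C X K k"
  by (simp add: is_kernel_def is_cokernel_def is_kernel_of_op)

lemma is_cokernel_op: "is_cokernel (op_cat C) K X k \<longleftrightarrow> is_kernel C X K k"
  by (simp add: is_kernel_def is_cokernel_def is_cokernel_of_op)

lemma is_pullback_op: "is_pullback (op_cat C) X Y Z f g P p q \<longleftrightarrow> is_pushout C X Y Z f g P p q"
  by (simp add: is_pullback_def is_pushout_def)

lemma is_pushout_op: "is_pushout (op_cat C) X Y Z f g P p q \<longleftrightarrow> is_pullback C X Y Z f g P p q"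
  by (simp add: is_pullback_def is_pushout_def)

text \<open>Kernels trade places with cokernels and pullbacks with pushouts, so the left and right
  halves of the property are exchanged.\<close>

lemma quasi_abelian_category_op:
  assumes "quasi_abelian_category C" shows "quasi_abelian_category (op_cat C)"
proof -
  interpret quasi_abelian_category C by fact
  interpret op: additive_category "op_cat C"
    by (rule additive_category_op) (rule additive_category_axioms)
  show ?thesis
  proof
    fix X Y f assume "X \<in> Obj (op_cat C)" "Y \<in> Obj (op_cat C)" "f \<in> Mor (op_cat C) X Y"
    then show "\<exists>K k. is_kernel_of (op_cat C) X Y f K k" "\<exists>Q c. is_cokernel_of (op_cat C) X Y f Q c"
      using ex_kernel[of Y X f] ex_cokernel[of Y X f]
      by (simp_all add: is_kernel_of_op is_cokernel_of_op)
  next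
    fix X Y Z c g P p q
    assume "X \<in> Obj (op_cat C)" "Y \<in> Obj (op_cat C)" "Z \<in> Obj (op_cat C)"
      "c \<in> Mor (op_cat C) X Z" "g \<in> Mor (op_cat C) Y Z"
      "is_cokernel (op_cat C) X Z c" "is_pullback (op_cat C) X Y Z c g P p q"
    then show "is_cokernel (op_cat C) P Y q"
      using kernel_pushout[of X Y Z c g P p q] by (simp add: is_pullback_op is_cokernel_op)
  next
    fix X Y Z k g P p q
    assume "X \<in> Obj (op_cat C)" "Y \<in> Obj (op_cat C)" "Z \<in> Obj (op_cat C)"
      "k \<in> Mor (op_cat C) Z X" "g \<in> Mor (op_cat C) Z Y"
      "is_kernel (op_cat C) Z X k" "is_pushout (op_cat C) X Y Z k g P p q"
    then show "is_kernel (op_cat C) Y P q"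
      using cokernel_pullback[of X Y Z k g P p q] by (simp add: is_pushout_op is_kernel_op)
  qed
qed

section \<open>Invariance of limits under isomorphism\<close>

context preadditive_category
begin

lemma ex1_eq: "\<exists>!w. P w \<Longrightarrow> P x \<Longrightarrow> P y \<Longrightarrow> x = y"
  by blast

text \<open>Precomposition with the inverse of \<open>r\<close> turns test morphisms on
  \<open>P'\<close> into test morphisms on \<open>P\<close>. This later carries a cokernel computed
  on an enlarged object back to the object one started with.\<close>

lemma is_cokernel_of_cmp_iso:
  assumes co: "is_cokernel_of C X P f Y q" and iso: "is_iso C P' P r"
    and [simp]: "X \<in> Obj C" "P \<in> Obj C" "P' \<in> Obj C" "Y \<in> Obj C"
    and f': "f' \<in> Mor C X P'" "r \<cdot> f' = f"
  shows "is_cokernel_of C X P' f' Y (q \<cdot> r)"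
proof -
  obtain r' where r [simp]: "mor r" "src r = P'" "tgt r = P" "mor r'" "src r' = P" "tgt r' = P'"
      "r' \<cdot> r = idm C P'" "r \<cdot> r' = idm C P"
    using iso_inverse[OF iso] by auto
  have fs [simp]: "mor f'" "src f' = X" "tgt f' = P'" using f'(1) by simp_all
  have q [simp]: "mor q" "src q = P" "tgt q = Y" and qf [simp]: "q \<cdot> f = zero_mor C X Y"
    and univ: "\<And>Z g. \<lbrakk>Z \<in> Obj C; g \<in> Mor C P Z; g \<cdot> f = zero_mor C X Z\<rbrakk> \<Longrightarrow> \<exists>!u. u \<in> Mor C Y Z \<and> u \<cdot> q = g"
    using co unfolding is_cokernel_of_def by auto
  have rr [simp]: "r' \<cdot> (r \<cdot> x) = x" if "mor x" "tgt x = P'" for x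
    using assoc[of x r r'] that by (simp del: assoc)
  have rr' [simp]: "r \<cdot> (r' \<cdot> x) = x" if "mor x" "tgt x = P" for x
    using assoc[of x r' r] that by (simp del: assoc)
  have f: "f' = r' \<cdot> f" using rr[of f'] by (simp add: f'(2))
  have "f \<in> Mor C X P" using mor_cmp[of f' r] by (simp add: f'(2))
  then have [simp]: "mor f" "src f = X" "tgt f = P" by simp_all
  show ?thesis
    unfolding is_cokernel_of_def
  proof (intro conjI ballI impI)
    show "q \<cdot> r \<cdot> f' = zero_mor C X Y" by (simp add: f'(2))
    fix Z g assume Z: "Z \<in> Obj C" and g: "g \<in> Mor C P' Z" "g \<cdot> f' = zero_mor C X Z"
    then have g' [simp]: "mor g" "src g = P'" "tgt g = Z" by simp_all
    have "g \<cdot> r' \<cdot> f = zero_mor C X Z" using g(2) unfolding f by simp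
    then obtain u where u: "u \<in> Mor C Y Z" "u \<cdot> q = g \<cdot> r'"
      and un: "\<And>u'. u' \<in> Mor C Y Z \<Longrightarrow> u' \<cdot> q = g \<cdot> r' \<Longrightarrow> u' = u"
      using univ[of Z "g \<cdot> r'"] Z by auto
    have us [simp]: "mor u" "src u = Y" "tgt u = Z" using u(1) Z by simp_all
    show "\<exists>!u. u \<in> Mor C Y Z \<and> u \<cdot> (q \<cdot> r) = g"
    proof (rule ex1I[of _ u])
      show "u \<in> Mor C Y Z \<and> u \<cdot> (q \<cdot> r) = g" using u assoc[of r q u] by (simp del: assoc, simp)
      fix w assume w: "w \<in> Mor C Y Z \<and> w \<cdot> (q \<cdot> r) = g"
      then have ws [simp]: "mor w" "src w = Y" "tgt w = Z" using Z by simp_all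
      have "w \<cdot> q = g \<cdot> r'" using w by auto
      then show "w = u" using w by (intro un) simp_all
    qed
  qed simp_all
qed

lemma is_cokernel_cmp_iso:
  assumes "is_cokernel C P Y q" "is_iso C P' P r" "P \<in> Obj C" "P' \<in> Obj C" "Y \<in> Obj C"
  shows "is_cokernel C P' Y (q \<cdot> r)"
proof -
  obtain X f where X: "X \<in> Obj C" and f: "f \<in> Mor C X P" and co: "is_cokernel_of C X P f Y q"
    using assms(1) unfolding is_cokernel_def by blast
  obtain r' where r: "mor r" "src r = P'" "tgt r = P" "mor r'" "src r' = P" "tgt r' = P'"
      "r \<cdot> r' = idm C P"
    using iso_inverse[OF assms(2,4,3)] by blast
  have "r' \<cdot> f \<in> Mor C X P'" using r X f assms by simp
  moreover have "r \<cdot> (r' \<cdot> f) = f" using assoc[of f r' r] r X f assms by (simp del: assoc)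
  ultimately show ?thesis
    using is_cokernel_of_cmp_iso[OF co assms(2)] X assms unfolding is_cokernel_def by blast
qed

text \<open>The axioms to be verified speak of an arbitrary cokernel; this compares it with the one
  that is constructed.\<close>

lemma cokernel_of_unique:
  assumes "is_cokernel_of C X Y f Q c" "is_cokernel_of C X Y f Q' c'" "Y \<in> Obj C"
  shows "\<exists>v. is_iso C Q Q' v \<and> v \<cdot> c = c'"
proof -
  have Q [simp]: "Q \<in> Obj C" "Q' \<in> Obj C" and c: "c \<in> Mor C Y Q" "c' \<in> Mor C Y Q'"
    and z: "c \<cdot> f = zero_mor C X Q" "c' \<cdot> f = zero_mor C X Q'"
    and univ: "\<And>Z g. \<lbrakk>Z \<in> Obj C; g \<in> Mor C Y Z; g \<cdot> f = zero_mor C X Z\<rbrakk> \<Longrightarrow> \<exists>!u. u \<in> Mor C Q Z \<and> u \<cdot> c = g"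
    and univ': "\<And>Z g. \<lbrakk>Z \<in> Obj C; g \<in> Mor C Y Z; g \<cdot> f = zero_mor C X Z\<rbrakk> \<Longrightarrow> \<exists>!u. u \<in> Mor C Q' Z \<and> u \<cdot> c' = g"
    using assms(1,2) unfolding is_cokernel_of_def by blast+
  have [simp]: "mor c" "src c = Y" "tgt c = Q" "mor c'" "src c' = Y" "tgt c' = Q'"
    using c assms(3) by simp_all
  obtain v where v: "v \<in> Mor C Q Q'" "v \<cdot> c = c'" using univ[of Q' c'] c z by auto
  obtain w where w: "w \<in> Mor C Q' Q" "w \<cdot> c' = c" using univ'[of Q c] c z by auto
  have [simp]: "mor v" "src v = Q" "tgt v = Q'" "mor w" "src w = Q'" "tgt w = Q"
    using v(1) w(1) by simp_all
  have "w \<cdot> v \<cdot> c = c" using v w by simp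
  then have "w \<cdot> v = idm C Q" using univ[of Q c] c z
    by (intro ex1_eq[of "\<lambda>u. u \<in> Mor C Q Q \<and> u \<cdot> c = c"]) simp_all
  moreover have "v \<cdot> w \<cdot> c' = c'" using v w by simp
  then have "v \<cdot> w = idm C Q'" using univ'[of Q' c'] c z
    by (intro ex1_eq[of "\<lambda>u. u \<in> Mor C Q' Q' \<and> u \<cdot> c' = c'"]) simp_all
  ultimately show ?thesis using v w unfolding is_iso_def by blast
qed

lemma is_cokernel_iso_cmp:
  assumes "is_cokernel C P Y q" "is_iso C Y Y' t" "P \<in> Obj C" "Y \<in> Obj C" "Y' \<in> Obj C"
  shows "is_cokernel C P Y' (t \<cdot> q)"
proof -
  obtain X f where X [simp]: "X \<in> Obj C" and f: "f \<in> Mor C X P" and co: "is_cokernel_of C X P f Y q"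
    using assms(1) unfolding is_cokernel_def by blast
  then have fs [simp]: "mor f" "src f = X" "tgt f = P" using assms(3) by simp_all
  obtain t' where t [simp]: "mor t" "src t = Y" "tgt t = Y'" "mor t'" "src t' = Y'" "tgt t' = Y"
      "t' \<cdot> t = idm C Y" "t \<cdot> t' = idm C Y'"
    using iso_inverse[OF assms(2,4,5)] by blast
  have q [simp]: "mor q" "src q = P" "tgt q = Y" and qf [simp]: "q \<cdot> f = zero_mor C X Y"
    and univ: "\<And>Z g. \<lbrakk>Z \<in> Obj C; g \<in> Mor C P Z; g \<cdot> f = zero_mor C X Z\<rbrakk> \<Longrightarrow> \<exists>!u. u \<in> Mor C Y Z \<and> u \<cdot> q = g"
    using co assms(3,4) unfolding is_cokernel_of_def by auto
  have tt [simp]: "t' \<cdot> (t \<cdot> x) = x" if "mor x" "tgt x = Y" for x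
    using assoc[of x t t'] that by (simp del: assoc)
  have "is_cokernel_of C X P f Y' (t \<cdot> q)"
    unfolding is_cokernel_of_def
  proof (intro conjI ballI impI)
    fix Z g assume Z: "Z \<in> Obj C" and g: "g \<in> Mor C P Z" "g \<cdot> f = zero_mor C X Z"
    then obtain u where u: "u \<in> Mor C Y Z" "u \<cdot> q = g"
      and un: "\<And>u'. u' \<in> Mor C Y Z \<Longrightarrow> u' \<cdot> q = g \<Longrightarrow> u' = u" using univ by blast
    have [simp]: "mor u" "src u = Y" "tgt u = Z" using u(1) Z assms(4) by simp_all
    show "\<exists>!w. w \<in> Mor C Y' Z \<and> w \<cdot> (t \<cdot> q) = g"
    proof (rule ex1I[of _ "u \<cdot> t'"])
      show "u \<cdot> t' \<in> Mor C Y' Z \<and> u \<cdot> t' \<cdot> (t \<cdot> q) = g" using u Z assms(5) by simp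
      fix w assume w: "w \<in> Mor C Y' Z \<and> w \<cdot> (t \<cdot> q) = g"
      then have ws [simp]: "mor w" "src w = Y'" "tgt w = Z" using Z assms(5) by simp_all
      have "w \<cdot> t = u" using w Z assms(4) by (intro un) simp_all
      then show "w = u \<cdot> t'" using assoc[of t' t w] by simp
    qed
  qed (use assms(3-5) in simp_all)
  then show ?thesis unfolding is_cokernel_def using X f by blast
qed

lemma pullback_unique:
  assumes "is_pullback C X Y Z f g P p q" "is_pullback C X Y Z f g P' p' q'"
    and [simp]: "X \<in> Obj C" "Y \<in> Obj C"
  shows "\<exists>r. is_iso C P' P r \<and> p \<cdot> r = p' \<and> q \<cdot> r = q'"
proof -
  have P [simp]: "P \<in> Obj C" "P' \<in> Obj C" using assms unfolding is_pullback_def by blast+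
  have p [simp]: "mor p" "src p = P" "tgt p = X" "mor q" "src q = P" "tgt q = Y"
     "mor p'" "src p' = P'" "tgt p' = X" "mor q'" "src q' = P'" "tgt q' = Y"
    using assms(1,2) unfolding is_pullback_def by simp_all
  have eq: "f \<cdot> p = g \<cdot> q" "f \<cdot> p' = g \<cdot> q'" using assms(1,2) unfolding is_pullback_def by simp_all
  have Pu: "\<exists>!w. w \<in> Mor C T P \<and> p \<cdot> w = u \<and> q \<cdot> w = v"
    if "T \<in> Obj C" "u \<in> Mor C T X" "v \<in> Mor C T Y" "f \<cdot> u = g \<cdot> v" for T u v
    using assms(1) that unfolding is_pullback_def by blast
  have Pu': "\<exists>!w. w \<in> Mor C T P' \<and> p' \<cdot> w = u \<and> q' \<cdot> w = v"
    if "T \<in> Obj C" "u \<in> Mor C T X" "v \<in> Mor C T Y" "f \<cdot> u = g \<cdot> v" for T u v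
    using assms(2) that unfolding is_pullback_def by blast
  obtain r where r: "r \<in> Mor C P' P" "p \<cdot> r = p'" "q \<cdot> r = q'"
    using Pu[of P' p' q'] eq by auto
  obtain r' where r': "r' \<in> Mor C P P'" "p' \<cdot> r' = p" "q' \<cdot> r' = q"
    using Pu'[of P p q] eq by auto
  have m [simp]: "mor r" "src r = P'" "tgt r = P" "mor r'" "src r' = P" "tgt r' = P'"
    using r(1) r'(1) by simp_all
  have "p \<cdot> (r \<cdot> r') = p" "q \<cdot> (r \<cdot> r') = q"
    using r r' assoc[of r' r p] assoc[of r' r q] by simp_all
  then have "r \<cdot> r' = idm C P" using ex1_eq[OF Pu[of P p q], of "r \<cdot> r'" "idm C P"] eq by simp
  moreover have "p' \<cdot> (r' \<cdot> r) = p'" "q' \<cdot> (r' \<cdot> r) = q'"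
    using r r' assoc[of r r' p'] assoc[of r r' q'] by simp_all
  then have "r' \<cdot> r = idm C P'" using ex1_eq[OF Pu'[of P' p' q'], of "r' \<cdot> r" "idm C P'"] eq by simp
  ultimately show ?thesis unfolding is_iso_def using r r'(1) by blast
qed

lemma is_pullback_cospan_iso:
  assumes "is_pullback C L Y' G l h P p q"
    and [simp]: "X \<in> Obj C" "Y \<in> Obj C" "Z \<in> Obj C" "L \<in> Obj C" "Y' \<in> Obj C" "G \<in> Obj C"
    and m [simp]: "mor c" "src c = X" "tgt c = Z" "mor g" "src g = Y" "tgt g = Z"
      "mor l" "src l = L" "tgt l = G" "mor h" "src h = Y'" "tgt h = G"
    and r: "mor r" "src r = X" "tgt r = L" "mor r'" "src r' = L" "tgt r' = X"
      "r' \<cdot> r = idm C X" "r \<cdot> r' = idm C L"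
    and t: "mor t" "src t = Y" "tgt t = Y'" "mor t'" "src t' = Y'" "tgt t' = Y"
      "t' \<cdot> t = idm C Y" "t \<cdot> t' = idm C Y'"
    and v: "mor v" "src v = Z" "tgt v = G" "mor v'" "src v' = G" "tgt v' = Z"
      "v' \<cdot> v = idm C Z" "v \<cdot> v' = idm C G"
    and sq: "v \<cdot> c = l \<cdot> r" "v \<cdot> g = h \<cdot> t"
  shows "is_pullback C X Y Z c g P (r' \<cdot> p) (t' \<cdot> q)"
proof -
  note [simp] = r t v
  have P [simp]: "P \<in> Obj C" and p [simp]: "mor p" "src p = P" "tgt p = L" "mor q" "src q = P" "tgt q = Y'"
    and eq: "l \<cdot> p = h \<cdot> q"
    using assms(1) unfolding is_pullback_def by auto
  have Pu: "\<exists>!w. w \<in> Mor C T P \<and> p \<cdot> w = u \<and> q \<cdot> w = v"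
    if "T \<in> Obj C" "u \<in> Mor C T L" "v \<in> Mor C T Y'" "l \<cdot> u = h \<cdot> v" for T u v
    using assms(1) that unfolding is_pullback_def by blast
  have c: "c = v' \<cdot> (l \<cdot> r)" using arg_cong[OF sq(1), of "\<lambda>x. v' \<cdot> x"] assoc[of c v v'] by (simp del: assoc)
  have g: "g = v' \<cdot> (h \<cdot> t)" using arg_cong[OF sq(2), of "\<lambda>x. v' \<cdot> x"] assoc[of g v v'] by (simp del: assoc)
  have canc: "r \<cdot> (r' \<cdot> x) = x" if "mor x" "tgt x = L" for x
    using assoc[of x r' r] that by (simp del: assoc)
  have canc': "r' \<cdot> (r \<cdot> x) = x" if "mor x" "tgt x = X" for x
    using assoc[of x r r'] that by (simp del: assoc)
  have tanc: "t \<cdot> (t' \<cdot> x) = x" if "mor x" "tgt x = Y'" for x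
    using assoc[of x t' t] that by (simp del: assoc)
  have tanc': "t' \<cdot> (t \<cdot> x) = x" if "mor x" "tgt x = Y" for x
    using assoc[of x t t'] that by (simp del: assoc)
  have vanc: "v \<cdot> (v' \<cdot> x) = x" if "mor x" "tgt x = G" for x
    using assoc[of x v' v] that by (simp del: assoc)
  note [simp] = canc canc' tanc tanc' vanc
  show ?thesis unfolding is_pullback_def
  proof (intro conjI ballI impI)
    show "c \<cdot> (r' \<cdot> p) = g \<cdot> (t' \<cdot> q)" unfolding c g using eq by simp
    fix T x y assume T: "T \<in> Obj C" "x \<in> Mor C T X" "y \<in> Mor C T Y" and cg: "c \<cdot> x = g \<cdot> y"
    then have m [simp]: "mor x" "src x = T" "tgt x = X" "mor y" "src y = T" "tgt y = Y" by simp_all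
    have "l \<cdot> (r \<cdot> x) = h \<cdot> (t \<cdot> y)"
      using arg_cong[OF cg, of "\<lambda>x. v \<cdot> x"] unfolding c g by simp
    then have "\<exists>!w. w \<in> Mor C T P \<and> p \<cdot> w = r \<cdot> x \<and> q \<cdot> w = t \<cdot> y"
      using T by (intro Pu) simp_all
    moreover have "p \<cdot> w = r \<cdot> x \<and> q \<cdot> w = t \<cdot> y \<longleftrightarrow> r' \<cdot> p \<cdot> w = x \<and> t' \<cdot> q \<cdot> w = y"
      if "w \<in> Mor C T P" for w
    proof -
      have w [simp]: "mor w" "src w = T" "tgt w = P" using that T by simp_all
      have "p \<cdot> w = r \<cdot> x \<longleftrightarrow> r' \<cdot> (p \<cdot> w) = x"
        using canc[of "p \<cdot> w"] canc'[of x] by auto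
      moreover have "q \<cdot> w = t \<cdot> y \<longleftrightarrow> t' \<cdot> (q \<cdot> w) = y"
        using tanc[of "q \<cdot> w"] tanc'[of y] by auto
      ultimately show ?thesis by simp
    qed
    ultimately show "\<exists>!w. w \<in> Mor C T P \<and> r' \<cdot> p \<cdot> w = x \<and> t' \<cdot> q \<cdot> w = y"
      by (metis (no_types, lifting))
  qed simp_all
qed

lemma is_iso_id: "X \<in> Obj C \<Longrightarrow> is_iso C X X (idm C X)"
  unfolding is_iso_def by auto

text \<open>Stability need only be checked for one pullback of one cospan in each isomorphism class:
  the isomorphism of cospans carries the given pullback to the original cospan, uniqueness of
  pullbacks compares it with any other, and cokernels survive isomorphisms on either side.\<close>

lemma is_cokernel_pullback_transfer:
  assumes pb: "is_pullback C L Y' G l h P p q" and cok: "is_cokernel C P Y' q"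
    and pb': "is_pullback C X Y Z c g P' p' q'"
    and [simp]: "X \<in> Obj C" "Y \<in> Obj C" "Z \<in> Obj C" "L \<in> Obj C" "Y' \<in> Obj C" "G \<in> Obj C"
    and cg: "c \<in> Mor C X Z" "g \<in> Mor C Y Z" "l \<in> Mor C L G" "h \<in> Mor C Y' G"
    and iso: "is_iso C X L r" "is_iso C Y Y' t" "is_iso C Z G v"
    and sq: "v \<cdot> c = l \<cdot> r" "v \<cdot> g = h \<cdot> t"
  shows "is_cokernel C P' Y q'"
proof -
  obtain r' where r: "mor r" "src r = X" "tgt r = L" "mor r'" "src r' = L" "tgt r' = X"
      "r' \<cdot> r = idm C X" "r \<cdot> r' = idm C L" using iso_inverse[OF iso(1)] by auto
  obtain t' where t: "mor t" "src t = Y" "tgt t = Y'" "mor t'" "src t' = Y'" "tgt t' = Y"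
      "t' \<cdot> t = idm C Y" "t \<cdot> t' = idm C Y'" using iso_inverse[OF iso(2)] by auto
  obtain v' where v: "mor v" "src v = Z" "tgt v = G" "mor v'" "src v' = G" "tgt v' = Z"
      "v' \<cdot> v = idm C Z" "v \<cdot> v' = idm C G" using iso_inverse[OF iso(3)] by auto
  have P: "P \<in> Obj C" "P' \<in> Obj C" and q: "mor q" "src q = P" "tgt q = Y'"
    using pb pb' unfolding is_pullback_def by auto
  have "is_pullback C X Y Z c g P (r' \<cdot> p) (t' \<cdot> q)"
    by (rule is_pullback_cospan_iso[OF pb _ _ _ _ _ _ _ _ _ _ _ _ _ _ _ _ _ _ r t v sq]) (use cg in simp_all)
  from pullback_unique[OF this pb'] obtain z where z: "is_iso C P' P z" "t' \<cdot> q \<cdot> z = q'"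
    by auto
  have "is_iso C Y' Y t'" unfolding is_iso_def using t by auto
  then have "is_cokernel C P Y (t' \<cdot> q)"
    using cok P by (intro is_cokernel_iso_cmp[of P Y' q]) simp_all
  from is_cokernel_cmp_iso[OF this z(1)] show ?thesis using z(2) P by simp
qed

lemma kernel_of_unique:
  assumes "is_kernel_of C X Y f K k" "is_kernel_of C X Y f K' k'" "X \<in> Obj C"
  shows "\<exists>v. is_iso C K K' v \<and> k' \<cdot> v = k"
proof -
  interpret op: preadditive_category "op_cat C"
    by (rule preadditive_category_op) (rule preadditive_category_axioms)
  show ?thesis
    using op.cokernel_of_unique[unfolded is_cokernel_of_op is_iso_op, OF assms(2,1)] assms(3) by simp
qed

lemma is_kernel_pushout_transfer:
  assumes "is_pushout C L Y' G l h P p q" "is_kernel C Y' P q" "is_pushout C X Y Z c g P' p' q'"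
    and "X \<in> Obj C" "Y \<in> Obj C" "Z \<in> Obj C" "L \<in> Obj C" "Y' \<in> Obj C" "G \<in> Obj C"
    and "c \<in> Mor C Z X" "g \<in> Mor C Z Y" "l \<in> Mor C G L" "h \<in> Mor C G Y'"
    and "is_iso C L X r" "is_iso C Y' Y t" "is_iso C G Z v"
    and "c \<cdot> v = r \<cdot> l" "g \<cdot> v = t \<cdot> h"
  shows "is_kernel C Y P' q'"
proof -
  interpret op: preadditive_category "op_cat C"
    by (rule preadditive_category_op) (rule preadditive_category_axioms)
  show ?thesis
    by (rule op.is_cokernel_pullback_transfer[unfolded is_cokernel_op is_pullback_op is_iso_op op_cat_simps,
          OF assms])
qed

end

section \<open>Additive quotients\<close>

text \<open>Closure of \<open>W\<close> under direct sums makes the morphisms through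
  \<open>W\<close> closed under addition, closure of \<open>H\<close> gives the quotient its direct
  sums, and the common zero object supplies the zero morphisms of the ideal and a zero object of the
  quotient.\<close>

locale ideal_quotient = additive_category B
  for B :: "('o, 'm) cat" (structure) +
  fixes H W :: "'o set"
  assumes H_obj: "H \<subseteq> Obj B" and W_obj: "W \<subseteq> Obj B"
    and zero_H_W: "\<exists>Z \<in> H \<inter> W. zero_object B Z"
    and biproduct_H: "\<lbrakk>X \<in> H; Y \<in> H; is_biproduct B X Y P i j p q\<rbrakk> \<Longrightarrow> P \<in> H"
    and biproduct_W: "\<lbrakk>X \<in> W; Y \<in> W; is_biproduct B X Y P i j p q\<rbrakk> \<Longrightarrow> P \<in> W"
begin

notation add (infixl "\<boxplus>" 65)

abbreviation Q :: "('o, 'm set) cat" where "Q \<equiv> additive_quotient B H W"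

abbreviation fac :: "'o \<Rightarrow> 'o \<Rightarrow> 'm set" where "fac \<equiv> factoring B W"

definition cls :: "'m \<Rightarrow> 'm set" where
  "cls f = fac (src f) (tgt f) #>\<^bsub>Hom B (src f) (tgt f)\<^esub> f"

lemma H_Obj [simp]: "X \<in> H \<Longrightarrow> X \<in> Obj B"
  using H_obj by blast

lemma W_Obj [simp]: "X \<in> W \<Longrightarrow> X \<in> Obj B"
  using W_obj by blast

lemma facI: "\<lbrakk>mor f; mor g; tgt f = src g; src g \<in> W; src f = X; tgt g = Y\<rbrakk> \<Longrightarrow> g \<cdot> f \<in> fac X Y"
  unfolding factoring_def mem_Collect_eq
  by (rule exI[of _ f], rule exI[of _ g], rule exI[of _ "src g"]) auto

lemma facE:
  assumes "f \<in> fac X Y" "X \<in> Obj B" "Y \<in> Obj B"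
  obtains g h where "mor g" "mor h" "src g = X" "tgt h = Y" "tgt g = src h" "src h \<in> W" "f = h \<cdot> g"
  using assms unfolding factoring_def by auto

lemma fac_mor:
  assumes "f \<in> fac X Y" "X \<in> Obj B" "Y \<in> Obj B"
  shows "mor f" "src f = X" "tgt f = Y"
  using facE[OF assms] by (metis mor_cmp)+

lemma fac_zero [simp]:
  assumes "X \<in> Obj B" "Y \<in> Obj B" shows "zero_mor B X Y \<in> fac X Y"
proof -
  obtain Z where Z: "Z \<in> W" using zero_H_W by auto
  then show ?thesis using assms facI[of "zero_mor B X Z" "zero_mor B Z Y" X Y] by simp
qed

lemma fac_neg:
  assumes "f \<in> fac X Y" "X \<in> Obj B" "Y \<in> Obj B" shows "neg f \<in> fac X Y"
proof -
  obtain g h where gh: "mor g" "mor h" "src g = X" "tgt h = Y" "tgt g = src h" "src h \<in> W" "f = h \<cdot> g"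
    using facE[OF assms] .
  then show ?thesis using facI[of g "neg h" X Y] by simp
qed

text \<open>The sum factors through the direct sum of the two intermediate objects, as a row
  composed with a column.\<close>

lemma fac_add:
  assumes "f \<in> fac X Y" "f' \<in> fac X Y" "X \<in> Obj B" "Y \<in> Obj B" shows "f \<boxplus> f' \<in> fac X Y"
proof -
  obtain g h where g [simp]: "mor g" "mor h" "src g = X" "tgt h = Y" "tgt g = src h" and h: "src h \<in> W" "f = h \<cdot> g"
    using facE[OF assms(1,3,4)] .
  obtain g' h' where g' [simp]: "mor g'" "mor h'" "src g' = X" "tgt h' = Y" "tgt g' = src h'"
    and h': "src h' \<in> W" "f' = h' \<cdot> g'"
    using facE[OF assms(2,3,4)] .
  obtain P i j p q where b: "is_biproduct B (src h) (src h') P i j p q"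
    using ex_biproduct[of "src h" "src h'"] by auto
  note b' [simp] = biproductD[OF b]
  have P: "P \<in> W" using biproduct_W[OF h(1) h'(1) b] .
  have [simp]: "p \<cdot> (i \<cdot> g) = g" "p \<cdot> (j \<cdot> g') = zero_mor B X (src h)"
    "q \<cdot> (j \<cdot> g') = g'" "q \<cdot> (i \<cdot> g) = zero_mor B X (src h')"
    using assoc[of g i p] assoc[of g' j p] assoc[of g i q] assoc[of g' j q] by (simp_all del: assoc)
  have "(h \<cdot> p \<boxplus> h' \<cdot> q) \<cdot> (i \<cdot> g \<boxplus> j \<cdot> g') = f \<boxplus> f'"
    using h h' assms(3,4) by simp
  moreover have "(h \<cdot> p \<boxplus> h' \<cdot> q) \<cdot> (i \<cdot> g \<boxplus> j \<cdot> g') \<in> fac X Y"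
    by (rule facI) (use P in simp_all)
  ultimately show ?thesis by simp
qed

lemma fac_cmp:
  assumes "f \<in> fac X Y" "mor g" "src g = Y" "X \<in> Obj B" shows "g \<cdot> f \<in> fac X (tgt g)"
proof -
  have "Y \<in> Obj B" using assms by auto
  then obtain k h where "mor k" "mor h" "src k = X" "tgt h = Y" "tgt k = src h" "src h \<in> W" "f = h \<cdot> k"
    using facE[OF assms(1,4)] by metis
  then show ?thesis using assms facI[of k "g \<cdot> h" X "tgt g"] by simp
qed

lemma cmp_fac:
  assumes "f \<in> fac X Y" "mor g" "tgt g = X" "Y \<in> Obj B" shows "f \<cdot> g \<in> fac (src g) Y"
proof -
  have "X \<in> Obj B" using assms by auto
  then obtain k h where "mor k" "mor h" "src k = X" "tgt h = Y" "tgt k = src h" "src h \<in> W" "f = h \<cdot> k"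
    using facE[OF assms(1) _ assms(4)] by metis
  then show ?thesis using assms facI[of "k \<cdot> g" h "src g" Y] by simp
qed

lemma fac_subgroup:
  assumes "X \<in> Obj B" "Y \<in> Obj B" shows "subgroup (fac X Y) (Hom B X Y)"
proof (rule subgroup.intro)
  show "fac X Y \<subseteq> Mor B X Y" using fac_mor assms by auto
  show "x \<otimes>\<^bsub>Hom B X Y\<^esub> y \<in> fac X Y" if "x \<in> fac X Y" "y \<in> fac X Y" for x y
    using that fac_add fac_mor assms by simp
  show "\<one>\<^bsub>Hom B X Y\<^esub> \<in> fac X Y" using assms by simp
  show "inv\<^bsub>Hom B X Y\<^esub> x \<in> fac X Y" if "x \<in> fac X Y" for x
    using that fac_neg fac_mor assms by simp
qed

lemma mem_cls:
  assumes "mor f"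
  shows "g \<in> cls f \<longleftrightarrow> mor g \<and> src g = src f \<and> tgt g = tgt f \<and> g \<boxplus> neg f \<in> fac (src f) (tgt f)"
proof -
  interpret comm_group "Hom B (src f) (tgt f)" by (rule hom_group) (use assms in auto)
  interpret S: subgroup "fac (src f) (tgt f)" "Hom B (src f) (tgt f)"
    by (rule fac_subgroup) (use assms in auto)
  have sub: "cls f \<subseteq> Mor B (src f) (tgt f)"
    unfolding cls_def using S.subset assms by (intro r_coset_subset_G) auto
  show ?thesis
  proof (cases "g \<in> Mor B (src f) (tgt f)")
    case True
    then show ?thesis
      using S.rcos_module[OF is_group, of f g] assms unfolding cls_def by simp
  next
    case False
    then show ?thesis using sub assms by auto
  qed
qed

lemma cls_self [simp]: "mor f \<Longrightarrow> f \<in> cls f"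
  by (simp add: mem_cls)

lemma cls_eq_iff:
  assumes "mor f" "mor g" "src g = src f" "tgt g = tgt f"
  shows "cls g = cls f \<longleftrightarrow> g \<boxplus> neg f \<in> fac (src f) (tgt f)"
proof -
  interpret comm_group "Hom B (src f) (tgt f)" by (rule hom_group) (use assms in auto)
  have "cls f = cls g" if "g \<in> cls f"
    using that assms repr_independence[OF _ _ fac_subgroup, of g f] unfolding cls_def by simp
  then have "cls g = cls f \<longleftrightarrow> g \<in> cls f" using cls_self[OF assms(2)] by blast
  then show ?thesis using assms by (simp add: mem_cls)
qed

lemma fac_diff_trans:
  assumes "f \<boxplus> neg g \<in> fac X Y" "h \<boxplus> neg g \<in> fac X Y" "mor f" "mor g" "mor h"
    "src f = X" "tgt f = Y" "src g = X" "tgt g = Y" "src h = X" "tgt h = Y"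
  shows "f \<boxplus> neg h \<in> fac X Y"
  using assms cls_eq_iff[of g f] cls_eq_iff[of g h] cls_eq_iff[of h f] by simp

lemma Q_Obj [simp]: "Obj Q = H"
  by (simp add: additive_quotient_def)

lemma Q_Mor: "Mor Q X Y = cls ` Mor B X Y" if "X \<in> H" "Y \<in> H"
  using that by (auto simp: additive_quotient_def carrier_FactGroup cls_def image_iff)

lemma Q_MorE:
  assumes "\<Phi> \<in> Mor Q X Y" "X \<in> H" "Y \<in> H"
  obtains f where "mor f" "src f = X" "tgt f = Y" "\<Phi> = cls f"
  using assms Q_Mor[of X Y] by auto

lemma cls_Mor: "\<lbrakk>X \<in> H; Y \<in> H; mor f; src f = X; tgt f = Y\<rbrakk> \<Longrightarrow> cls f \<in> Mor Q X Y"
  using Q_Mor[of X Y] by auto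

lemma Q_id: "X \<in> H \<Longrightarrow> idm Q X = cls (idm B X)"
  by (simp add: additive_quotient_def cls_def)

lemma Q_one:
  assumes "X \<in> H" "Y \<in> H" shows "zero_mor Q X Y = cls (zero_mor B X Y)"
proof -
  interpret comm_group "Hom B X Y" by (rule hom_group) (use assms in auto)
  have "zero_mor Q X Y = fac X Y" by (simp add: additive_quotient_def)
  also have "\<dots> = cls (zero_mor B X Y)"
    unfolding cls_def using assms fac_subgroup[of X Y] by (simp add: coset_join2)
  finally show ?thesis .
qed

lemma cls_zero_iff:
  assumes "mor f" "X = src f" "Y = tgt f" "X \<in> H" "Y \<in> H"
  shows "cls f = zero_mor Q X Y \<longleftrightarrow> f \<in> fac X Y"
proof -
  have "cls f = cls (zero_mor B X Y) \<longleftrightarrow> f \<in> fac X Y"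
    by (subst cls_eq_iff) (use assms in simp_all)
  then show ?thesis using Q_one[OF assms(4,5)] by simp
qed

lemma Q_mult:
  assumes "mor f" "mor g" "X = src f" "Y = tgt f" "src g = src f" "tgt g = tgt f" "X \<in> H" "Y \<in> H"
  shows "cls f \<otimes>\<^bsub>Hom Q X Y\<^esub> cls g = cls (f \<boxplus> g)"
proof -
  interpret comm_group "Hom B X Y" by (rule hom_group) (use assms in auto)
  interpret normal "fac X Y" "Hom B X Y"
    using subgroup_imp_normal fac_subgroup assms by simp
  have "cls f \<otimes>\<^bsub>Hom Q X Y\<^esub> cls g = cls f <#>\<^bsub>Hom B X Y\<^esub> cls g"
    by (simp add: additive_quotient_def FactGroup_def)
  then show ?thesis using rcos_sum[of f g] assms by (simp add: cls_def)
qed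

text \<open>Other representatives change the composite by \<open>(g' \<boxplus> neg g) \<cdot> f'
  \<boxplus> g \<cdot> (f' \<boxplus> neg f)\<close>, which lies in the ideal. Hence the union
  defining the composite of two cosets runs over a single coset.\<close>

lemma Q_cmp:
  assumes [simp]: "mor f" "mor g" "src g = tgt f" and "src f \<in> H" "tgt f \<in> H" "tgt g \<in> H"
  shows "cls g \<cdot>\<^bsub>Q\<^esub> cls f = cls (g \<cdot> f)"
proof -
  have 1: "fac X Z #>\<^bsub>Hom B X Z\<^esub> (g' \<cdot> f') = cls (g \<cdot> f)"
    if "X \<in> H" "Y \<in> H" "Z \<in> H" "f' \<in> cls f \<inter> Mor B X Y" "g' \<in> cls g \<inter> Mor B Y Z" for X Y Z f' g'
  proof -
    have [simp]: "mor f'" "src f' = X" "tgt f' = Y" "mor g'" "src g' = Y" "tgt g' = Z"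
      "X = src f" "Y = tgt f" "Z = tgt g"
      using that by (auto simp: mem_cls)
    have df: "f' \<boxplus> neg f \<in> fac (src f) (tgt f)" and dg: "g' \<boxplus> neg g \<in> fac (tgt f) (tgt g)"
      using that by (simp_all add: mem_cls)
    have "g' \<cdot> f' \<boxplus> neg (g \<cdot> f) = (g' \<boxplus> neg g) \<cdot> f' \<boxplus> g \<cdot> (f' \<boxplus> neg f)"
    proof -
      have "neg (g \<cdot> f') \<boxplus> (g \<cdot> f' \<boxplus> neg (g \<cdot> f)) = neg (g \<cdot> f)"
        using add_neg_cancel(2)[of "neg (g \<cdot> f')" "neg (g \<cdot> f)"] by simp
      then show ?thesis by (simp add: add_assoc)
    qed
    also have "\<dots> \<in> fac (src f) (tgt g)"
      using fac_add cmp_fac[OF dg, of f'] fac_cmp[OF df, of g] by simp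
    finally have "cls (g' \<cdot> f') = cls (g \<cdot> f)" by (subst cls_eq_iff) simp_all
    then show ?thesis by (simp add: cls_def)
  qed
  define M where "M = {fac X Z #>\<^bsub>Hom B X Z\<^esub> (g' \<cdot> f') | X Y Z f' g'.
              X \<in> H \<and> Y \<in> H \<and> Z \<in> H \<and> f' \<in> cls f \<inter> Mor B X Y \<and> g' \<in> cls g \<inter> Mor B Y Z}"
  have "M \<subseteq> {cls (g \<cdot> f)}"
  proof
    fix x assume "x \<in> M"
    then obtain X Y Z f' g' where "x = fac X Z #>\<^bsub>Hom B X Z\<^esub> (g' \<cdot> f')"
      "X \<in> H" "Y \<in> H" "Z \<in> H" "f' \<in> cls f \<inter> Mor B X Y" "g' \<in> cls g \<inter> Mor B Y Z"
      unfolding M_def by blast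
    then show "x \<in> {cls (g \<cdot> f)}" using 1[of X Y Z f' g'] by simp
  qed
  moreover have "cls (g \<cdot> f) \<in> M"
    unfolding M_def mem_Collect_eq
    by (rule exI[of _ "src f"], rule exI[of _ "tgt f"], rule exI[of _ "tgt g"], rule exI[of _ f], rule exI[of _ g])
      (use assms in \<open>simp add: cls_def[of "g \<cdot> f"]\<close>)
  ultimately have "M = {cls (g \<cdot> f)}" by blast
  moreover have "cls g \<cdot>\<^bsub>Q\<^esub> cls f = \<Union>M" by (simp add: additive_quotient_def M_def)
  ultimately show ?thesis by simp
qed

lemma Q_group:
  assumes "X \<in> H" "Y \<in> H" shows "comm_group (Hom Q X Y)"
  using comm_group.abelian_FactGroup[OF hom_group fac_subgroup, of X Y] assms
  by (simp add: additive_quotient_def)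

lemma Q_preadditive: "preadditive_category Q"
proof (rule preadditive_category.intro)
  fix X Y X' Y' \<Phi>
  assume o: "X \<in> Obj Q" "Y \<in> Obj Q" "X' \<in> Obj Q" "Y' \<in> Obj Q" and m: "\<Phi> \<in> Mor Q X Y" "\<Phi> \<in> Mor Q X' Y'"
  obtain f where f: "mor f" "src f = X" "tgt f = Y" "\<Phi> = cls f"
    using Q_MorE[OF m(1)] o by auto
  obtain f' where f': "mor f'" "src f' = X'" "tgt f' = Y'" "\<Phi> = cls f'"
    using Q_MorE[OF m(2)] o by auto
  have "f \<in> cls f'" using f f' cls_self[of f] by simp
  then show "X = X' \<and> Y = Y'" using f f' by (simp add: mem_cls)
next
  fix X Y assume "X \<in> Obj Q" "Y \<in> Obj Q"
  then show "comm_group (Hom Q X Y)" using Q_group by simp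
next
  fix X assume "X \<in> Obj Q"
  then show "idm Q X \<in> Mor Q X X" by (simp add: Q_id cls_Mor)
next
  fix X Y \<Phi> assume o: "X \<in> Obj Q" "Y \<in> Obj Q" "\<Phi> \<in> Mor Q X Y"
  then obtain f where "mor f" "src f = X" "tgt f = Y" "\<Phi> = cls f"
    using Q_MorE[OF o(3)] by auto
  then show "\<Phi> \<cdot>\<^bsub>Q\<^esub> idm Q X = \<Phi>" "idm Q Y \<cdot>\<^bsub>Q\<^esub> \<Phi> = \<Phi>"
    using o by (simp_all add: Q_id Q_cmp)
next
  fix X Y Z \<Phi> \<Gamma> assume o: "X \<in> Obj Q" "Y \<in> Obj Q" "Z \<in> Obj Q" and m: "\<Phi> \<in> Mor Q X Y" "\<Gamma> \<in> Mor Q Y Z"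
  obtain f where f: "mor f" "src f = X" "tgt f = Y" "\<Phi> = cls f" using Q_MorE[OF m(1)] o by auto
  obtain g where g: "mor g" "src g = Y" "tgt g = Z" "\<Gamma> = cls g" using Q_MorE[OF m(2)] o by auto
  show "\<Gamma> \<cdot>\<^bsub>Q\<^esub> \<Phi> \<in> Mor Q X Z" using f g o by (simp add: Q_cmp cls_Mor)
next
  fix V X Y Z \<Phi> \<Gamma> \<Theta>
  assume o: "V \<in> Obj Q" "X \<in> Obj Q" "Y \<in> Obj Q" "Z \<in> Obj Q"
    and m: "\<Phi> \<in> Mor Q V X" "\<Gamma> \<in> Mor Q X Y" "\<Theta> \<in> Mor Q Y Z"
  obtain f where f: "mor f" "src f = V" "tgt f = X" "\<Phi> = cls f" using Q_MorE[OF m(1)] o by auto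
  obtain g where g: "mor g" "src g = X" "tgt g = Y" "\<Gamma> = cls g" using Q_MorE[OF m(2)] o by auto
  obtain h where h: "mor h" "src h = Y" "tgt h = Z" "\<Theta> = cls h" using Q_MorE[OF m(3)] o by auto
  show "\<Theta> \<cdot>\<^bsub>Q\<^esub> \<Gamma> \<cdot>\<^bsub>Q\<^esub> \<Phi> = \<Theta> \<cdot>\<^bsub>Q\<^esub> (\<Gamma> \<cdot>\<^bsub>Q\<^esub> \<Phi>)" using f g h o by (simp add: Q_cmp)
next
  fix X Y Z \<Phi> \<Phi>' \<Gamma> assume o: "X \<in> Obj Q" "Y \<in> Obj Q" "Z \<in> Obj Q"
    and m: "\<Phi> \<in> Mor Q X Y" "\<Phi>' \<in> Mor Q X Y" "\<Gamma> \<in> Mor Q Y Z"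
  obtain f where f: "mor f" "src f = X" "tgt f = Y" "\<Phi> = cls f" using Q_MorE[OF m(1)] o by auto
  obtain f' where f': "mor f'" "src f' = X" "tgt f' = Y" "\<Phi>' = cls f'" using Q_MorE[OF m(2)] o by auto
  obtain g where g: "mor g" "src g = Y" "tgt g = Z" "\<Gamma> = cls g" using Q_MorE[OF m(3)] o by auto
  show "\<Gamma> \<cdot>\<^bsub>Q\<^esub> (\<Phi> \<otimes>\<^bsub>Hom Q X Y\<^esub> \<Phi>') = \<Gamma> \<cdot>\<^bsub>Q\<^esub> \<Phi> \<otimes>\<^bsub>Hom Q X Z\<^esub> (\<Gamma> \<cdot>\<^bsub>Q\<^esub> \<Phi>')"
    using f f' g o by (simp add: Q_cmp Q_mult)
next
  fix X Y Z \<Phi> \<Gamma> \<Gamma>' assume o: "X \<in> Obj Q" "Y \<in> Obj Q" "Z \<in> Obj Q"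
    and m: "\<Phi> \<in> Mor Q X Y" "\<Gamma> \<in> Mor Q Y Z" "\<Gamma>' \<in> Mor Q Y Z"
  obtain f where f: "mor f" "src f = X" "tgt f = Y" "\<Phi> = cls f" using Q_MorE[OF m(1)] o by auto
  obtain g where g: "mor g" "src g = Y" "tgt g = Z" "\<Gamma> = cls g" using Q_MorE[OF m(2)] o by auto
  obtain g' where g': "mor g'" "src g' = Y" "tgt g' = Z" "\<Gamma>' = cls g'" using Q_MorE[OF m(3)] o by auto
  show "\<Gamma> \<otimes>\<^bsub>Hom Q Y Z\<^esub> \<Gamma>' \<cdot>\<^bsub>Q\<^esub> \<Phi> = \<Gamma> \<cdot>\<^bsub>Q\<^esub> \<Phi> \<otimes>\<^bsub>Hom Q X Z\<^esub> (\<Gamma>' \<cdot>\<^bsub>Q\<^esub> \<Phi>)"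
    using f g g' o by (simp add: Q_cmp Q_mult)
qed

lemma Q_biproduct:
  assumes "is_biproduct B X Y P i j p q" "X \<in> H" "Y \<in> H"
  shows "is_biproduct Q X Y P (cls i) (cls j) (cls p) (cls q)"
proof -
  note [simp] = biproductD[OF assms(1)] assms(2,3)
  have [simp]: "P \<in> H" using biproduct_H[OF assms(2,3,1)] .
  show ?thesis unfolding is_biproduct_def
    by (simp add: Q_cmp Q_id Q_one Q_mult cls_Mor)
qed

lemma Q_additive: "additive_category Q"
proof -
  interpret Q: preadditive_category Q by (rule Q_preadditive)
  show ?thesis
  proof
    obtain Z where Z: "Z \<in> H" "zero_object B Z" using zero_H_W by blast
    then have "idm Q Z = zero_mor Q Z Z" using zero_object_iff_id[of Z] by (simp add: Q_id Q_one)
    then show "\<exists>Z. zero_object Q Z" using Z Q.zero_object_iff_id[of Z] by auto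
  next
    fix X Y assume "X \<in> Obj Q" "Y \<in> Obj Q"
    then show "\<exists>P i j p q. is_biproduct Q X Y P i j p q"
      using ex_biproduct[of X Y] Q_biproduct by (metis H_Obj Q_Obj)
  qed
qed

text \<open>Everything is phrased on representatives, so that it can be checked in \<open>B\<close>.
  Uniqueness is required only against zero, because two solutions differ by a morphism that
  \<open>k\<close> sends into the ideal.\<close>

lemma Q_kernelI:
  assumes f: "mor f" "src f = X" "tgt f = Y" and k: "mor k" "src k = K" "tgt k = X"
    and o: "X \<in> H" "Y \<in> H" "K \<in> H" and fk: "f \<cdot> k \<in> fac K Y"
    and lift: "\<And>g. \<lbrakk>src g \<in> H; mor g; tgt g = X; f \<cdot> g \<in> fac (src g) Y\<rbrakk>
      \<Longrightarrow> \<exists>u. mor u \<and> src u = src g \<and> tgt u = K \<and> k \<cdot> u \<boxplus> neg g \<in> fac (src g) X"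
    and mono: "\<And>u. \<lbrakk>src u \<in> H; mor u; tgt u = K; k \<cdot> u \<in> fac (src u) X\<rbrakk> \<Longrightarrow> u \<in> fac (src u) K"
  shows "is_kernel_of Q X Y (cls f) K (cls k)"
  unfolding is_kernel_of_def
proof (intro conjI ballI impI)
  note [simp] = f k o
  show "K \<in> Obj Q" "cls k \<in> Mor Q K X" "cls f \<cdot>\<^bsub>Q\<^esub> cls k = zero_mor Q K Y"
    using fk by (simp_all add: cls_Mor Q_cmp cls_zero_iff)
  fix Z \<Gamma> assume "Z \<in> Obj Q" and \<Gamma>: "\<Gamma> \<in> Mor Q Z X" "cls f \<cdot>\<^bsub>Q\<^esub> \<Gamma> = zero_mor Q Z Y"
  then have Z [simp]: "Z \<in> H" by simp
  obtain g where g [simp]: "mor g" "src g = Z" "tgt g = X" "\<Gamma> = cls g" using Q_MorE[OF \<Gamma>(1)] by auto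
  have "f \<cdot> g \<in> fac Z Y" using \<Gamma>(2) by (simp add: Q_cmp cls_zero_iff)
  then obtain u where u [simp]: "mor u" "src u = Z" "tgt u = K" and ku: "k \<cdot> u \<boxplus> neg g \<in> fac Z X"
    using lift[of g] by auto
  show "\<exists>!u. u \<in> Mor Q Z K \<and> cls k \<cdot>\<^bsub>Q\<^esub> u = \<Gamma>"
  proof (rule ex1I[of _ "cls u"])
    show "cls u \<in> Mor Q Z K \<and> cls k \<cdot>\<^bsub>Q\<^esub> cls u = \<Gamma>"
      using ku by (simp add: cls_Mor Q_cmp cls_eq_iff)
    fix \<Theta> assume \<Theta>: "\<Theta> \<in> Mor Q Z K \<and> cls k \<cdot>\<^bsub>Q\<^esub> \<Theta> = \<Gamma>"
    then obtain v where v [simp]: "mor v" "src v = Z" "tgt v = K" "\<Theta> = cls v"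
      using Q_MorE[of \<Theta> Z K] by auto
    have "k \<cdot> (v \<boxplus> neg u) \<in> fac Z X"
      using \<Theta> ku fac_diff_trans[of "k \<cdot> v" g Z X "k \<cdot> u"] by (simp add: Q_cmp cls_eq_iff)
    then have "v \<boxplus> neg u \<in> fac Z K" using mono[of "v \<boxplus> neg u"] by simp
    then show "\<Theta> = cls u" by (simp add: cls_eq_iff)
  qed
qed

lemma Q_cokernelI:
  assumes f: "mor f" "src f = X" "tgt f = Y" and k: "mor k" "src k = Y" "tgt k = K"
    and o: "X \<in> H" "Y \<in> H" "K \<in> H" and fk: "k \<cdot> f \<in> fac X K"
    and ext: "\<And>g. \<lbrakk>tgt g \<in> H; mor g; src g = Y; g \<cdot> f \<in> fac X (tgt g)\<rbrakk>
      \<Longrightarrow> \<exists>u. mor u \<and> src u = K \<and> tgt u = tgt g \<and> u \<cdot> k \<boxplus> neg g \<in> fac Y (tgt g)"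
    and epi: "\<And>u. \<lbrakk>tgt u \<in> H; mor u; src u = K; u \<cdot> k \<in> fac Y (tgt u)\<rbrakk> \<Longrightarrow> u \<in> fac K (tgt u)"
  shows "is_cokernel_of Q X Y (cls f) K (cls k)"
  unfolding is_cokernel_of_def
proof (intro conjI ballI impI)
  note [simp] = f k o
  show "K \<in> Obj Q" "cls k \<in> Mor Q Y K" "cls k \<cdot>\<^bsub>Q\<^esub> cls f = zero_mor Q X K"
    using fk by (simp_all add: cls_Mor Q_cmp cls_zero_iff)
  fix Z \<Gamma> assume "Z \<in> Obj Q" and \<Gamma>: "\<Gamma> \<in> Mor Q Y Z" "\<Gamma> \<cdot>\<^bsub>Q\<^esub> cls f = zero_mor Q X Z"
  then have Z [simp]: "Z \<in> H" by simp
  obtain g where g [simp]: "mor g" "src g = Y" "tgt g = Z" "\<Gamma> = cls g" using Q_MorE[OF \<Gamma>(1)] by auto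
  have "g \<cdot> f \<in> fac X Z" using \<Gamma>(2) by (simp add: Q_cmp cls_zero_iff)
  then obtain u where u [simp]: "mor u" "src u = K" "tgt u = Z" and ku: "u \<cdot> k \<boxplus> neg g \<in> fac Y Z"
    using ext[of g] by auto
  show "\<exists>!u. u \<in> Mor Q K Z \<and> u \<cdot>\<^bsub>Q\<^esub> cls k = \<Gamma>"
  proof (rule ex1I[of _ "cls u"])
    show "cls u \<in> Mor Q K Z \<and> cls u \<cdot>\<^bsub>Q\<^esub> cls k = \<Gamma>"
      using ku by (simp add: cls_Mor Q_cmp cls_eq_iff)
    fix \<Theta> assume \<Theta>: "\<Theta> \<in> Mor Q K Z \<and> \<Theta> \<cdot>\<^bsub>Q\<^esub> cls k = \<Gamma>"
    then obtain v where v [simp]: "mor v" "src v = K" "tgt v = Z" "\<Theta> = cls v"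
      using Q_MorE[of \<Theta> K Z] by auto
    have "(v \<boxplus> neg u) \<cdot> k \<in> fac Y Z"
      using \<Theta> ku fac_diff_trans[of "v \<cdot> k" g Y Z "u \<cdot> k"] by (simp add: Q_cmp cls_eq_iff)
    then have "v \<boxplus> neg u \<in> fac K Z" using epi[of "v \<boxplus> neg u"] by simp
    then show "\<Theta> = cls u" by (simp add: cls_eq_iff)
  qed
qed

text \<open>The square itself commutes strictly, whereas the test squares commute only modulo the
  ideal; closing this gap is the real content of the condition \<open>lift\<close>.\<close>

lemma Q_pullbackI:
  assumes l: "mor l" "src l = L" "tgt l = G" and h: "mor h" "src h = Y" "tgt h = G"
    and p: "mor p" "src p = P" "tgt p = L" and q: "mor q" "src q = P" "tgt q = Y"
    and o: "L \<in> H" "Y \<in> H" "G \<in> H" "P \<in> H" and sq: "l \<cdot> p = h \<cdot> q"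
    and lift: "\<And>u v. \<lbrakk>src u \<in> H; mor u; mor v; src v = src u; tgt u = L; tgt v = Y;
        l \<cdot> u \<boxplus> neg (h \<cdot> v) \<in> fac (src u) G\<rbrakk>
      \<Longrightarrow> \<exists>w. mor w \<and> src w = src u \<and> tgt w = P \<and>
            p \<cdot> w \<boxplus> neg u \<in> fac (src u) L \<and> q \<cdot> w \<boxplus> neg v \<in> fac (src u) Y"
    and mono: "\<And>w. \<lbrakk>src w \<in> H; mor w; tgt w = P; p \<cdot> w \<in> fac (src w) L; q \<cdot> w \<in> fac (src w) Y\<rbrakk>
      \<Longrightarrow> w \<in> fac (src w) P"
  shows "is_pullback Q L Y G (cls l) (cls h) P (cls p) (cls q)"
  unfolding is_pullback_def
proof (intro conjI ballI impI)
  note [simp] = l h p q o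
  show "P \<in> Obj Q" "cls p \<in> Mor Q P L" "cls q \<in> Mor Q P Y" "cls l \<cdot>\<^bsub>Q\<^esub> cls p = cls h \<cdot>\<^bsub>Q\<^esub> cls q"
    using sq by (simp_all add: cls_Mor Q_cmp)
  fix T \<Phi> \<Gamma> assume "T \<in> Obj Q" and m: "\<Phi> \<in> Mor Q T L" "\<Gamma> \<in> Mor Q T Y" and e: "cls l \<cdot>\<^bsub>Q\<^esub> \<Phi> = cls h \<cdot>\<^bsub>Q\<^esub> \<Gamma>"
  then have T [simp]: "T \<in> H" by simp
  obtain u where u [simp]: "mor u" "src u = T" "tgt u = L" "\<Phi> = cls u" using Q_MorE[OF m(1)] by auto
  obtain v where v [simp]: "mor v" "src v = T" "tgt v = Y" "\<Gamma> = cls v" using Q_MorE[OF m(2)] by auto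
  have "l \<cdot> u \<boxplus> neg (h \<cdot> v) \<in> fac T G" using e by (simp add: Q_cmp cls_eq_iff)
  then obtain w where w [simp]: "mor w" "src w = T" "tgt w = P"
    and pw: "p \<cdot> w \<boxplus> neg u \<in> fac T L" and qw: "q \<cdot> w \<boxplus> neg v \<in> fac T Y"
    using lift[of u v] by auto
  show "\<exists>!w. w \<in> Mor Q T P \<and> cls p \<cdot>\<^bsub>Q\<^esub> w = \<Phi> \<and> cls q \<cdot>\<^bsub>Q\<^esub> w = \<Gamma>"
  proof (rule ex1I[of _ "cls w"])
    show "cls w \<in> Mor Q T P \<and> cls p \<cdot>\<^bsub>Q\<^esub> cls w = \<Phi> \<and> cls q \<cdot>\<^bsub>Q\<^esub> cls w = \<Gamma>"
      using pw qw by (simp add: cls_Mor Q_cmp cls_eq_iff)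
    fix \<Theta> assume \<Theta>: "\<Theta> \<in> Mor Q T P \<and> cls p \<cdot>\<^bsub>Q\<^esub> \<Theta> = \<Phi> \<and> cls q \<cdot>\<^bsub>Q\<^esub> \<Theta> = \<Gamma>"
    then obtain x where x [simp]: "mor x" "src x = T" "tgt x = P" "\<Theta> = cls x"
      using Q_MorE[of \<Theta> T P] by auto
    have "p \<cdot> (x \<boxplus> neg w) \<in> fac T L" "q \<cdot> (x \<boxplus> neg w) \<in> fac T Y"
      using \<Theta> pw qw fac_diff_trans[of "p \<cdot> x" u T L "p \<cdot> w"] fac_diff_trans[of "q \<cdot> x" v T Y "q \<cdot> w"]
      by (simp_all add: Q_cmp cls_eq_iff)
    then have "x \<boxplus> neg w \<in> fac T P" using mono[of "x \<boxplus> neg w"] by simp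
    then show "\<Theta> = cls w" by (simp add: cls_eq_iff)
  qed
qed

lemma Q_pushoutI:
  assumes l: "mor l" "src l = G" "tgt l = L" and h: "mor h" "src h = G" "tgt h = Y"
    and p: "mor p" "src p = L" "tgt p = P" and q: "mor q" "src q = Y" "tgt q = P"
    and o: "L \<in> H" "Y \<in> H" "G \<in> H" "P \<in> H" and sq: "p \<cdot> l = q \<cdot> h"
    and ext: "\<And>u v. \<lbrakk>tgt u \<in> H; mor u; mor v; tgt v = tgt u; src u = L; src v = Y;
        u \<cdot> l \<boxplus> neg (v \<cdot> h) \<in> fac G (tgt u)\<rbrakk>
      \<Longrightarrow> \<exists>w. mor w \<and> tgt w = tgt u \<and> src w = P \<and>
            w \<cdot> p \<boxplus> neg u \<in> fac L (tgt u) \<and> w \<cdot> q \<boxplus> neg v \<in> fac Y (tgt u)"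
    and epi: "\<And>w. \<lbrakk>tgt w \<in> H; mor w; src w = P; w \<cdot> p \<in> fac L (tgt w); w \<cdot> q \<in> fac Y (tgt w)\<rbrakk>
      \<Longrightarrow> w \<in> fac P (tgt w)"
  shows "is_pushout Q L Y G (cls l) (cls h) P (cls p) (cls q)"
  unfolding is_pushout_def
proof (intro conjI ballI impI)
  note [simp] = l h p q o
  show "P \<in> Obj Q" "cls p \<in> Mor Q L P" "cls q \<in> Mor Q Y P" "cls p \<cdot>\<^bsub>Q\<^esub> cls l = cls q \<cdot>\<^bsub>Q\<^esub> cls h"
    using sq by (simp_all add: cls_Mor Q_cmp)
  fix T \<Phi> \<Gamma> assume "T \<in> Obj Q" and m: "\<Phi> \<in> Mor Q L T" "\<Gamma> \<in> Mor Q Y T" and e: "\<Phi> \<cdot>\<^bsub>Q\<^esub> cls l = \<Gamma> \<cdot>\<^bsub>Q\<^esub> cls h"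
  then have T [simp]: "T \<in> H" by simp
  obtain u where u [simp]: "mor u" "src u = L" "tgt u = T" "\<Phi> = cls u" using Q_MorE[OF m(1)] by auto
  obtain v where v [simp]: "mor v" "src v = Y" "tgt v = T" "\<Gamma> = cls v" using Q_MorE[OF m(2)] by auto
  have "u \<cdot> l \<boxplus> neg (v \<cdot> h) \<in> fac G T" using e by (simp add: Q_cmp cls_eq_iff)
  then obtain w where w [simp]: "mor w" "tgt w = T" "src w = P"
    and pw: "w \<cdot> p \<boxplus> neg u \<in> fac L T" and qw: "w \<cdot> q \<boxplus> neg v \<in> fac Y T"
    using ext[of u v] by auto
  show "\<exists>!w. w \<in> Mor Q P T \<and> w \<cdot>\<^bsub>Q\<^esub> cls p = \<Phi> \<and> w \<cdot>\<^bsub>Q\<^esub> cls q = \<Gamma>"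
  proof (rule ex1I[of _ "cls w"])
    show "cls w \<in> Mor Q P T \<and> cls w \<cdot>\<^bsub>Q\<^esub> cls p = \<Phi> \<and> cls w \<cdot>\<^bsub>Q\<^esub> cls q = \<Gamma>"
      using pw qw by (simp add: cls_Mor Q_cmp cls_eq_iff)
    fix \<Theta> assume \<Theta>: "\<Theta> \<in> Mor Q P T \<and> \<Theta> \<cdot>\<^bsub>Q\<^esub> cls p = \<Phi> \<and> \<Theta> \<cdot>\<^bsub>Q\<^esub> cls q = \<Gamma>"
    then obtain x where x [simp]: "mor x" "src x = P" "tgt x = T" "\<Theta> = cls x"
      using Q_MorE[of \<Theta> P T] by auto
    have "(x \<boxplus> neg w) \<cdot> p \<in> fac L T" "(x \<boxplus> neg w) \<cdot> q \<in> fac Y T"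
      using \<Theta> pw qw fac_diff_trans[of "x \<cdot> p" u L T "w \<cdot> p"] fac_diff_trans[of "x \<cdot> q" v Y T "w \<cdot> q"]
      by (simp_all add: Q_cmp cls_eq_iff)
    then have "x \<boxplus> neg w \<in> fac P T" using epi[of "x \<boxplus> neg w"] by simp
    then show "\<Theta> = cls w" by (simp add: cls_eq_iff)
  qed
qed

end

section \<open>Extension groups\<close>

context biadditive_functor
begin

notation add (infixl "\<boxplus>" 65)

abbreviation ext :: "'o \<Rightarrow> 'o \<Rightarrow> 'e set" where "ext D A \<equiv> carrier (Ext E D A)"
abbreviation ext0 :: "'o \<Rightarrow> 'o \<Rightarrow> 'e" where "ext0 D A \<equiv> \<one>\<^bsub>Ext E D A\<^esub>"
abbreviation psh :: "'o \<Rightarrow> 'm \<Rightarrow> 'e \<Rightarrow> 'e" where "psh \<equiv> push B E"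
abbreviation pll :: "'o \<Rightarrow> 'm \<Rightarrow> 'e \<Rightarrow> 'e" where "pll \<equiv> pull B E"

lemma ext0_in [simp]:
  assumes "D \<in> Obj B" "A \<in> Obj B" shows "ext0 D A \<in> ext D A"
proof -
  interpret comm_group "Ext E D A" by (rule ext_group[OF assms])
  show ?thesis by simp
qed

lemma ext0_mult [simp]:
  assumes "D \<in> Obj B" "A \<in> Obj B" "\<delta> \<in> ext D A"
  shows "ext0 D A \<otimes>\<^bsub>Ext E D A\<^esub> \<delta> = \<delta>" "\<delta> \<otimes>\<^bsub>Ext E D A\<^esub> ext0 D A = \<delta>"
proof -
  interpret comm_group "Ext E D A" by (rule ext_group[OF assms(1,2)])
  show "ext0 D A \<otimes>\<^bsub>Ext E D A\<^esub> \<delta> = \<delta>" "\<delta> \<otimes>\<^bsub>Ext E D A\<^esub> ext0 D A = \<delta>" using assms(3) by simp_all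
qed

lemma push_hom: "\<lbrakk>D \<in> Obj B; mor f\<rbrakk> \<Longrightarrow> psh D f \<in> hom (Ext E D (src f)) (Ext E D (tgt f))"
  unfolding push_def using Emap_hom[of D D "src f" "tgt f" "idm B D" f] by simp

lemma pull_hom: "\<lbrakk>A \<in> Obj B; mor g\<rbrakk> \<Longrightarrow> pll A g \<in> hom (Ext E (tgt g) A) (Ext E (src g) A)"
  unfolding pull_def using Emap_hom[of "tgt g" "src g" A A g "idm B A"] by simp

lemma push_in [simp]:
  "\<lbrakk>D \<in> Obj B; mor f; tgt f = A'; \<delta> \<in> ext D (src f)\<rbrakk> \<Longrightarrow> psh D f \<delta> \<in> ext D A'"
  using push_hom hom_in_carrier by metis

lemma pull_in [simp]:
  "\<lbrakk>A \<in> Obj B; mor g; src g = D'; \<delta> \<in> ext (tgt g) A\<rbrakk> \<Longrightarrow> pll A g \<delta> \<in> ext D' A"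
  using pull_hom hom_in_carrier by metis

lemma push_ext0 [simp]:
  assumes "D \<in> Obj B" "mor f" "src f = A" shows "psh D f (ext0 D A) = ext0 D (tgt f)"
  using hom_one[OF push_hom[OF assms(1,2)]] assms(3)
    ext_group[OF assms(1), THEN comm_group.axioms(2)] assms(1,2) by auto

lemma pull_ext0 [simp]:
  assumes "A \<in> Obj B" "mor g" "tgt g = D" shows "pll A g (ext0 D A) = ext0 (src g) A"
  using hom_one[OF pull_hom[OF assms(1,2)]] assms(3)
    ext_group[OF _ assms(1), THEN comm_group.axioms(2)] assms(1,2) by auto

lemma push_id [simp]: "\<lbrakk>D \<in> Obj B; A \<in> Obj B; \<delta> \<in> ext D A\<rbrakk> \<Longrightarrow> psh D (idm B A) \<delta> = \<delta>"
  by (simp add: push_def Emap_id)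

lemma pull_id [simp]: "\<lbrakk>D \<in> Obj B; A \<in> Obj B; \<delta> \<in> ext D A\<rbrakk> \<Longrightarrow> pll A (idm B D) \<delta> = \<delta>"
  by (simp add: pull_def Emap_id)

lemma push_push [simp]:
  "\<lbrakk>D \<in> Obj B; mor f; mor g; src g = tgt f; \<delta> \<in> ext D (src f)\<rbrakk>
    \<Longrightarrow> psh D g (psh D f \<delta>) = psh D (g \<cdot> f) \<delta>"
  unfolding push_def
  using Emap_cmp[of D D D "src f" "tgt f" "tgt g" "idm B D" "idm B D" f g \<delta>] by simp

lemma pull_pull [simp]:
  "\<lbrakk>A \<in> Obj B; mor f; mor g; src g = tgt f; \<delta> \<in> ext (tgt g) A\<rbrakk>
    \<Longrightarrow> pll A f (pll A g \<delta>) = pll A (g \<cdot> f) \<delta>"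
  unfolding pull_def
  using Emap_cmp[of "tgt g" "src g" "src f" A A A g f "idm B A" "idm B A" \<delta>] by simp

text \<open>Both sides equal \<open>Emap E g f\<close>, split by functoriality in the two possible
  orders.\<close>

lemma push_pull:
  assumes "mor f" "mor g" "\<delta> \<in> ext (tgt g) (src f)" "src g = D" "src f = A"
  shows "psh D f (pll A g \<delta>) = pll (tgt f) g (psh (tgt g) f \<delta>)"
  unfolding push_def pull_def
  using Emap_cmp[of "tgt g" "src g" "src g" "src f" "src f" "tgt f" g "idm B D" "idm B A" f \<delta>]
    Emap_cmp[of "tgt g" "tgt g" "src g" "src f" "tgt f" "tgt f" "idm B (tgt g)" g f "idm B (tgt f)" \<delta>]
    assms by auto

lemma push_add:
  "\<lbrakk>D \<in> Obj B; mor f; mor g; src f = src g; tgt f = tgt g; \<delta> \<in> ext D (src g)\<rbrakk>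
    \<Longrightarrow> psh D (f \<boxplus> g) \<delta> = psh D f \<delta> \<otimes>\<^bsub>Ext E D (tgt g)\<^esub> psh D g \<delta>"
  unfolding push_def
  using Emap_add_right[of D D "src g" "tgt g" "idm B D" f g \<delta>] by simp

lemma pull_add:
  "\<lbrakk>A \<in> Obj B; mor f; mor g; src f = src g; tgt f = tgt g; \<delta> \<in> ext (tgt g) A\<rbrakk>
    \<Longrightarrow> pll A (f \<boxplus> g) \<delta> = pll A f \<delta> \<otimes>\<^bsub>Ext E (src g) A\<^esub> pll A g \<delta>"
  unfolding pull_def
  using Emap_add_left[of "tgt g" "src g" A A f g "idm B A" \<delta>] by simp

lemma ext_idem:
  assumes "D \<in> Obj B" "A \<in> Obj B" "\<delta> \<in> ext D A" "\<delta> = \<delta> \<otimes>\<^bsub>Ext E D A\<^esub> \<delta>"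
  shows "\<delta> = ext0 D A"
proof -
  interpret comm_group "Ext E D A" by (rule ext_group[OF assms(1,2)])
  show ?thesis using assms(3,4) r_cancel_one' by metis
qed

lemma push_zero_mor [simp]:
  assumes "D \<in> Obj B" "A \<in> Obj B" "A' \<in> Obj B" "\<delta> \<in> ext D A"
  shows "psh D (zero_mor B A A') \<delta> = ext0 D A'"
proof (rule ext_idem)
  show "psh D (zero_mor B A A') \<delta> = psh D (zero_mor B A A') \<delta> \<otimes>\<^bsub>Ext E D A'\<^esub> psh D (zero_mor B A A') \<delta>"
    using push_add[of D "zero_mor B A A'" "zero_mor B A A'" \<delta>] assms
      add_zero(1)[of "zero_mor B A A'" A A'] by (metis mor_zero)
qed (use assms in simp_all)

lemma pull_zero_mor [simp]:
  assumes "D \<in> Obj B" "D' \<in> Obj B" "A \<in> Obj B" "\<delta> \<in> ext D A"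
  shows "pll A (zero_mor B D' D) \<delta> = ext0 D' A"
proof (rule ext_idem)
  show "pll A (zero_mor B D' D) \<delta> = pll A (zero_mor B D' D) \<delta> \<otimes>\<^bsub>Ext E D' A\<^esub> pll A (zero_mor B D' D) \<delta>"
    using pull_add[of A "zero_mor B D' D" "zero_mor B D' D" \<delta>] assms
      add_zero(1)[of "zero_mor B D' D" D' D] by (metis mor_zero)
qed (use assms in simp_all)

end

section \<open>Conflations and exact sequences\<close>

context extriangulated_category
begin

abbreviation real :: "'e \<Rightarrow> 'o \<Rightarrow> 'm \<Rightarrow> 'o \<Rightarrow> 'm \<Rightarrow> 'o \<Rightarrow> bool" where
  "real \<equiv> realised_by B E s"

lemma realD:
  assumes "real \<delta> A a M b D"
  shows "A \<in> Obj B" "M \<in> Obj B" "D \<in> Obj B" "\<delta> \<in> ext D A"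
    "mor a" "src a = A" "tgt a = M" "mor b" "src b = M" "tgt b = D"
  using assms unfolding realised_by_def by auto

lemma ex_realD:
  assumes "D \<in> Obj B" "A \<in> Obj B" "\<delta> \<in> ext D A"
  shows "\<exists>a M b. real \<delta> A a M b D"
proof -
  obtain ab where ab: "ab \<in> sequences B A D" "s D A \<delta> = seq_equiv B A D `` {ab}"
    using s_class[OF assms] by (auto elim: quotientE)
  then obtain a b M where "ab = (a, b)" "M \<in> Obj B" "a \<in> Mor B A M" "b \<in> Mor B M D"
    unfolding sequences_def by auto
  then show ?thesis using ab assms unfolding realised_by_def by metis
qed

lemma seq_equiv_refl:
  assumes "A \<in> Obj B" "D \<in> Obj B" "M \<in> Obj B" "a \<in> Mor B A M" "b \<in> Mor B M D"
  shows "((a, b), (a, b)) \<in> seq_equiv B A D"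
proof -
  have "is_iso B M M (idm B M)" using assms(3) by (auto simp: is_iso_def)
  then show ?thesis unfolding seq_equiv_def using assms by fastforce
qed

lemma real_unique:
  assumes "real \<delta> A a M b D" "real \<delta> A a' M' b' D"
  shows "\<exists>g h. mor g \<and> src g = M \<and> tgt g = M' \<and> mor h \<and> src h = M' \<and> tgt h = M \<and>
    h \<cdot> g = idm B M \<and> g \<cdot> h = idm B M' \<and> g \<cdot> a = a' \<and> b' \<cdot> g = b \<and> h \<cdot> a' = a \<and> b \<cdot> h = b'"
proof -
  note [simp] = realD[OF assms(1)] realD[OF assms(2)]
  have "(a', b') \<in> seq_equiv B A D `` {(a, b)}"
    using assms seq_equiv_refl[of A D M' a' b'] unfolding realised_by_def by auto
  then obtain N N' g where N: "N \<in> Obj B" "N' \<in> Obj B" "a \<in> Mor B A N" "a' \<in> Mor B A N'"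
    and g: "is_iso B N N' g" "g \<cdot> a = a'" "b' \<cdot> g = b"
    unfolding seq_equiv_def by (simp del: Mor_iff) blast
  have [simp]: "N = M" "N' = M'" using N by auto
  obtain h where h: "mor g" "src g = M" "tgt g = M'" "mor h" "src h = M'" "tgt h = M"
    "h \<cdot> g = idm B M" "g \<cdot> h = idm B M'"
    using iso_inverse[OF g(1)] by auto
  have "h \<cdot> a' = h \<cdot> g \<cdot> a" "b \<cdot> h = b' \<cdot> (g \<cdot> h)" using h(1-6) unfolding g(2,3)[symmetric] by simp_all
  then have "h \<cdot> a' = a" "b \<cdot> h = b'" using h by (simp_all del: assoc)
  then show ?thesis using h g by blast
qed

lemma real_split:
  assumes "A \<in> Obj B" "zero_object B Z"
  shows "real (ext0 Z A) A (idm B A) A (zero_mor B A Z) Z"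
    and "real (ext0 A Z) Z (zero_mor B Z A) A (idm B A) A"
  using s_zero[OF biproduct_zero[OF assms]] s_zero[OF biproduct_commute[OF biproduct_zero[OF assms]]]
  by simp_all

text \<open>Any direct sum realises zero, and two realisations of the same extension are isomorphic
  over the fixed ends.\<close>

lemma real_zero_biproduct:
  assumes "real (ext0 D A) A a M b D"
  shows "\<exists>j p. is_biproduct B A D M a j p b"
proof -
  note [simp] = realD[OF assms]
  obtain P i j p q where b: "is_biproduct B A D P i j p q" using ex_biproduct[of A D] by auto
  from real_unique[OF s_zero[OF b] assms] obtain g h where
    "mor g" "src g = P" "tgt g = M" "mor h" "src h = M" "tgt h = P"
    "h \<cdot> g = idm B P" "g \<cdot> h = idm B M" "g \<cdot> i = a" "q \<cdot> h = b"
    by blast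
  then show ?thesis using biproduct_iso[OF b, of g M h] by auto
qed

text \<open>Comparing the split conflation A = A -> 0 with the given one, (ET3) makes
  \<open>b \<cdot> a\<close> factor through a zero object.\<close>

lemma real_cmp_zero:
  assumes "real \<delta> A a M b D" shows "b \<cdot> a = zero_mor B A D"
proof -
  note [simp] = realD[OF assms]
  obtain Z where Z: "zero_object B Z" using ex_zero_object by blast
  then have [simp]: "Z \<in> Obj B" by (simp add: zero_object_def)
  obtain h where "ext_morphism B E Z A (ext0 Z A) D A \<delta> (idm B A) h" "h \<cdot> zero_mor B A Z = b \<cdot> a"
    using ET3[OF real_split(1)[OF _ Z, of A] assms, where f = "idm B A" and g = a] by auto
  then show ?thesis by (auto simp: ext_morphism_def)
qed

text \<open>Mapping the conflation to M = M -> 0 by \<open>a\<close>, (ET3) identifies the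
  pushforward of \<open>\<delta>\<close> with a pullback of the zero extension.\<close>

lemma push_infl:
  assumes "real \<delta> A a M b D" shows "psh D a \<delta> = ext0 D M"
proof -
  note [simp] = realD[OF assms]
  obtain Z where Z: "zero_object B Z" using ex_zero_object by blast
  then have [simp]: "Z \<in> Obj B" by (simp add: zero_object_def)
  obtain h where "ext_morphism B E D A \<delta> Z M (ext0 Z M) a h"
    using ET3[OF assms real_split(1)[OF _ Z, of M], where f = a and g = "idm B M"] by auto
  then show ?thesis by (auto simp: ext_morphism_def)
qed

lemma pull_defl:
  assumes "real \<delta> A a M b D" shows "pll A b \<delta> = ext0 M A"
proof -
  note [simp] = realD[OF assms]
  obtain Z where Z: "zero_object B Z" using ex_zero_object by blast
  then have [simp]: "Z \<in> Obj B" by (simp add: zero_object_def)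
  obtain h where "ext_morphism B E M Z (ext0 M Z) D A \<delta> h b"
    using ET3_op[OF real_split(2)[OF _ Z, of M] assms, where g = "idm B M" and h = b] by auto
  then show ?thesis by (auto simp: ext_morphism_def)
qed

text \<open>The morphism \<open>x\<close> is regarded as the middle map from the split conflation
  with terms \<open>src x\<close>, \<open>src x\<close> and 0; the left component supplied by
  (ET3op) is the lift.\<close>

lemma lift_infl:
  assumes "real \<delta> A a M b D" "mor x" "tgt x = M" "b \<cdot> x = zero_mor B (src x) D"
  shows "\<exists>y. mor y \<and> src y = src x \<and> tgt y = A \<and> a \<cdot> y = x"
proof -
  note [simp] = realD[OF assms(1)] assms(2,3)
  obtain Z where Z: "zero_object B Z" using ex_zero_object by blast
  then have [simp]: "Z \<in> Obj B" by (simp add: zero_object_def)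
  have "\<exists>y. ext_morphism B E Z (src x) (ext0 Z (src x)) D A \<delta> y (zero_mor B Z D) \<and> x \<cdot> idm B (src x) = a \<cdot> y"
    by (rule ET3_op[OF real_split(1)[OF _ Z, of "src x"] assms(1)]) (use assms(4) in simp_all)
  then obtain y where "ext_morphism B E Z (src x) (ext0 Z (src x)) D A \<delta> y (zero_mor B Z D)" "a \<cdot> y = x"
    using assms(2) by auto
  then show ?thesis by (intro exI[of _ y]) (simp add: ext_morphism_def)
qed

lemma extend_defl:
  assumes "real \<delta> A a M b D" "mor x" "src x = M" "x \<cdot> a = zero_mor B A (tgt x)"
  shows "\<exists>y. mor y \<and> src y = D \<and> tgt y = tgt x \<and> y \<cdot> b = x"
proof -
  note [simp] = realD[OF assms(1)] assms(2,3)
  obtain Z where Z: "zero_object B Z" using ex_zero_object by blast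
  then have [simp]: "Z \<in> Obj B" by (simp add: zero_object_def)
  have "\<exists>y. ext_morphism B E D A \<delta> (tgt x) Z (ext0 (tgt x) Z) (zero_mor B A Z) y \<and> y \<cdot> b = idm B (tgt x) \<cdot> x"
    by (rule ET3[OF assms(1) real_split(2)[OF _ Z, of "tgt x"]]) (use assms(4) in simp_all)
  then obtain y where "ext_morphism B E D A \<delta> (tgt x) Z (ext0 (tgt x) Z) (zero_mor B A Z) y" "y \<cdot> b = x"
    using assms(2) by auto
  then show ?thesis by (intro exI[of _ y]) (simp add: ext_morphism_def)
qed

text \<open>Vanishing of the pushforward means that \<open>f\<close> and the identity of
  \<open>D\<close> form a morphism to the zero extension. It is realised by a map into a direct sum,
  whose component in \<open>tgt f\<close> is the extension.\<close>

lemma extend_infl: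
  assumes "real \<delta> A a M b D" "mor f" "src f = A" "psh D f \<delta> = ext0 D (tgt f)"
  shows "\<exists>g. mor g \<and> src g = M \<and> tgt g = tgt f \<and> g \<cdot> a = f"
proof -
  note [simp] = realD[OF assms(1)] assms(2,3)
  obtain P i j p q where b: "is_biproduct B (tgt f) D P i j p q" using ex_biproduct[of "tgt f" D] by auto
  note [simp] = biproductD[OF b]
  obtain g where "g \<in> Mor B M P" and ga: "g \<cdot> a = i \<cdot> f"
    using s_realises[OF assms(1) s_zero[OF b], where f = f and h = "idm B D"] assms(4) by (auto simp: ext_morphism_def)
  then have [simp]: "mor g" "src g = M" "tgt g = P" by simp_all
  have "p \<cdot> (g \<cdot> a) = f" using assoc[of f i p] by (simp add: ga del: assoc)
  then show ?thesis by (intro exI[of _ "p \<cdot> g"]) simp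
qed

lemma lift_defl:
  assumes "real \<delta> A a M b D" "mor g" "tgt g = D" "pll A g \<delta> = ext0 (src g) A"
  shows "\<exists>h. mor h \<and> src h = src g \<and> tgt h = M \<and> b \<cdot> h = g"
proof -
  note [simp] = realD[OF assms(1)] assms(2,3)
  obtain P i j p q where b: "is_biproduct B A (src g) P i j p q" using ex_biproduct[of A "src g"] by auto
  note [simp] = biproductD[OF b]
  obtain h where "h \<in> Mor B P M" and bh: "b \<cdot> h = g \<cdot> q"
    using s_realises[OF s_zero[OF b] assms(1), where f = "idm B A" and h = g] assms(4) by (auto simp: ext_morphism_def)
  then have [simp]: "mor h" "src h = P" "tgt h = M" by simp_all
  have "b \<cdot> h \<cdot> j = g \<cdot> q \<cdot> j" by (simp only: bh)
  then have "b \<cdot> (h \<cdot> j) = g" by simp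
  then show ?thesis by (intro exI[of _ "h \<cdot> j"]) simp
qed

text \<open>Exactness at E(D, X): since \<open>b\<close> kills \<open>\<epsilon>\<close>, it lifts
  along the deflation of a realisation of \<open>\<epsilon>\<close>, and (ET3op) produces the
  morphism between the left ends.\<close>

lemma ext_eq_push:
  assumes "real \<delta> A a M b D" "X \<in> Obj B" "\<epsilon> \<in> ext D X" "pll X b \<epsilon> = ext0 M X"
  shows "\<exists>\<phi>. mor \<phi> \<and> src \<phi> = A \<and> tgt \<phi> = X \<and> psh D \<phi> \<delta> = \<epsilon>"
proof -
  note [simp] = realD[OF assms(1)] assms(2,3)
  obtain x K y where r: "real \<epsilon> X x K y D" using ex_realD[of D X \<epsilon>] by auto
  note [simp] = realD[OF r]
  obtain g where "mor g" "src g = M" "tgt g = K" "y \<cdot> g = b"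
    using lift_defl[OF r, of b] assms(4) by auto
  then obtain f where "ext_morphism B E D A \<delta> D X \<epsilon> f (idm B D)"
    using ET3_op[OF assms(1) r, where g = g and h = "idm B D"] by auto
  then show ?thesis by (auto simp: ext_morphism_def)
qed

lemma ext_eq_pull:
  assumes "real \<delta> A a M b D" "X \<in> Obj B" "\<epsilon> \<in> ext X A" "psh X a \<epsilon> = ext0 X M"
  shows "\<exists>\<psi>. mor \<psi> \<and> src \<psi> = X \<and> tgt \<psi> = D \<and> pll A \<psi> \<delta> = \<epsilon>"
proof -
  note [simp] = realD[OF assms(1)] assms(2,3)
  obtain x K y where r: "real \<epsilon> A x K y X" using ex_realD[of X A \<epsilon>] by auto
  note [simp] = realD[OF r]
  obtain g where "mor g" "src g = K" "tgt g = M" "g \<cdot> x = a"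
    using extend_infl[OF r, of a] assms(4) by auto
  then obtain f where "ext_morphism B E X A \<epsilon> D A \<delta> (idm B A) f"
    using ET3[OF r assms(1), where f = "idm B A" and g = g] by auto
  then show ?thesis by (auto simp: ext_morphism_def)
qed

text \<open>(ET4) yields \<open>\<delta>''\<close> and \<open>e\<close> with \<open>a\<^sub>* \<delta>'' = e\<^sup>* \<epsilon>\<close>, where \<open>e\<close> is the deflation of \<open>b\<^sub>* \<epsilon> = 0\<close>;
  pull this equation back along a section of \<open>e\<close>.\<close>

lemma ext_exact_push:
  assumes "real \<delta> A a M b D" "X \<in> Obj B" "\<epsilon> \<in> ext X M" "psh X b \<epsilon> = ext0 X D"
  shows "\<exists>\<epsilon>'. \<epsilon>' \<in> ext X A \<and> psh X a \<epsilon>' = \<epsilon>"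
proof -
  note [simp] = realD[OF assms(1)] assms(2,3)
  obtain x N y where r: "real \<epsilon> M x N y X" using ex_realD[of X M \<epsilon>] by auto
  note [simp] = realD[OF r]
  from ET4[OF assms(1) r] obtain G \<delta>'' c c' d e where
    r1: "real \<delta>'' A c N c' G" and r2: "real (psh X b \<epsilon>) D d G e X"
    and eq: "psh G a \<delta>'' = pll M e \<epsilon>" by blast
  note [simp] = realD[OF r1] realD[OF r2]
  have "\<exists>j p. is_biproduct B D X G d j p e"
    using r2 unfolding assms(4) by (rule real_zero_biproduct)
  then obtain j p where b: "is_biproduct B D X G d j p e" by blast
  note [simp] = biproductD[OF b]
  have "psh X a (pll A j \<delta>'') = pll M j (pll M e \<epsilon>)"
    by (subst push_pull) (simp_all add: eq del: pull_pull)
  then show ?thesis by (intro exI[of _ "pll A j \<delta>''"]) simp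
qed

text \<open>The dual chase by (ET4op): the inflation \<open>e\<close> of the split conflation
  \<open>X -> G -> A\<close> has a retraction \<open>p\<close>, and pushing
  \<open>\<delta>''\<close> along \<open>p\<close> gives the required class.\<close>

lemma ext_exact_pull:
  assumes "real \<delta> A a M b D" "X \<in> Obj B" "\<epsilon> \<in> ext M X" "pll X a \<epsilon> = ext0 A X"
  shows "\<exists>\<epsilon>'. \<epsilon>' \<in> ext D X \<and> pll X b \<epsilon>' = \<epsilon>"
proof -
  note [simp] = realD[OF assms(1)] assms(2,3)
  obtain x N y where r: "real \<epsilon> X x N y M" using ex_realD[of M X \<epsilon>] by auto
  note [simp] = realD[OF r]
  from ET4_op[OF assms(1) r] obtain G \<delta>'' c c' d e where
    r1: "real \<delta>'' G c' N c D" and r2: "real (pll X a \<epsilon>) X e G d A"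
    and eq: "pll G b \<delta>'' = psh M e \<epsilon>" by blast
  note [simp] = realD[OF r1] realD[OF r2]
  have "\<exists>j p. is_biproduct B X A G e j p d"
    using r2 unfolding assms(4) by (rule real_zero_biproduct)
  then obtain j p where b: "is_biproduct B X A G e j p d" by blast
  note [simp] = biproductD[OF b]
  have "pll X b (psh D p \<delta>'') = psh M p (psh M e \<epsilon>)"
    by (simp add: push_pull eq flip: eq del: push_push)
  then show ?thesis by (intro exI[of _ "psh D p \<delta>''"]) simp
qed

end

section \<open>Cotorsion pairs\<close>

context extriangulated_category
begin

definition noext :: "'o \<Rightarrow> 'o \<Rightarrow> bool" where
  "noext D A \<longleftrightarrow> (\<forall>\<epsilon> \<in> ext D A. \<epsilon> = ext0 D A)"

lemma noextD: "noext D A \<Longrightarrow> \<epsilon> \<in> ext D A \<Longrightarrow> \<epsilon> = ext0 D A"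
  by (simp add: noext_def)

lemma noext_mid_left:
  assumes "real \<delta> A a M b D" "noext A X" "noext D X" "X \<in> Obj B"
  shows "noext M X"
  unfolding noext_def
proof
  note [simp] = realD[OF assms(1)] assms(4)
  fix \<epsilon> assume \<epsilon>: "\<epsilon> \<in> ext M X"
  then have "pll X a \<epsilon> = ext0 A X" by (intro noextD[OF assms(2)]) simp
  from ext_exact_pull[OF assms(1,4) \<epsilon> this] obtain \<epsilon>' where "\<epsilon>' \<in> ext D X" "pll X b \<epsilon>' = \<epsilon>" by blast
  then show "\<epsilon> = ext0 M X" using noextD[OF assms(3)] by (metis pull_ext0 realD[OF assms(1)] assms(4))
qed

lemma noext_mid_right:
  assumes "real \<delta> A a M b D" "noext X A" "noext X D" "X \<in> Obj B"
  shows "noext X M"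
  unfolding noext_def
proof
  note [simp] = realD[OF assms(1)] assms(4)
  fix \<epsilon> assume \<epsilon>: "\<epsilon> \<in> ext X M"
  then have "psh X b \<epsilon> = ext0 X D" by (intro noextD[OF assms(3)]) simp
  from ext_exact_push[OF assms(1,4) \<epsilon> this] obtain \<epsilon>' where "\<epsilon>' \<in> ext X A" "psh X a \<epsilon>' = \<epsilon>" by blast
  then show "\<epsilon> = ext0 X M" using noextD[OF assms(2)] by (metis push_ext0 realD[OF assms(1)] assms(4))
qed

lemma noext_zero_object:
  assumes "zero_object B Z" "X \<in> Obj B" shows "noext Z X" "noext X Z"
proof -
  have Z: "Z \<in> Obj B" using assms(1) by (simp add: zero_object_def)
  then have "idm B Z = zero_mor B Z Z" using assms(1) zero_object_iff_id by blast
  then show "noext Z X" "noext X Z"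
    unfolding noext_def using assms(2) Z by (metis pull_id pull_zero_mor, metis push_id push_zero_mor)
qed

lemma cotorsion_pairD:
  assumes "cotorsion_pair B E s \<U> \<V>"
  shows "\<U> \<subseteq> Obj B" "\<V> \<subseteq> Obj B" "\<And>U V. \<lbrakk>U \<in> \<U>; V \<in> \<V>\<rbrakk> \<Longrightarrow> noext U V"
    and "\<And>X. X \<in> Obj B \<Longrightarrow> \<exists>V \<in> \<V>. \<exists>U \<in> \<U>. \<exists>\<delta> a b. real \<delta> V a U b X"
    and "\<And>X. X \<in> Obj B \<Longrightarrow> \<exists>V \<in> \<V>. \<exists>U \<in> \<U>. \<exists>\<delta> a b. real \<delta> X a V b U"
proof -
  show "\<U> \<subseteq> Obj B" "\<V> \<subseteq> Obj B"
    using assms unfolding cotorsion_pair_def additive_summand_closed_def by auto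
  show "noext U V" if "U \<in> \<U>" "V \<in> \<V>" for U V
    using assms that unfolding cotorsion_pair_def ext_vanish_def noext_def by auto
  show "\<exists>V \<in> \<V>. \<exists>U \<in> \<U>. \<exists>\<delta> a b. real \<delta> V a U b X" if "X \<in> Obj B" for X
  proof -
    have "X \<in> Cone B E s \<V> \<U>" using assms that unfolding cotorsion_pair_def by blast
    then show ?thesis unfolding Cone_def conflation_def by blast
  qed
  show "\<exists>V \<in> \<V>. \<exists>U \<in> \<U>. \<exists>\<delta> a b. real \<delta> X a V b U" if "X \<in> Obj B" for X
  proof -
    have "X \<in> CoCone B E s \<V> \<U>" using assms that unfolding cotorsion_pair_def by blast
    then show ?thesis unfolding CoCone_def conflation_def by blast
  qed
qed

text \<open>If X has no extensions by \<open>\<V>\<close>, its approximation V -> U -> X splits and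
  X is a summand of U. Thus each class of a cotorsion pair determines the other, and membership
  reduces to vanishing of extension groups.\<close>

lemma cotorsion_pair_left_iff:
  assumes "cotorsion_pair B E s \<U> \<V>" "X \<in> Obj B"
  shows "X \<in> \<U> \<longleftrightarrow> (\<forall>V \<in> \<V>. noext X V)"
proof
  assume no: "\<forall>V \<in> \<V>. noext X V"
  obtain V U \<delta> a b where V: "V \<in> \<V>" and U: "U \<in> \<U>" and r: "real \<delta> V a U b X"
    using cotorsion_pairD(4)[OF assms] by blast
  have "\<delta> = ext0 X V" using no V realD(4)[OF r] noextD by blast
  then obtain j p where "is_biproduct B V X U a j p b" using real_zero_biproduct r by blast
  moreover have "closed_under_summands B \<U>"
    using assms unfolding cotorsion_pair_def additive_summand_closed_def by blast
  ultimately show "X \<in> \<U>" using U unfolding closed_under_summands_def by blast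
qed (use cotorsion_pairD(3)[OF assms(1)] in blast)

lemma cotorsion_pair_right_iff:
  assumes "cotorsion_pair B E s \<U> \<V>" "X \<in> Obj B"
  shows "X \<in> \<V> \<longleftrightarrow> (\<forall>U \<in> \<U>. noext U X)"
proof
  assume no: "\<forall>U \<in> \<U>. noext U X"
  obtain V U \<delta> a b where V: "V \<in> \<V>" and U: "U \<in> \<U>" and r: "real \<delta> X a V b U"
    using cotorsion_pairD(5)[OF assms] by blast
  have "\<delta> = ext0 U X" using no U realD(4)[OF r] noextD by blast
  then obtain j p where "is_biproduct B X U V a j p b" using real_zero_biproduct r by blast
  moreover have "closed_under_summands B \<V>"
    using assms unfolding cotorsion_pair_def additive_summand_closed_def by blast
  ultimately show "X \<in> \<V>" using V unfolding closed_under_summands_def by blast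
qed (use cotorsion_pairD(3)[OF assms(1)] in blast)

text \<open>Both classes are characterised by vanishing of extension groups, which passes from the
  ends of a conflation to its middle term by exactness.\<close>

lemma cotorsion_pair_extension_closed:
  assumes "cotorsion_pair B E s \<U> \<V>" "real \<delta> A a M b D"
  shows "A \<in> \<U> \<Longrightarrow> D \<in> \<U> \<Longrightarrow> M \<in> \<U>" "A \<in> \<V> \<Longrightarrow> D \<in> \<V> \<Longrightarrow> M \<in> \<V>"
proof -
  note [simp] = realD[OF assms(2)]
  have sub: "\<U> \<subseteq> Obj B" "\<V> \<subseteq> Obj B" using cotorsion_pairD[OF assms(1)] by blast+
  show "A \<in> \<U> \<Longrightarrow> D \<in> \<U> \<Longrightarrow> M \<in> \<U>"
    using noext_mid_left[OF assms(2)] cotorsion_pair_left_iff[OF assms(1)] sub by auto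
  show "A \<in> \<V> \<Longrightarrow> D \<in> \<V> \<Longrightarrow> M \<in> \<V>"
    using noext_mid_right[OF assms(2)] cotorsion_pair_right_iff[OF assms(1)] sub by auto
qed

text \<open>(ET4) is applied to the split conflation \<open>A \<rightarrow> A \<oplus> X \<rightarrow> X\<close> with inclusion \<open>(1, f)\<close> and to
  \<open>A \<oplus> X \<rightarrow> N \<oplus> X \<rightarrow> D\<close>.\<close>

lemma real_infl_biproduct:
  assumes r: "real \<delta> A w N p D" and f: "mor f" "src f = A" "tgt f = X"
    and P: "is_biproduct B N X P i j p1 p2"
  shows "\<exists>G \<delta>' c d e. real (pll A e \<delta>) A (i \<cdot> w \<boxplus> j \<cdot> f) P c G \<and> real \<delta>' X d G e D"
proof -
  note [simp] = realD[OF r] f biproductD[OF P]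
  obtain R i0 j0 p0 q0 where R: "is_biproduct B A X R i0 j0 p0 q0" using ex_biproduct[of A X] by auto
  note [simp] = biproductD[OF R]
  obtain Z where Z: "zero_object B Z" using ex_zero_object by blast
  then have [simp]: "Z \<in> Obj B" by (simp add: zero_object_def)
  have r1: "real (ext0 X A) A (i0 \<boxplus> j0 \<cdot> f) R (q0 \<boxplus> neg (f \<cdot> p0)) X"
    by (rule s_zero[OF biproduct_shear[OF R f]])
  \<comment> \<open>This is the sum of the given conflation with the trivial one X = X -> 0; the
    third term is still \<open>D\<close> because \<open>D\<close> itself serves as a direct sum of
    \<open>D\<close> and 0.\<close>
  obtain \<delta>' m n where \<delta>': "\<delta>' = psh D i0 \<delta>" and m: "m = i \<cdot> (w \<cdot> p0) \<boxplus> j \<cdot> q0"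
    and r2: "real \<delta>' R m P n D"
    using s_sum[OF r real_split(1)[OF _ Z, of X] R P biproduct_zero[OF _ Z, of D]] by simp
  note [simp] = realD[OF r2]
  from ET4[OF r1 r2] obtain G \<delta>'' c c' d e where
    r3: "real \<delta>'' A c P c' G" and r4: "real (psh D (q0 \<boxplus> neg (f \<cdot> p0)) \<delta>') X d G e D"
    and c: "c = m \<cdot> (i0 \<boxplus> j0 \<cdot> f)" and eq: "psh G (i0 \<boxplus> j0 \<cdot> f) \<delta>'' = pll R e \<delta>'" by blast
  note [simp] = realD[OF r3] realD[OF r4]
  have [simp]: "p0 \<cdot> (j0 \<cdot> f) = zero_mor B A A" "q0 \<cdot> (j0 \<cdot> f) = f"
    using assoc[of f j0 p0] assoc[of f j0 q0] by (simp_all del: assoc)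
  have "c = i \<cdot> w \<boxplus> j \<cdot> f" by (simp add: c m)
  moreover have "\<delta>'' = pll A e \<delta>"
  proof -
    \<comment> \<open>The projection \<open>p0\<close> is a retraction of the sheared inclusion, so
      pushing the (ET4) identity along it recovers \<open>\<delta>''\<close>.\<close>
    have "\<delta>'' = psh G p0 (psh G (i0 \<boxplus> j0 \<cdot> f) \<delta>'')" by simp
    also have "\<dots> = pll A e (psh D p0 \<delta>')" unfolding eq by (subst push_pull) simp_all
    also have "psh D p0 \<delta>' = \<delta>" by (simp add: \<delta>')
    finally show ?thesis .
  qed
  ultimately show ?thesis using r3 r4 by blast
qed

end

section \<open>Twin cotorsion pairs\<close>

locale twin_cotorsion = extriangulated_category B E s
  for B :: "('o, 'm) cat" (structure) and E :: "('o, 'm, 'e) bifun"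
    and s :: "('o, 'm, 'e) seq_assignment" +
  fixes \<S> \<T> \<U> \<V> :: "'o set"
  assumes twin: "twin_cotorsion_pair B E s \<S> \<T> \<U> \<V>"
begin

definition "\<W> = \<T> \<inter> \<U>"
definition "Bminus = CoCone B E s \<W> \<S>"
definition "Bplus = Cone B E s \<V> \<W>"

lemma ST_pair: "cotorsion_pair B E s \<S> \<T>" and UV_pair: "cotorsion_pair B E s \<U> \<V>"
  and SV_vanish: "ext_vanish E \<S> \<V>"
  using twin unfolding twin_cotorsion_pair_def by auto

lemma objs [simp]:
  "X \<in> \<S> \<Longrightarrow> X \<in> Obj B" "X \<in> \<T> \<Longrightarrow> X \<in> Obj B" "X \<in> \<U> \<Longrightarrow> X \<in> Obj B" "X \<in> \<V> \<Longrightarrow> X \<in> Obj B"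
  "X \<in> \<W> \<Longrightarrow> X \<in> Obj B" "X \<in> Bminus \<Longrightarrow> X \<in> Obj B" "X \<in> Bplus \<Longrightarrow> X \<in> Obj B"
  using cotorsion_pairD(1,2)[OF ST_pair] cotorsion_pairD(1,2)[OF UV_pair]
  unfolding \<W>_def Bminus_def Bplus_def Cone_def CoCone_def by blast+

lemma noext_ST: "S \<in> \<S> \<Longrightarrow> T \<in> \<T> \<Longrightarrow> noext S T"
  and noext_UV: "U \<in> \<U> \<Longrightarrow> V \<in> \<V> \<Longrightarrow> noext U V"
  and noext_SV: "S \<in> \<S> \<Longrightarrow> V \<in> \<V> \<Longrightarrow> noext S V"
  using cotorsion_pairD(3)[OF ST_pair] cotorsion_pairD(3)[OF UV_pair] SV_vanish
  unfolding ext_vanish_def noext_def by auto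

lemma S_sub_U: "S \<in> \<S> \<Longrightarrow> S \<in> \<U>"
  using cotorsion_pair_left_iff[OF UV_pair] noext_SV by simp

lemma V_sub_T: "V \<in> \<V> \<Longrightarrow> V \<in> \<T>"
  using cotorsion_pair_right_iff[OF ST_pair] noext_SV by simp

lemma W_T: "X \<in> \<W> \<Longrightarrow> X \<in> \<T>" and W_U: "X \<in> \<W> \<Longrightarrow> X \<in> \<U>"
  by (simp_all add: \<W>_def)

lemma BminusE:
  assumes "X \<in> Bminus"
  obtains \<delta> w N p S where "N \<in> \<W>" "S \<in> \<S>" "real \<delta> X w N p S"
  using assms unfolding Bminus_def CoCone_def conflation_def by blast

lemma BplusE:
  assumes "X \<in> Bplus"
  obtains \<delta> V v N p where "V \<in> \<V>" "N \<in> \<W>" "real \<delta> V v N p X"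
  using assms unfolding Bplus_def Cone_def conflation_def by blast

text \<open>The obstruction to extending \<open>f\<close> lies in E(S, T), which is zero for S in
  \<open>\<S>\<close> and T in \<open>\<T>\<close>.\<close>

lemma extend_to_T:
  assumes "real \<delta> A a M b S" "S \<in> \<S>" "mor f" "src f = A" "tgt f \<in> \<T>"
  shows "\<exists>g. mor g \<and> src g = M \<and> tgt g = tgt f \<and> g \<cdot> a = f"
  using assms realD[OF assms(1)] noextD[OF noext_ST[OF assms(2,5)]]
  by (intro extend_infl[OF assms(1)]) simp_all

lemma lift_from_U:
  assumes "real \<delta> V a M b D" "V \<in> \<V>" "mor f" "tgt f = D" "src f \<in> \<U>"
  shows "\<exists>g. mor g \<and> src g = src f \<and> tgt g = M \<and> b \<cdot> g = f"
  using assms realD[OF assms(1)] noextD[OF noext_UV[OF assms(5,2)]]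
  by (intro lift_defl[OF assms(1)]) simp_all

text \<open>Forward, \<open>\<theta>\<close> extends to an object of \<open>\<W>\<close>, which lies
  in \<open>\<U>\<close> and so has no extensions by \<open>\<V>\<close>. Backward, take X -> T -> S
  from the pair \<open>(\<S>, \<T>)\<close>: a class in E(T, V) restricts to zero on X, hence comes
  from E(S, V) = 0. So T lies in \<open>\<U>\<close> as well, and the chosen conflation already
  witnesses membership.\<close>

lemma Bminus_iff:
  "X \<in> Bminus \<longleftrightarrow> X \<in> Obj B \<and>
     (\<forall>\<theta> V \<epsilon>. mor \<theta> \<and> src \<theta> = X \<and> tgt \<theta> \<in> \<T> \<and> V \<in> \<V> \<and> \<epsilon> \<in> ext (tgt \<theta>) V \<longrightarrow> pll V \<theta> \<epsilon> = ext0 X V)"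
proof (intro iffI conjI allI impI)
  fix \<theta> V \<epsilon> assume X: "X \<in> Bminus"
    and th: "mor \<theta> \<and> src \<theta> = X \<and> tgt \<theta> \<in> \<T> \<and> V \<in> \<V> \<and> \<epsilon> \<in> ext (tgt \<theta>) V"
  obtain \<delta> w N p S where N: "N \<in> \<W>" and S: "S \<in> \<S>" and r: "real \<delta> X w N p S" using BminusE[OF X] .
  note [simp] = realD[OF r]
  obtain g where g: "mor g" "src g = N" "tgt g = tgt \<theta>" and gw: "g \<cdot> w = \<theta>"
    using extend_to_T[OF r S] th by blast
  have "pll V g \<epsilon> = ext0 N V"
    using g th N by (intro noextD[OF noext_UV[OF W_U]]) simp_all
  then have "pll V w (pll V g \<epsilon>) = ext0 X V" using th by simp
  then show "pll V \<theta> \<epsilon> = ext0 X V" using pull_pull[of V w g \<epsilon>] g th gw by simp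
next
  assume X: "X \<in> Obj B \<and>
     (\<forall>\<theta> V \<epsilon>. mor \<theta> \<and> src \<theta> = X \<and> tgt \<theta> \<in> \<T> \<and> V \<in> \<V> \<and> \<epsilon> \<in> ext (tgt \<theta>) V \<longrightarrow> pll V \<theta> \<epsilon> = ext0 X V)"
  obtain T S \<delta> a b where T: "T \<in> \<T>" and S: "S \<in> \<S>" and r: "real \<delta> X a T b S"
    using cotorsion_pairD(5)[OF ST_pair] X by blast
  note [simp] = realD[OF r]
  have "noext T V" if V: "V \<in> \<V>" for V
    unfolding noext_def
  proof
    fix \<epsilon> assume \<epsilon>: "\<epsilon> \<in> ext T V"
    then have "pll V a \<epsilon> = ext0 X V" using X T V by simp
    then obtain \<epsilon>' where "\<epsilon>' \<in> ext S V" "pll V b \<epsilon>' = \<epsilon>"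
      using ext_exact_pull[OF r _ \<epsilon>] V by auto
    then show "\<epsilon> = ext0 T V"
      using noextD[OF noext_SV[OF S V]] pull_ext0[of V b S] V by simp
  qed
  then have "T \<in> \<W>" using T cotorsion_pair_left_iff[OF UV_pair, of T] by (simp add: \<W>_def)
  then show "X \<in> Bminus" unfolding Bminus_def CoCone_def conflation_def using r S by simp blast
qed simp

lemma BminusD:
  "\<lbrakk>X \<in> Bminus; mor \<theta>; src \<theta> = X; tgt \<theta> \<in> \<T>; V \<in> \<V>; \<epsilon> \<in> ext (tgt \<theta>) V\<rbrakk> \<Longrightarrow> pll V \<theta> \<epsilon> = ext0 X V"
  using Bminus_iff by blast

lemma U_sub_Bminus: "X \<in> \<U> \<Longrightarrow> X \<in> Bminus"
  unfolding Bminus_iff using noextD[OF noext_UV, of X] by auto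

text \<open>Morphisms from \<open>X\<close> to \<open>\<T>\<close> extend to \<open>M\<close>, so
  the orthogonality test for \<open>X\<close> follows from that for \<open>M\<close>.\<close>

lemma Bminus_cocone_S:
  assumes "real \<delta> X a M b S" "M \<in> Bminus" "S \<in> \<S>" shows "X \<in> Bminus"
  unfolding Bminus_iff
proof (intro conjI allI impI)
  note [simp] = realD[OF assms(1)]
  show "X \<in> Obj B" by simp
  fix \<theta> V \<epsilon> assume th: "mor \<theta> \<and> src \<theta> = X \<and> tgt \<theta> \<in> \<T> \<and> V \<in> \<V> \<and> \<epsilon> \<in> ext (tgt \<theta>) V"
  obtain g where g: "mor g" "src g = M" "tgt g = tgt \<theta>" and ga: "g \<cdot> a = \<theta>"
    using extend_to_T[OF assms(1,3)] th by blast
  have "pll V g \<epsilon> = ext0 M V" using BminusD[OF assms(2) g(1)] g th by simp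
  then have "pll V a (pll V g \<epsilon>) = ext0 X V" using th by simp
  then show "pll V \<theta> \<epsilon> = ext0 X V" using pull_pull[of V a g \<epsilon>] g th ga by simp
qed

text \<open>The class pulled back to \<open>M\<close> restricts to zero on \<open>X\<close>, so it
  comes from E(S, V), and this group vanishes for a twin pair.\<close>

lemma Bminus_cone_S:
  assumes "real \<delta> X a M b S" "X \<in> Bminus" "S \<in> \<S>" shows "M \<in> Bminus"
  unfolding Bminus_iff
proof (intro conjI allI impI)
  note [simp] = realD[OF assms(1)]
  show "M \<in> Obj B" by simp
  fix \<theta> V \<epsilon> assume th: "mor \<theta> \<and> src \<theta> = M \<and> tgt \<theta> \<in> \<T> \<and> V \<in> \<V> \<and> \<epsilon> \<in> ext (tgt \<theta>) V"
  then have z: "pll V \<theta> \<epsilon> \<in> ext M V" by simp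
  have "pll V a (pll V \<theta> \<epsilon>) = ext0 X V"
    using BminusD[OF assms(2), of "\<theta> \<cdot> a" V \<epsilon>] th by simp
  then obtain \<epsilon>' where "\<epsilon>' \<in> ext S V" "pll V b \<epsilon>' = pll V \<theta> \<epsilon>"
    using ext_exact_pull[OF assms(1) _ z] th by auto
  then show "pll V \<theta> \<epsilon> = ext0 M V"
    using noextD[OF noext_SV[OF assms(3), of V], of \<epsilon>'] pull_ext0[of V b S] th by simp
qed

lemma Bminus_biproduct:
  assumes "X \<in> Bminus" "Y \<in> Bminus" "is_biproduct B X Y P i j p q" shows "P \<in> Bminus"
  unfolding Bminus_iff
proof (intro conjI allI impI)
  note [simp] = biproductD[OF assms(3)]
  show "P \<in> Obj B" by simp
  fix \<theta> V \<epsilon> assume th: "mor \<theta> \<and> src \<theta> = P \<and> tgt \<theta> \<in> \<T> \<and> V \<in> \<V> \<and> \<epsilon> \<in> ext (tgt \<theta>) V"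
  then have z [simp]: "pll V \<theta> \<epsilon> \<in> ext P V" "V \<in> Obj B" by simp_all
  have i: "pll V i (pll V \<theta> \<epsilon>) = ext0 X V" and j: "pll V j (pll V \<theta> \<epsilon>) = ext0 Y V"
    using BminusD[OF assms(1), of "\<theta> \<cdot> i" V \<epsilon>] BminusD[OF assms(2), of "\<theta> \<cdot> j" V \<epsilon>] th by simp_all
  have "pll V \<theta> \<epsilon> = pll V (i \<cdot> p \<boxplus> j \<cdot> q) (pll V \<theta> \<epsilon>)" by (simp del: pull_pull)
  also have "\<dots> = pll V p (pll V i (pll V \<theta> \<epsilon>)) \<otimes>\<^bsub>Ext E P V\<^esub> pll V q (pll V j (pll V \<theta> \<epsilon>))"
    using pull_add[of V "i \<cdot> p" "j \<cdot> q" "pll V \<theta> \<epsilon>"]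
      pull_pull[of V p i "pll V \<theta> \<epsilon>"] pull_pull[of V q j "pll V \<theta> \<epsilon>"] by (simp del: pull_pull)
  also have "\<dots> = ext0 P V" unfolding i j by simp
  finally show "pll V \<theta> \<epsilon> = ext0 P V" .
qed

section \<open>Good extensions\<close>

definition good :: "'o \<Rightarrow> 'o \<Rightarrow> 'e \<Rightarrow> bool" where
  "good D A \<delta> \<longleftrightarrow> (\<forall>\<phi>. mor \<phi> \<and> src \<phi> = A \<and> tgt \<phi> \<in> \<T> \<longrightarrow> psh D \<phi> \<delta> = ext0 D (tgt \<phi>))"

lemma goodD: "\<lbrakk>good D A \<delta>; mor \<phi>; src \<phi> = A; tgt \<phi> \<in> \<T>\<rbrakk> \<Longrightarrow> psh D \<phi> \<delta> = ext0 D (tgt \<phi>)"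
  by (simp add: good_def)

lemma good_S: "S \<in> \<S> \<Longrightarrow> A \<in> Obj B \<Longrightarrow> \<delta> \<in> ext S A \<Longrightarrow> good S A \<delta>"
  unfolding good_def using noextD[OF noext_ST] by simp

lemma good_pull:
  assumes "good D A \<delta>" "mor g" "tgt g = D" "A \<in> Obj B" "\<delta> \<in> ext D A"
  shows "good (src g) A (pll A g \<delta>)"
  unfolding good_def
proof (intro allI impI)
  fix \<phi> assume ph: "mor \<phi> \<and> src \<phi> = A \<and> tgt \<phi> \<in> \<T>"
  then have "psh (src g) \<phi> (pll A g \<delta>) = pll (tgt \<phi>) g (psh D \<phi> \<delta>)"
    using assms by (subst push_pull) auto
  then show "psh (src g) \<phi> (pll A g \<delta>) = ext0 (src g) (tgt \<phi>)"
    using goodD[OF assms(1)] ph assms by simp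
qed

lemma good_push:
  assumes "good D A \<delta>" "mor f" "src f = A" "D \<in> Obj B" "\<delta> \<in> ext D A"
  shows "good D (tgt f) (psh D f \<delta>)"
  unfolding good_def using goodD[OF assms(1), of "_ \<cdot> f"] assms by auto

lemma good_extend:
  assumes "real \<delta> A a M b D" "good D A \<delta>" "mor f" "src f = A" "tgt f \<in> \<T>"
  shows "\<exists>g. mor g \<and> src g = M \<and> tgt g = tgt f \<and> g \<cdot> a = f"
  using extend_infl[OF assms(1,3,4) goodD[OF assms(2-5)]] .

text \<open>A morphism \<open>\<theta>\<close> from N to \<open>\<T>\<close> is split as
  \<open>y \<cdot> b \<boxplus> g \<cdot> t\<close>, with \<open>g \<cdot> t\<close> through
  \<open>W0\<close>. The summand through Y is harmless because Y is in \<open>Bminus\<close>, the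
  other because \<open>W0\<close> lies in \<open>\<U>\<close>.\<close>

lemma Bminus_good_extension:
  assumes "real \<delta> A a N b Y" "good Y A \<delta>" "A \<in> Bminus" "Y \<in> Bminus" shows "N \<in> Bminus"
  unfolding Bminus_iff
proof (intro conjI allI impI)
  note [simp] = realD[OF assms(1)]
  show "N \<in> Obj B" by simp
  fix \<theta> V \<epsilon> assume th: "mor \<theta> \<and> src \<theta> = N \<and> tgt \<theta> \<in> \<T> \<and> V \<in> \<V> \<and> \<epsilon> \<in> ext (tgt \<theta>) V"
  then have [simp]: "mor \<theta>" "src \<theta> = N" "V \<in> Obj B" "\<epsilon> \<in> ext (tgt \<theta>) V" by simp_all
  obtain \<delta>A w W0 p S where W0: "W0 \<in> \<W>" and S: "S \<in> \<S>" and r: "real \<delta>A A w W0 p S" using BminusE[OF assms(3)] .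
  note [simp] = realD[OF r]
  obtain g where g [simp]: "mor g" "src g = W0" "tgt g = tgt \<theta>" and gw: "g \<cdot> w = \<theta> \<cdot> a"
    using extend_to_T[OF r S, of "\<theta> \<cdot> a"] th by auto
  \<comment> \<open>Goodness enters here: the inflation \<open>w\<close> of A into
    \<open>W0\<close>, an object of \<open>\<T>\<close>, extends to N.\<close>
  obtain t where t [simp]: "mor t" "src t = N" "tgt t = W0" and ta: "t \<cdot> a = w"
    using good_extend[OF assms(1,2), of w] W_T[OF W0] by auto
  have "(\<theta> \<boxplus> neg (g \<cdot> t)) \<cdot> a = zero_mor B A (tgt \<theta>)"
    by (simp add: ta gw)
  then obtain y where y [simp]: "mor y" "src y = Y" "tgt y = tgt \<theta>" and yb: "y \<cdot> b = \<theta> \<boxplus> neg (g \<cdot> t)"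
    using extend_defl[OF assms(1), of "\<theta> \<boxplus> neg (g \<cdot> t)"] by auto
  have "y \<cdot> b \<boxplus> g \<cdot> t = \<theta>" using add_neg_cancel(3)[of \<theta> "g \<cdot> t"] by (simp add: yb)
  then have "pll V \<theta> \<epsilon> = pll V (y \<cdot> b) \<epsilon> \<otimes>\<^bsub>Ext E N V\<^esub> pll V (g \<cdot> t) \<epsilon>"
    using pull_add[of V "y \<cdot> b" "g \<cdot> t" \<epsilon>] by simp
  moreover have "pll V (y \<cdot> b) \<epsilon> = ext0 N V"
    using pull_pull[of V b y \<epsilon>] BminusD[OF assms(4), of y V \<epsilon>] th by simp
  moreover have "pll V (g \<cdot> t) \<epsilon> = ext0 N V"
  proof -
    have "pll V g \<epsilon> = ext0 W0 V"
      using noextD[OF noext_UV[OF W_U[OF W0], of V], of "pll V g \<epsilon>"] th by simp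
    then have "pll V t (pll V g \<epsilon>) = ext0 N V" by (simp del: pull_pull)
    then show ?thesis by simp
  qed
  ultimately show "pll V \<theta> \<epsilon> = ext0 N V" by simp
qed

end

section \<open>The heart\<close>

context twin_cotorsion
begin

lemma Bminus_zero_object: "\<exists>Z \<in> Bminus \<inter> \<W>. zero_object B Z"
proof -
  obtain Z where Z: "zero_object B Z" using ex_zero_object by blast
  then have o: "Z \<in> Obj B" by (simp add: zero_object_def)
  have "Z \<in> \<W>"
    unfolding \<W>_def using Z o cotorsion_pair_left_iff[OF UV_pair o] cotorsion_pair_right_iff[OF ST_pair o]
      noext_zero_object[OF Z] by simp
  then show ?thesis using Z U_sub_Bminus W_U by blast
qed

lemma W_biproduct:
  assumes "X \<in> \<W>" "Y \<in> \<W>" "is_biproduct B X Y P i j p q" shows "P \<in> \<W>"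
  using cotorsion_pair_extension_closed[OF ST_pair s_zero[OF assms(3)]]
    cotorsion_pair_extension_closed[OF UV_pair s_zero[OF assms(3)]] assms(1,2)
  unfolding \<W>_def by blast

end

sublocale twin_cotorsion \<subseteq> heart: ideal_quotient B Bminus \<W>
proof unfold_locales
  show "Bminus \<subseteq> Obj B" "\<W> \<subseteq> Obj B" by (simp_all add: subsetI)
  show "\<exists>Z \<in> Bminus \<inter> \<W>. zero_object B Z" by (rule Bminus_zero_object)
qed (fact Bminus_biproduct W_biproduct)+

context twin_cotorsion
begin

abbreviation fac where "fac \<equiv> factoring B \<W>"
abbreviation Q where "Q \<equiv> additive_quotient B Bminus \<W>"
abbreviation cls where "cls \<equiv> heart.cls"

lemma W_Bminus: "X \<in> \<W> \<Longrightarrow> X \<in> Bminus"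
  using W_U U_sub_Bminus by blast

section \<open>The ideal of morphisms through \<open>\<W>\<close> detected by extensions\<close>

lemma fac_push:
  assumes "f \<in> fac X Y" "X \<in> Obj B" "Y \<in> Obj B" "\<delta> \<in> ext S X" "S \<in> \<S>"
  shows "psh S f \<delta> = ext0 S Y"
proof -
  obtain g h where gh: "mor g" "mor h" "src g = X" "tgt h = Y" "tgt g = src h" "src h \<in> \<W>" and f: "f = h \<cdot> g"
    using heart.facE[OF assms(1-3)] .
  have "psh S g \<delta> = ext0 S (src h)"
    using noextD[OF noext_ST[OF assms(5) W_T[OF gh(6)]]] gh assms by simp
  then have "psh S h (psh S g \<delta>) = ext0 S Y" using gh assms by (simp del: push_push)
  then show ?thesis using gh assms unfolding f by simp
qed

lemma fac_pull:
  assumes "f \<in> fac X Y" "X \<in> Obj B" "Y \<in> Obj B" "\<delta> \<in> ext Y V" "V \<in> \<V>"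
  shows "pll V f \<delta> = ext0 X V"
proof -
  obtain g h where gh: "mor g" "mor h" "src g = X" "tgt h = Y" "tgt g = src h" "src h \<in> \<W>" and f: "f = h \<cdot> g"
    using heart.facE[OF assms(1-3)] .
  have "pll V h \<delta> = ext0 (src h) V"
    using noextD[OF noext_UV[OF W_U[OF gh(6)] assms(5)]] gh assms by simp
  then have "pll V g (pll V h \<delta>) = ext0 X V" using gh assms by (simp del: pull_pull)
  then show ?thesis using gh assms unfolding f by simp
qed

text \<open>The converse of \<open>fac_push\<close>: vanishing of this one pushforward already lets
  \<open>f\<close> extend to \<open>N\<close>. Deciding membership in the ideal is thus a
  computation with a single extension class.\<close>

lemma push_fac:
  assumes "real \<delta> X w N p S" "N \<in> \<W>" "mor f" "src f = X" "psh S f \<delta> = ext0 S (tgt f)"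
  shows "f \<in> fac X (tgt f)"
proof -
  obtain g where "mor g" "src g = N" "tgt g = tgt f" "g \<cdot> w = f"
    using extend_infl[OF assms(1,3,4,5)] by blast
  then show ?thesis using heart.facI[of w g X "tgt f"] realD[OF assms(1)] assms(2) by simp
qed

lemma pull_fac:
  assumes "real \<delta> V v N p Y" "N \<in> \<W>" "mor f" "tgt f = Y" "pll V f \<delta> = ext0 (src f) V"
  shows "f \<in> fac (src f) Y"
proof -
  obtain g where "mor g" "src g = src f" "tgt g = N" "p \<cdot> g = f"
    using lift_defl[OF assms(1,3,4,5)] by blast
  then show ?thesis using heart.facI[of g p "src f" Y] realD[OF assms(1)] assms(2) by simp
qed

text \<open>A morphism into \<open>\<T>\<close> extends along the inflation of X into an object of
  \<open>\<W>\<close>; hence objects of \<open>\<T>\<close> are invisible from \<open>Bminus\<close>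
  modulo the ideal.\<close>

lemma to_T_fac:
  assumes "X \<in> Bminus" "mor f" "src f = X" "tgt f \<in> \<T>" shows "f \<in> fac X (tgt f)"
proof -
  obtain \<delta> w N p S where N: "N \<in> \<W>" and S: "S \<in> \<S>" and r: "real \<delta> X w N p S" using BminusE[OF assms(1)] .
  show ?thesis using push_fac[OF r N assms(2,3)] noextD[OF noext_ST[OF S assms(4)]] realD[OF r] assms by simp
qed

text \<open>A factorisation of \<open>k \<cdot> u\<close> through \<open>\<W>\<close> lifts to K,
  because objects of \<open>\<W>\<close> have no extensions by V. The difference from
  \<open>u\<close> is killed by \<open>k\<close>, so it passes through V, and morphisms from
  \<open>Bminus\<close> to V are in the ideal since V belongs to \<open>\<T>\<close>.\<close>

lemma V_deflation_mono:
  assumes r: "real \<delta> V a K k X" and V: "V \<in> \<V>" and u: "mor u" "tgt u = K" and Z: "src u \<in> Bminus"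
    and ku: "k \<cdot> u \<in> fac (src u) X"
  shows "u \<in> fac (src u) K"
proof -
  note [simp] = realD[OF r] u
  have [simp]: "src u \<in> Obj B" by simp
  obtain m h where m [simp]: "mor m" "mor h" "src m = src u" "tgt h = X" "tgt m = src h"
    and W: "src h \<in> \<W>" and kuhm: "k \<cdot> u = h \<cdot> m"
    using heart.facE[OF ku] by auto
  obtain h' where h' [simp]: "mor h'" "src h' = src h" "tgt h' = K" and kh': "k \<cdot> h' = h"
    using lift_from_U[OF r V, of h] W_U[OF W] by auto
  have kh'm: "k \<cdot> (h' \<cdot> m) = h \<cdot> m" using assoc[of m h' k] by (simp add: kh' del: assoc)
  have "k \<cdot> (u \<boxplus> neg (h' \<cdot> m)) = zero_mor B (src u) X"
    by (simp add: kuhm kh'm)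
  then obtain y where y [simp]: "mor y" "src y = src u" "tgt y = V" and ay: "a \<cdot> y = u \<boxplus> neg (h' \<cdot> m)"
    using lift_infl[OF r, of "u \<boxplus> neg (h' \<cdot> m)"] by auto
  have "a \<cdot> y \<in> fac (src u) K"
    using heart.fac_cmp[OF to_T_fac[OF Z, of y], of a] V_sub_T[OF V] by simp
  moreover have "h' \<cdot> m \<in> fac (src u) K" using W by (intro heart.facI) simp_all
  ultimately have "a \<cdot> y \<boxplus> h' \<cdot> m \<in> fac (src u) K" by (intro heart.fac_add) simp_all
  then show ?thesis using add_neg_cancel(3)[of u "h' \<cdot> m"] by (simp add: ay)
qed

end

section \<open>Kernels and cokernels when the heart is \<open>Bminus\<close>\<close>

locale twin_cotorsion_Bminus = twin_cotorsion +
  assumes Bminus_sub: "Bminus \<subseteq> Bplus"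
begin

text \<open>The hypothesis enters in this form: it supplies the class against which morphisms into X
  are tested for lying in the ideal.\<close>

lemma Bminus_approx:
  assumes "X \<in> Bminus"
  obtains \<delta> V v N p where "V \<in> \<V>" "N \<in> \<W>" "real \<delta> V v N p X"
  by (rule BplusE[OF subsetD[OF Bminus_sub assms]]) (rule that)

text \<open>For existence, \<open>g \<cdot> a\<close> factors through an object of
  \<open>\<W>\<close>, hence of \<open>\<T>\<close>, and goodness extends that factor to N;
  subtracting it leaves a morphism that descends to Y.\<close>

lemma good_cokernel:
  assumes r: "real \<delta> A a N b Y" and g: "good Y A \<delta>" and o: "A \<in> Bminus" "Y \<in> Bminus"
  shows "is_cokernel_of Q A N (cls a) Y (cls b)"
proof (rule heart.Q_cokernelI)
  note [simp] = realD[OF r]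
  show "N \<in> Bminus" using Bminus_good_extension[OF r g o] .
  show "b \<cdot> a \<in> fac A Y" using real_cmp_zero[OF r] by simp
  show "\<exists>u. mor u \<and> src u = Y \<and> tgt u = tgt g \<and> u \<cdot> b \<boxplus> neg g \<in> fac N (tgt g)"
    if "tgt g \<in> Bminus" and m: "mor g" "src g = N" and ga: "g \<cdot> a \<in> fac A (tgt g)" for g
  proof -
    note [simp] = m
    obtain k h where k [simp]: "mor k" "mor h" "src k = A" "tgt h = tgt g" "tgt k = src h"
      and W: "src h \<in> \<W>" and gahk: "g \<cdot> a = h \<cdot> k"
      using heart.facE[OF ga] by auto
    obtain k' where k' [simp]: "mor k'" "src k' = N" "tgt k' = src h" and k'a: "k' \<cdot> a = k"
      using good_extend[OF r assms(2), of k] W_T[OF W] by auto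
    have "(g \<boxplus> neg (h \<cdot> k')) \<cdot> a = zero_mor B A (tgt g)" by (simp add: gahk k'a)
    then obtain u where u [simp]: "mor u" "src u = Y" "tgt u = tgt g" and ub: "u \<cdot> b = g \<boxplus> neg (h \<cdot> k')"
      using extend_defl[OF r, of "g \<boxplus> neg (h \<cdot> k')"] by auto
    have "u \<cdot> b \<boxplus> neg g = neg (h \<cdot> k')"
      using add_neg_cancel(3)[of "neg (h \<cdot> k')" g] by (simp add: ub add_comm[of g] add_assoc)
    moreover have "h \<cdot> k' \<in> fac N (tgt g)" using W by (intro heart.facI) simp_all
    ultimately show ?thesis using heart.fac_neg[of "h \<cdot> k'" N "tgt g"] u by (intro exI[of _ u]) simp
  qed
  show "u \<in> fac Y (tgt u)"
    if T: "tgt u \<in> Bminus" and m: "mor u" "src u = Y" and ub: "u \<cdot> b \<in> fac N (tgt u)" for u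
  proof -
    note [simp] = m
    obtain \<delta>' V v W0 p where V: "V \<in> \<V>" and W0: "W0 \<in> \<W>" and r': "real \<delta>' V v W0 p (tgt u)"
      using Bminus_approx[OF T] .
    note [simp] = realD[OF r']
    \<comment> \<open>The test class of the target, pulled back along \<open>u\<close>, dies on N.
      It is therefore a pushforward of \<open>\<delta>\<close> along some A -> V, and goodness kills
      it because V lies in \<open>\<T>\<close>.\<close>
    have "pll V b (pll V u \<delta>') = ext0 N V" using fac_pull[OF ub _ _ _ V] by simp
    then obtain \<phi> where ph: "mor \<phi>" "src \<phi> = A" "tgt \<phi> = V" "psh Y \<phi> \<delta> = pll V u \<delta>'"
      using ext_eq_push[OF r, of V "pll V u \<delta>'"] by auto
    then have "pll V u \<delta>' = ext0 Y V" using goodD[OF g ph(1,2)] V_sub_T[OF V] by simp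
    then show ?thesis using pull_fac[OF r' W0 m(1)] by simp
  qed
qed (use realD[OF r] o in simp_all)

text \<open>The added component is the inflation \<open>w\<close> of A into \<open>\<W>\<close>: the
  column with entries \<open>w\<close> and \<open>f\<close> is an inflation whose class is pulled
  back from an extension over S, and extensions over \<open>\<S>\<close> are always good. The cone
  stays in \<open>Bminus\<close> because it sits in X -> G -> S.\<close>

lemma ex_good_inflation:
  assumes "A \<in> Bminus" "X \<in> Bminus" and f: "mor f" "src f = A" "tgt f = X"
  shows "\<exists>N P i j p q \<delta> a G c. N \<in> \<W> \<and> is_biproduct B N X P i j p q \<and> real \<delta> A a P c G \<and>
    good G A \<delta> \<and> G \<in> Bminus \<and> P \<in> Bminus \<and> cls a = cls (j \<cdot> f)"
proof -
  obtain \<delta> w N p S where N: "N \<in> \<W>" and S: "S \<in> \<S>" and r: "real \<delta> A w N p S" using BminusE[OF assms(1)] .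
  note [simp] = realD[OF r] f
  have [simp]: "X \<in> Obj B" using assms(2) by simp
  obtain P i j p1 q1 where P: "is_biproduct B N X P i j p1 q1" using ex_biproduct[of N X] by auto
  note [simp] = biproductD[OF P]
  obtain G \<delta>' c d e where r1: "real (pll A e \<delta>) A (i \<cdot> w \<boxplus> j \<cdot> f) P c G" and r2: "real \<delta>' X d G e S"
    using real_infl_biproduct[OF r f P] by blast
  note [simp] = realD[OF r1] realD[OF r2]
  have "good G A (pll A e \<delta>)" using good_pull[OF good_S[OF S], of A \<delta> e] by simp
  moreover have "G \<in> Bminus" by (rule Bminus_cone_S[OF r2 assms(2) S])
  moreover have "P \<in> Bminus" by (rule Bminus_biproduct[OF W_Bminus[OF N] assms(2) P])
  moreover have "cls (i \<cdot> w \<boxplus> j \<cdot> f) = cls (j \<cdot> f)"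
  proof -
    have "i \<cdot> w \<boxplus> j \<cdot> f \<boxplus> neg (j \<cdot> f) = i \<cdot> w" using add_neg_cancel(3)[of "i \<cdot> w" "neg (j \<cdot> f)"] by simp
    moreover have "i \<cdot> w \<in> fac A P" using N by (intro heart.facI) simp_all
    ultimately show ?thesis by (simp add: heart.cls_eq_iff)
  qed
  ultimately show ?thesis using N P r1 by blast
qed

text \<open>The two composites differ from identities at most by \<open>i \<cdot> p\<close>, which
  factors through \<open>N\<close>.\<close>

lemma is_iso_summand:
  assumes "is_biproduct B N X P i j p q" "N \<in> \<W>" "X \<in> Bminus"
  shows "is_iso Q X P (cls j)" "is_iso Q P X (cls q)" "P \<in> Bminus"
proof -
  note [simp] = biproductD[OF assms(1)] assms(3)
  show P [simp]: "P \<in> Bminus" by (rule Bminus_biproduct[OF W_Bminus[OF assms(2)] assms(3,1)])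
  have "j \<cdot> q \<boxplus> neg (idm B P) = neg (i \<cdot> p)"
  proof -
    have "i \<cdot> p \<boxplus> (j \<cdot> q \<boxplus> neg (idm B P)) = zero_mor B P P"
      using add_assoc[of "i \<cdot> p" "j \<cdot> q" "neg (idm B P)"] by simp
    then show ?thesis using neg_unique[of "i \<cdot> p" "j \<cdot> q \<boxplus> neg (idm B P)"] by simp
  qed
  moreover have "i \<cdot> p \<in> fac P P" using assms(2) by (intro heart.facI) simp_all
  ultimately have "cls (j \<cdot> q) = cls (idm B P)"
    using heart.fac_neg[of "i \<cdot> p" P P] by (simp add: heart.cls_eq_iff)
  then have "cls j \<cdot>\<^bsub>Q\<^esub> cls q = idm Q P" "cls q \<cdot>\<^bsub>Q\<^esub> cls j = idm Q X"
    by (simp_all add: heart.Q_cmp heart.Q_id)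
  moreover have "cls j \<in> Mor Q X P" "cls q \<in> Mor Q P X" by (simp_all add: heart.cls_Mor)
  ultimately show "is_iso Q X P (cls j)" "is_iso Q P X (cls q)" unfolding is_iso_def by blast+
qed

lemma ex_good_cokernel:
  assumes "A \<in> Bminus" "X \<in> Bminus" and f: "mor f" "src f = A" "tgt f = X"
  shows "\<exists>\<delta> a P c G j. real \<delta> A a P c G \<and> good G A \<delta> \<and> G \<in> Bminus \<and> P \<in> Bminus \<and>
    mor j \<and> src j = X \<and> tgt j = P \<and> is_iso Q X P (cls j) \<and> is_cokernel_of Q A X (cls f) G (cls (c \<cdot> j))"
proof -
  obtain N P i j p q \<delta> a G c where N: "N \<in> \<W>" and P: "is_biproduct B N X P i j p q"
    and r: "real \<delta> A a P c G" and g: "good G A \<delta>" and o: "G \<in> Bminus" "P \<in> Bminus" and a: "cls a = cls (j \<cdot> f)"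
    using ex_good_inflation[OF assms] by blast
  note [simp] = realD[OF r] biproductD[OF P] o assms
  interpret Q: preadditive_category Q by (rule heart.Q_preadditive)
  have iso: "is_iso Q X P (cls j)" by (rule is_iso_summand[OF P N assms(2)])
  have "is_cokernel_of Q A X (cls f) G (cls c \<cdot>\<^bsub>Q\<^esub> cls j)"
  proof (rule Q.is_cokernel_of_cmp_iso[OF good_cokernel[OF r g assms(1) o(1)] iso])
    show "cls f \<in> Mor Q A X" by (rule heart.cls_Mor) simp_all
    show "cls j \<cdot>\<^bsub>Q\<^esub> cls f = cls a" using a by (simp add: heart.Q_cmp)
  qed simp_all
  then have "is_cokernel_of Q A X (cls f) G (cls (c \<cdot> j))" by (simp add: heart.Q_cmp)
  then show ?thesis using r g o iso biproductD[OF P] by blast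
qed

text \<open>The pullback L of the approximation of Y along f has the lifting property of a kernel
  but may lie outside \<open>Bminus\<close>. A second deflation K -> L with cocone in
  \<open>\<V>\<close> repairs this, and every morphism from \<open>Bminus\<close> to L lifts along
  it.\<close>

lemma ex_V_deflation_kernel:
  assumes X: "X \<in> Bminus" and Y: "Y \<in> Bminus" and f: "mor f" "src f = X" "tgt f = Y"
  shows "\<exists>\<delta> V a K k. real \<delta> V a K k X \<and> V \<in> \<V> \<and> K \<in> Bminus \<and> is_kernel_of Q X Y (cls f) K (cls k)"
proof -
  note [simp] = f
  obtain \<delta>Y Vy v Wy p where Vy: "Vy \<in> \<V>" and Wy: "Wy \<in> \<W>" and r: "real \<delta>Y Vy v Wy p Y"
    using Bminus_approx[OF Y] .
  note [simp] = realD[OF r]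
  have [simp]: "X \<in> Obj B" using X by simp
  obtain v' L l where r1: "real (pll Vy f \<delta>Y) Vy v' L l X" using ex_realD[of X Vy "pll Vy f \<delta>Y"] by auto
  note [simp] = realD[OF r1]
  have "\<exists>g \<in> Mor B L Wy. g \<cdot> v' = v \<cdot> idm B Vy \<and> p \<cdot> g = f \<cdot> l"
    by (rule s_realises[OF r1 r]) (simp add: ext_morphism_def)
  then obtain g where g [simp]: "mor g" "src g = L" "tgt g = Wy" and pg: "p \<cdot> g = f \<cdot> l" by auto
  obtain T S \<delta>T t u where T: "T \<in> \<T>" and S: "S \<in> \<S>" and r2: "real \<delta>T L t T u S"
    using cotorsion_pairD(5)[OF ST_pair, of L] by auto
  note [simp] = realD[OF r2]
  obtain V1 U1 \<delta>1 v1 p1 where V1: "V1 \<in> \<V>" and U1: "U1 \<in> \<U>" and r3: "real \<delta>1 V1 v1 U1 p1 T"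
    using cotorsion_pairD(4)[OF UV_pair, of T] by auto
  note [simp] = realD[OF r3]
  \<comment> \<open>K is the pullback of \<open>U1 -> T\<close> along \<open>L -> T\<close>. One
    conflation, K -> U1 -> S, puts K in \<open>Bminus\<close>; the other makes K -> L a deflation
    with cocone \<open>V1\<close>.\<close>
  obtain K \<delta>K cK' cK d eK where r4: "real \<delta>K K cK' U1 cK S" and r5: "real (pll V1 t \<delta>1) V1 eK K d L"
    using ET4_op[OF r2 r3] by blast
  note [simp] = realD[OF r4] realD[OF r5]
  have K: "K \<in> Bminus" by (rule Bminus_cocone_S[OF r4 U_sub_Bminus[OF U1] S])
  \<comment> \<open>The two deflations are composed; the cocone V is an extension of
    \<open>Vy\<close> by \<open>V1\<close>, so it remains in \<open>\<V>\<close>.\<close>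
  obtain V \<delta> a d' e' where r6: "real \<delta> V a K (l \<cdot> d) X" and r7: "real (pll V1 v' (pll V1 t \<delta>1)) V1 e' V d' Vy"
    using ET4_op[OF r1 r5] by blast
  note [simp] = realD[OF r6]
  have V: "V \<in> \<V>" by (rule cotorsion_pair_extension_closed(2)[OF UV_pair r7 V1 Vy])
  have "is_kernel_of Q X Y (cls f) K (cls (l \<cdot> d))"
  proof (rule heart.Q_kernelI)
    have "p \<cdot> g \<cdot> d \<in> fac K Y"
      using Wy heart.facI[of "g \<cdot> d" p K Y] by simp
    then show "f \<cdot> (l \<cdot> d) \<in> fac K Y" unfolding pg by simp
    show "\<exists>u. mor u \<and> src u = src x \<and> tgt u = K \<and> l \<cdot> d \<cdot> u \<boxplus> neg x \<in> fac (src x) X"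
      if Z: "src x \<in> Bminus" and m: "mor x" "tgt x = X" and fx: "f \<cdot> x \<in> fac (src x) Y" for x
    proof -
      note [simp] = m
      have "pll Vy x (pll Vy f \<delta>Y) = ext0 (src x) Vy" using fac_pull[OF fx _ _ _ Vy] by simp
      then obtain y where y [simp]: "mor y" "src y = src x" "tgt y = L" and ly: "l \<cdot> y = x"
        using lift_defl[OF r1 m] by blast
      \<comment> \<open>The obstruction to lifting \<open>y\<close> to K is pulled back from E(T,
        V1) along a morphism \<open>src x -> T\<close>, and such classes vanish on
        \<open>Bminus\<close>.\<close>
      have "pll V1 y (pll V1 t \<delta>1) = ext0 (src y) V1"
        using BminusD[OF Z, of "t \<cdot> y" V1 \<delta>1] T V1 by simp
      then obtain z where z [simp]: "mor z" "src z = src x" "tgt z = K" and dz: "d \<cdot> z = y"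
        using lift_defl[OF r5 y(1,3)] by auto
      have "l \<cdot> d \<cdot> z \<boxplus> neg x \<in> fac (src x) X" by (simp add: dz ly)
      then show ?thesis using z by blast
    qed
    show "x \<in> fac (src x) K" if "src x \<in> Bminus" "mor x" "tgt x = K" "l \<cdot> d \<cdot> x \<in> fac (src x) X" for x
      using V_deflation_mono[OF r6 V that(2,3,1,4)] .
  qed (use X Y K in simp_all)
  then show ?thesis using r6 V K by blast
qed

text \<open>The map of which \<open>k\<close> is a kernel has to be built: (ET4) for V -> K -> X and
  K -> N -> S gives \<open>d : X -> G\<close> with \<open>d \<cdot> k\<close> through
  \<open>N\<close>, and \<open>\<delta>\<close> is a pullback along \<open>d\<close>. Hence a
  morphism that \<open>d\<close> sends into the ideal pulls \<open>\<delta>\<close> back to zero and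
  lifts to K.\<close>

lemma V_deflation_is_kernel:
  assumes r: "real \<delta> V a K k X" and V: "V \<in> \<V>" and K: "K \<in> Bminus" and X: "X \<in> Bminus"
  shows "is_kernel Q K X (cls k)"
proof -
  note [simp] = realD[OF r]
  obtain \<delta>K w N p S where N: "N \<in> \<W>" and S: "S \<in> \<S>" and r1: "real \<delta>K K w N p S" using BminusE[OF K] .
  note [simp] = realD[OF r1]
  obtain G \<delta>'' c c' d e where r2: "real \<delta>'' V c N c' G" and r3: "real (psh S k \<delta>K) X d G e S"
    and dk: "c' \<cdot> w = d \<cdot> k" and dd: "pll V d \<delta>'' = \<delta>"
    using ET4[OF r r1] by blast
  note [simp] = realD[OF r2] realD[OF r3]
  have G: "G \<in> Bminus" by (rule Bminus_cone_S[OF r3 X S])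
  have "is_kernel_of Q X G (cls d) K (cls k)"
  proof (rule heart.Q_kernelI)
    have "c' \<cdot> w \<in> fac K G" using N by (intro heart.facI) simp_all
    then show "d \<cdot> k \<in> fac K G" by (simp add: dk)
    show "\<exists>u. mor u \<and> src u = src x \<and> tgt u = K \<and> k \<cdot> u \<boxplus> neg x \<in> fac (src x) X"
      if Z: "src x \<in> Bminus" and m: "mor x" "tgt x = X" and dx: "d \<cdot> x \<in> fac (src x) G" for x
    proof -
      note [simp] = m
      have "pll V x (pll V d \<delta>'') = ext0 (src x) V" using fac_pull[OF dx _ _ _ V] by simp
      then obtain y where y [simp]: "mor y" "src y = src x" "tgt y = K" and ky: "k \<cdot> y = x"
        using lift_defl[OF r m] unfolding dd by blast
      have "k \<cdot> y \<boxplus> neg x \<in> fac (src x) X" by (simp add: ky)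
      then show ?thesis using y by blast
    qed
    show "x \<in> fac (src x) K" if "src x \<in> Bminus" "mor x" "tgt x = K" "k \<cdot> x \<in> fac (src x) X" for x
      using V_deflation_mono[OF r V that(2,3,1,4)] .
  qed (use X K G in simp_all)
  moreover have "cls d \<in> Mor Q X G" using X G by (intro heart.cls_Mor) simp_all
  ultimately show ?thesis unfolding is_kernel_def using G by auto
qed

end

section \<open>Pullbacks of cokernels and pushouts of kernels\<close>

context twin_cotorsion_Bminus
begin

text \<open>The condition \<open>from_U\<close> absorbs what commutes only modulo
  \<open>\<W>\<close>: errors through \<open>\<W>\<close>, and in the uniqueness part a morphism
  from an object of \<open>\<S>\<close>, are lifted along \<open>h\<close>. It can always be
  arranged by adding to Y an approximation of G.\<close>

lemma good_pullback:
  assumes r: "real \<delta> A a L l G" and g: "good G A \<delta>" and o: "A \<in> Bminus" "G \<in> Bminus" "Y \<in> Bminus"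
    and h: "mor h" "src h = Y" "tgt h = G"
    and from_U: "\<And>x. \<lbrakk>mor x; src x \<in> \<U>; tgt x = G\<rbrakk> \<Longrightarrow> \<exists>y. mor y \<and> src y = src x \<and> tgt y = Y \<and> h \<cdot> y = x"
  shows "\<exists>P p q. is_pullback Q L Y G (cls l) (cls h) P p q \<and> is_cokernel Q P Y q"
proof -
  note [simp] = realD[OF r] h
  have [simp]: "Y \<in> Obj B" using o by simp
  have L: "L \<in> Bminus" by (rule Bminus_good_extension[OF r g o(1,2)])
  obtain a' P q where r1: "real (pll A h \<delta>) A a' P q Y" using ex_realD[of Y A "pll A h \<delta>"] by auto
  note [simp] = realD[OF r1]
  have g1: "good Y A (pll A h \<delta>)" using good_pull[OF g h(1,3)] by simp
  have P: "P \<in> Bminus" by (rule Bminus_good_extension[OF r1 g1 o(1,3)])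
  have "\<exists>p \<in> Mor B P L. p \<cdot> a' = a \<cdot> idm B A \<and> l \<cdot> p = h \<cdot> q"
    by (rule s_realises[OF r1 r]) (simp add: ext_morphism_def)
  then obtain p where p [simp]: "mor p" "src p = P" "tgt p = L" and pa: "p \<cdot> a' = a" and lp: "l \<cdot> p = h \<cdot> q"
    by auto
  have "is_pullback Q L Y G (cls l) (cls h) P (cls p) (cls q)"
  proof (rule heart.Q_pullbackI)
    show "l \<cdot> p = h \<cdot> q" by fact
    show "\<exists>w. mor w \<and> src w = src u \<and> tgt w = P \<and>
            p \<cdot> w \<boxplus> neg u \<in> fac (src u) L \<and> q \<cdot> w \<boxplus> neg v \<in> fac (src u) Y"
      if Z: "src u \<in> Bminus" and m: "mor u" "mor v" "src v = src u" "tgt u = L" "tgt v = Y"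
        and luv: "l \<cdot> u \<boxplus> neg (h \<cdot> v) \<in> fac (src u) G" for u v
    proof -
      note [simp] = m
      obtain k x where k [simp]: "mor k" "mor x" "src k = src u" "tgt x = G" "tgt k = src x"
        and W: "src x \<in> \<W>" and eq: "l \<cdot> u \<boxplus> neg (h \<cdot> v) = x \<cdot> k"
        using heart.facE[OF luv] by auto
      obtain y where y [simp]: "mor y" "src y = src x" "tgt y = Y" and hy: "h \<cdot> y = x"
        using from_U[of x] W_U[OF W] by auto
      \<comment> \<open>Adding the lifted error to \<open>v\<close> does not change its class and
        makes the test square commute strictly.\<close>
      define v' where "v' = v \<boxplus> y \<cdot> k"
      have v' [simp]: "mor v'" "src v' = src u" "tgt v' = Y" by (simp_all add: v'_def)
      have hyk: "h \<cdot> (y \<cdot> k) = x \<cdot> k" using assoc[of k y h] by (simp add: hy del: assoc)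
      have "h \<cdot> v' = h \<cdot> v \<boxplus> (l \<cdot> u \<boxplus> neg (h \<cdot> v))" by (simp add: v'_def hyk eq)
      also have "\<dots> = l \<cdot> u" by (rule add_neg_cancel(1)) simp_all
      finally have hv': "h \<cdot> v' = l \<cdot> u" .
      have "pll A v' (pll A h \<delta>) = pll A u (pll A l \<delta>)" by (simp add: hv')
      also have "\<dots> = ext0 (src u) A" unfolding pull_defl[OF r] by simp
      finally obtain x0 where x0 [simp]: "mor x0" "src x0 = src u" "tgt x0 = P" and qx0: "q \<cdot> x0 = v'"
        using lift_defl[OF r1 v'(1,3)] by auto
      have lpx0: "l \<cdot> (p \<cdot> x0) = l \<cdot> u"
        using assoc[of x0 p l] assoc[of x0 q h] by (simp add: lp qx0 hv' del: assoc)
      \<comment> \<open>\<open>x0\<close> has the right component in Y, but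
        \<open>p \<cdot> x0\<close> agrees with \<open>u\<close> only after \<open>l\<close>. The
        defect comes from A and is corrected along \<open>a'\<close>, which \<open>q\<close>
        kills.\<close>
      have "l \<cdot> (u \<boxplus> neg (p \<cdot> x0)) = zero_mor B (src u) G" by (simp add: lpx0)
      then obtain z where z [simp]: "mor z" "src z = src u" "tgt z = A" and az: "a \<cdot> z = u \<boxplus> neg (p \<cdot> x0)"
        using lift_infl[OF r, of "u \<boxplus> neg (p \<cdot> x0)"] by auto
      have paz: "p \<cdot> (a' \<cdot> z) = u \<boxplus> neg (p \<cdot> x0)" using assoc[of z a' p] by (simp add: pa az del: assoc)
      have qaz: "q \<cdot> (a' \<cdot> z) = zero_mor B (src u) Y"
        using assoc[of z a' q] by (simp add: real_cmp_zero[OF r1] del: assoc)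
      have pw: "p \<cdot> (x0 \<boxplus> a' \<cdot> z) = u" using add_neg_cancel(1)[of "p \<cdot> x0" u] by (simp add: paz)
      have qw: "q \<cdot> (x0 \<boxplus> a' \<cdot> z) = v'" by (simp add: qaz qx0)
      have "v' \<boxplus> neg v = y \<cdot> k"
        using add_neg_cancel(3)[of "y \<cdot> k" "neg v"] by (simp add: v'_def add_comm[of v])
      moreover have "y \<cdot> k \<in> fac (src u) Y" using W by (intro heart.facI) simp_all
      ultimately have "q \<cdot> (x0 \<boxplus> a' \<cdot> z) \<boxplus> neg v \<in> fac (src u) Y" unfolding qw by simp
      moreover have "p \<cdot> (x0 \<boxplus> a' \<cdot> z) \<boxplus> neg u \<in> fac (src u) L" unfolding pw by simp
      ultimately show ?thesis by (intro exI[of _ "x0 \<boxplus> a' \<cdot> z"]) (simp del: distrib_left)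
    qed
    show "w \<in> fac (src w) P"
      if Z: "src w \<in> Bminus" and m: "mor w" "tgt w = P"
        and pw: "p \<cdot> w \<in> fac (src w) L" and qw: "q \<cdot> w \<in> fac (src w) Y" for w
    proof -
      note [simp] = m
      obtain \<delta>' n N t S where N: "N \<in> \<W>" and S: "S \<in> \<S>" and r2: "real \<delta>' (src w) n N t S" using BminusE[OF Z] .
      note [simp] = realD[OF r2]
      \<comment> \<open>By the test for the ideal it suffices that \<open>w\<close> pushes
        \<open>\<delta>'\<close> to zero. Vanishing under \<open>q\<close> makes that pushforward
        come from \<open>\<epsilon>\<close> over A, and vanishing under \<open>p\<close> makes
        \<open>\<epsilon>\<close> a pullback of \<open>\<delta>\<close> along some S -> G.\<close>
      have "psh S q (psh S w \<delta>') = ext0 S Y" using fac_push[OF qw _ _ _ S] by simp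
      then obtain \<epsilon> where \<epsilon> [simp]: "\<epsilon> \<in> ext S A" and ae: "psh S a' \<epsilon> = psh S w \<delta>'"
        using ext_exact_push[OF r1, of S "psh S w \<delta>'"] by auto
      have "psh S a \<epsilon> = psh S p (psh S a' \<epsilon>)" by (simp add: pa)
      also have "\<dots> = ext0 S L" unfolding ae using fac_push[OF pw _ _ _ S] by simp
      finally obtain \<phi> where ph [simp]: "mor \<phi>" "src \<phi> = S" "tgt \<phi> = G" and e\<phi>: "pll A \<phi> \<delta> = \<epsilon>"
        using ext_eq_pull[OF r, of S \<epsilon>] by auto
      obtain y where y [simp]: "mor y" "src y = S" "tgt y = Y" and hy: "h \<cdot> y = \<phi>"
        using from_U[of \<phi>] S_sub_U[OF S] by auto
      \<comment> \<open>Lifting \<open>\<phi>\<close> along \<open>h\<close> exhibits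
        \<open>\<epsilon>\<close> as a pullback of the class realised by P, which \<open>a'\<close>
        annihilates.\<close>
      have "psh S a' \<epsilon> = psh S a' (pll A y (pll A h \<delta>))" by (simp add: e\<phi> hy)
      also have "\<dots> = pll P y (psh Y a' (pll A h \<delta>))" by (subst push_pull) simp_all
      also have "\<dots> = ext0 S P" unfolding push_infl[OF r1] by simp
      finally show ?thesis using push_fac[OF r2 N m(1)] by (simp add: ae)
    qed
  qed (use L o P in simp_all)
  moreover have "is_cokernel Q P Y (cls q)"
    unfolding is_cokernel_def
    using good_cokernel[OF r1 g1 o(1,3)] heart.cls_Mor[of A P a'] o P by auto
  ultimately show ?thesis by blast
qed

text \<open>The lifting condition needed for pullbacks has its counterpart in goodness of
  \<open>\<delta>\<close>: errors through \<open>\<W>\<close> extend along \<open>b\<close>, and in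
  the uniqueness part the morphism K -> V kills \<open>\<delta>\<close> because V lies in
  \<open>\<T>\<close>.\<close>

lemma good_pushout:
  assumes r: "real \<delta> K b Y c M" and g: "good M K \<delta>" and k: "mor k" "src k = K" "tgt k = X"
    and r1: "real (psh M k \<delta>) X d P e M" and c': "mor c'" "src c' = Y" "tgt c' = P"
    and c'b: "c' \<cdot> b = d \<cdot> k" and ec': "e \<cdot> c' = c"
    and o: "K \<in> Bminus" "X \<in> Bminus" "Y \<in> Bminus" "P \<in> Bminus"
  shows "is_pushout Q X Y K (cls k) (cls b) P (cls d) (cls c')"
proof (rule heart.Q_pushoutI)
  note [simp] = realD[OF r] realD[OF r1] k c'
  show "d \<cdot> k = c' \<cdot> b" using c'b by simp
  show "\<exists>w. mor w \<and> tgt w = tgt u \<and> src w = P \<and>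
            w \<cdot> d \<boxplus> neg u \<in> fac X (tgt u) \<and> w \<cdot> c' \<boxplus> neg v \<in> fac Y (tgt u)"
    if T: "tgt u \<in> Bminus" and m: "mor u" "mor v" "tgt v = tgt u" "src u = X" "src v = Y"
      and uv: "u \<cdot> k \<boxplus> neg (v \<cdot> b) \<in> fac K (tgt u)" for u v
  proof -
    note [simp] = m
    obtain n x where n [simp]: "mor n" "mor x" "src n = K" "tgt x = tgt u" "tgt n = src x"
      and W: "src x \<in> \<W>" and eq: "u \<cdot> k \<boxplus> neg (v \<cdot> b) = x \<cdot> n"
      using heart.facE[OF uv] by auto
    obtain n' where n' [simp]: "mor n'" "src n' = Y" "tgt n' = src x" and n'b: "n' \<cdot> b = n"
      using good_extend[OF r g, of n] W_T[OF W] by auto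
    define v' where "v' = v \<boxplus> x \<cdot> n'"
    have v' [simp]: "mor v'" "src v' = Y" "tgt v' = tgt u" by (simp_all add: v'_def)
    have "v' \<cdot> b = v \<cdot> b \<boxplus> (u \<cdot> k \<boxplus> neg (v \<cdot> b))" by (simp add: v'_def n'b eq)
    also have "\<dots> = u \<cdot> k" by (rule add_neg_cancel(1)) simp_all
    finally have v'b: "v' \<cdot> b = u \<cdot> k" .
    have "psh M u (psh M k \<delta>) = psh M v' (psh M b \<delta>)" by (simp add: v'b)
    also have "\<dots> = ext0 M (tgt u)" unfolding push_infl[OF r] by simp
    finally obtain t where t [simp]: "mor t" "src t = P" "tgt t = tgt u" and td: "t \<cdot> d = u"
      using extend_infl[OF r1 m(1,4)] by auto
    have "t \<cdot> (c' \<cdot> b) = u \<cdot> k" using assoc[of k d t] by (simp add: c'b td del: assoc)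
    \<comment> \<open>The extension \<open>t\<close> of \<open>u\<close> need not restrict to
      \<open>v'\<close> on Y. The difference vanishes on K, so it descends to M and is added through
      \<open>e\<close> without disturbing \<open>d\<close>.\<close>
    then have "(v' \<boxplus> neg (t \<cdot> c')) \<cdot> b = zero_mor B K (tgt u)" by (simp add: v'b)
    then obtain z where z [simp]: "mor z" "src z = M" "tgt z = tgt u" and zc: "z \<cdot> c = v' \<boxplus> neg (t \<cdot> c')"
      using extend_defl[OF r, of "v' \<boxplus> neg (t \<cdot> c')"] by auto
    have wd: "(t \<boxplus> z \<cdot> e) \<cdot> d = u" by (simp add: td real_cmp_zero[OF r1])
    have wc: "(t \<boxplus> z \<cdot> e) \<cdot> c' = v'" using add_neg_cancel(1)[of "t \<cdot> c'" v'] by (simp add: ec' zc)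
    have "v' \<boxplus> neg v = x \<cdot> n'"
      using add_neg_cancel(3)[of "x \<cdot> n'" "neg v"] by (simp add: v'_def add_comm[of v])
    moreover have "x \<cdot> n' \<in> fac Y (tgt u)" using W by (intro heart.facI) simp_all
    ultimately have "(t \<boxplus> z \<cdot> e) \<cdot> c' \<boxplus> neg v \<in> fac Y (tgt u)" unfolding wc by simp
    moreover have "(t \<boxplus> z \<cdot> e) \<cdot> d \<boxplus> neg u \<in> fac X (tgt u)" unfolding wd by simp
    ultimately show ?thesis by (intro exI[of _ "t \<boxplus> z \<cdot> e"]) (simp del: distrib_right)
  qed
  show "w \<in> fac P (tgt w)"
    if T: "tgt w \<in> Bminus" and m: "mor w" "src w = P"
      and wd: "w \<cdot> d \<in> fac X (tgt w)" and wc: "w \<cdot> c' \<in> fac Y (tgt w)" for w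
  proof -
    note [simp] = m
    obtain \<delta>' V v N p where V: "V \<in> \<V>" and N: "N \<in> \<W>" and r2: "real \<delta>' V v N p (tgt w)"
      using Bminus_approx[OF T] .
    note [simp] = realD[OF r2]
    have "pll V d (pll V w \<delta>') = ext0 X V" using fac_pull[OF wd _ _ _ V] by simp
    then obtain \<epsilon> where \<epsilon> [simp]: "\<epsilon> \<in> ext M V" and ee: "pll V e \<epsilon> = pll V w \<delta>'"
      using ext_exact_pull[OF r1, of V "pll V w \<delta>'"] by auto
    \<comment> \<open>The test class on P comes from \<open>\<epsilon>\<close> over M because it
      vanishes on X; since it also vanishes on Y, \<open>\<epsilon>\<close> is a pushforward of
      \<open>\<delta>\<close> to V.\<close>
    have "pll V c \<epsilon> = pll V c' (pll V e \<epsilon>)" by (simp add: ec')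
    also have "\<dots> = ext0 Y V" unfolding ee using fac_pull[OF wc _ _ _ V] by simp
    finally obtain \<phi> where ph: "mor \<phi>" "src \<phi> = K" "tgt \<phi> = V" "psh M \<phi> \<delta> = \<epsilon>"
      using ext_eq_push[OF r, of V \<epsilon>] by auto
    then have "\<epsilon> = ext0 M V" using goodD[OF g ph(1,2)] V_sub_T[OF V] by simp
    then have "pll V w \<delta>' = ext0 P V" using ee by simp
    then show ?thesis using pull_fac[OF r2 N m(1)] by simp
  qed
qed (use realD[OF r] realD[OF r1] k c' o in simp_all)

lemma heart_quasi_abelian: "quasi_abelian_category Q"
proof -
  interpret Q: additive_category Q by (rule heart.Q_additive)
  have Q_cmp: "cls g \<cdot>\<^bsub>Q\<^esub> cls f = cls (g \<cdot> f)"
    if "mor f" "mor g" "src g = tgt f" "src f \<in> Bminus" "tgt f \<in> Bminus" "tgt g \<in> Bminus" for f g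
    using heart.Q_cmp that .
  show ?thesis
  proof
    fix X Y \<Phi> assume o: "X \<in> Obj Q" "Y \<in> Obj Q" and Phi: "\<Phi> \<in> Mor Q X Y"
    then obtain f where f: "mor f" "src f = X" "tgt f = Y" "\<Phi> = cls f"
      using heart.Q_MorE[OF Phi] by auto
    show "\<exists>K k. is_kernel_of Q X Y \<Phi> K k" using ex_V_deflation_kernel[of X Y f] f o by auto
    show "\<exists>K k. is_cokernel_of Q X Y \<Phi> K k" using ex_good_cokernel[of X Y f] f o by auto
  next
    fix X Y Z \<gamma> \<eta> P p q
    assume o': "X \<in> Obj Q" "Y \<in> Obj Q" "Z \<in> Obj Q" and m: "\<gamma> \<in> Mor Q X Z" "\<eta> \<in> Mor Q Y Z"
      and cok: "is_cokernel Q X Z \<gamma>" and pb: "is_pullback Q X Y Z \<gamma> \<eta> P p q"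
    then have o: "X \<in> Bminus" "Y \<in> Bminus" "Z \<in> Bminus" by simp_all
    obtain A \<Phi> where A: "A \<in> Bminus" and Phi: "\<Phi> \<in> Mor Q A X" and cok: "is_cokernel_of Q A X \<Phi> Z \<gamma>"
      using cok unfolding is_cokernel_def by auto
    obtain f where f: "mor f" "src f = A" "tgt f = X" "\<Phi> = cls f" using heart.Q_MorE[OF Phi A o(1)] .
    obtain \<delta> a L l G j where r: "real \<delta> A a L l G" and g: "good G A \<delta>" and GL: "G \<in> Bminus" "L \<in> Bminus"
      and j: "mor j" "src j = X" "tgt j = L" and isoj: "is_iso Q X L (cls j)"
      and cok': "is_cokernel_of Q A X (cls f) G (cls (l \<cdot> j))"
      using ex_good_cokernel[OF A o(1) f(1-3)] by blast
    obtain v where v: "is_iso Q Z G v" "v \<cdot>\<^bsub>Q\<^esub> \<gamma> = cls (l \<cdot> j)"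
      using Q.cokernel_of_unique[OF cok[unfolded f(4)] cok'] o' by blast
    have "v \<in> Mor Q Z G" using v(1) by (simp add: is_iso_def)
    then have "v \<cdot>\<^bsub>Q\<^esub> \<eta> \<in> Mor Q Y G" using m(2) o GL by simp
    then obtain h where h: "mor h" "src h = Y" "tgt h = G" "v \<cdot>\<^bsub>Q\<^esub> \<eta> = cls h"
      using heart.Q_MorE o GL by metis
    obtain \<delta>' V n N t where V: "V \<in> \<V>" and N: "N \<in> \<W>" and r': "real \<delta>' V n N t G"
      using Bminus_approx[OF GL(1)] .
    note [simp] = realD[OF r'] realD[OF r] h(1-3) o GL j
    obtain Y' i2 j2 p2 q2 where Y': "is_biproduct B N Y Y' i2 j2 p2 q2" using ex_biproduct[of N Y] by auto
    note [simp] = biproductD[OF Y']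
    note iso2 = is_iso_summand[OF Y' N o(2)]
    \<comment> \<open>\<open>t\<close> is the deflation from N onto G with cocone in
      \<open>\<V>\<close>, so morphisms from \<open>\<U>\<close> to G lift along \<open>t\<close>,
      hence along \<open>h'\<close>; on the heart \<open>h'\<close> still represents
      \<open>h\<close>.\<close>
    define h' where "h' = t \<cdot> p2 \<boxplus> h \<cdot> q2"
    have h' [simp]: "mor h'" "src h' = Y'" "tgt h' = G" by (simp_all add: h'_def)
    have "\<exists>y. mor y \<and> src y = src x \<and> tgt y = Y' \<and> h' \<cdot> y = x"
      if x: "mor x" "src x \<in> \<U>" "tgt x = G" for x
    proof -
      obtain y where y: "mor y" "src y = src x" "tgt y = N" "t \<cdot> y = x"
        using lift_from_U[OF r' V x(1,3,2)] by blast
      have "p2 \<cdot> (i2 \<cdot> y) = y" "q2 \<cdot> (i2 \<cdot> y) = zero_mor B (src x) Y"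
        using assoc[of y i2 p2] assoc[of y i2 q2] y x by (simp_all del: assoc)
      then have "h' \<cdot> (i2 \<cdot> y) = x" using y x by (simp add: h'_def)
      then show ?thesis using y by (intro exI[of _ "i2 \<cdot> y"]) simp
    qed
    from good_pullback[OF r g A GL(1) iso2(3) h' this] obtain P' p' q' where
      pb': "is_pullback Q L Y' G (cls l) (cls h') P' p' q'" and cok2: "is_cokernel Q P' Y' q'" by blast
    have hj: "h' \<cdot> j2 = h" by (simp add: h'_def)
    show "is_cokernel Q P Y q"
    proof (rule Q.is_cokernel_pullback_transfer[OF pb' cok2 pb o' _ _ _ m _ _ isoj iso2(1) v(1)])
      show "v \<cdot>\<^bsub>Q\<^esub> \<gamma> = cls l \<cdot>\<^bsub>Q\<^esub> cls j" unfolding v(2) by (rule Q_cmp[symmetric]) simp_all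
      have "cls h' \<cdot>\<^bsub>Q\<^esub> cls j2 = cls (h' \<cdot> j2)" using iso2(3) by (intro Q_cmp) simp_all
      then show "v \<cdot>\<^bsub>Q\<^esub> \<eta> = cls h' \<cdot>\<^bsub>Q\<^esub> cls j2" by (simp add: h(4) hj)
      show "cls l \<in> Mor Q L G" "cls h' \<in> Mor Q Y' G" using iso2(3) by (simp_all only: heart.cls_Mor h' GL realD[OF r])
    qed (use GL iso2(3) in simp_all)
  next
    fix X Y Z \<kappa> \<eta> P p q
    assume o': "X \<in> Obj Q" "Y \<in> Obj Q" "Z \<in> Obj Q" and m: "\<kappa> \<in> Mor Q Z X" "\<eta> \<in> Mor Q Z Y"
      and ker: "is_kernel Q Z X \<kappa>" and po: "is_pushout Q X Y Z \<kappa> \<eta> P p q"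
    then have o: "X \<in> Bminus" "Y \<in> Bminus" "Z \<in> Bminus" by simp_all
    obtain A \<Phi> where A: "A \<in> Bminus" and Phi: "\<Phi> \<in> Mor Q X A" and ker: "is_kernel_of Q X A \<Phi> Z \<kappa>"
      using ker unfolding is_kernel_def by auto
    obtain f where f: "mor f" "src f = X" "tgt f = A" "\<Phi> = cls f" using heart.Q_MorE[OF Phi o(1) A] .
    obtain \<delta> V a K k where r: "real \<delta> V a K k X" and V: "V \<in> \<V>" and K: "K \<in> Bminus"
      and ker': "is_kernel_of Q X A (cls f) K (cls k)"
      using ex_V_deflation_kernel[OF o(1) A f(1-3)] by blast
    obtain v where v: "is_iso Q K Z v" "\<kappa> \<cdot>\<^bsub>Q\<^esub> v = cls k"
      using Q.kernel_of_unique[OF ker' ker[unfolded f(4)]] o' by blast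
    have "v \<in> Mor Q K Z" using v(1) by (simp add: is_iso_def)
    then have "\<eta> \<cdot>\<^bsub>Q\<^esub> v \<in> Mor Q K Y" using m(2) o K by simp
    then obtain h where h: "mor h" "src h = K" "tgt h = Y" "\<eta> \<cdot>\<^bsub>Q\<^esub> v = cls h"
      using heart.Q_MorE o K by metis
    obtain N Y' i2 j2 p2 q2 \<delta>' b M c where N: "N \<in> \<W>" and Y': "is_biproduct B N Y Y' i2 j2 p2 q2"
      and r': "real \<delta>' K b Y' c M" and g: "good M K \<delta>'" and MY: "M \<in> Bminus" "Y' \<in> Bminus"
      and b: "cls b = cls (j2 \<cdot> h)"
      using ex_good_inflation[OF K o(2) h(1-3)] by blast
    note [simp] = realD[OF r'] realD[OF r] h(1-3) o K MY biproductD[OF Y']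
    note iso2 = is_iso_summand[OF Y' N o(2)]
    \<comment> \<open>One application of (ET4) gives both the pushout square and the deflation
      \<open>c'\<close> with the same cocone V as \<open>k\<close>; \<open>c'\<close> is therefore a
      kernel as soon as P' lies in \<open>Bminus\<close>.\<close>
    obtain P' \<delta>'' c0 c' d e where r1: "real \<delta>'' V c0 Y' c' P'" and r2: "real (psh M k \<delta>') X d P' e M"
      and c'b: "c' \<cdot> b = d \<cdot> k" and ec: "e \<cdot> c' = c"
      using ET4[OF r r'] by blast
    note [simp] = realD[OF r1] realD[OF r2]
    have "good M X (psh M k \<delta>')" using good_push[OF g, of k] by simp
    then have P' [simp]: "P' \<in> Bminus" by (rule Bminus_good_extension[OF r2 _ o(1) MY(1)])
    have po': "is_pushout Q X Y' K (cls k) (cls b) P' (cls d) (cls c')"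
      by (rule good_pushout[OF r' g _ _ _ r2 _ _ _ c'b ec]) simp_all
    have ker2: "is_kernel Q Y' P' (cls c')" by (rule V_deflation_is_kernel[OF r1 V MY(2) P'])
    have isoX: "is_iso Q X X (idm Q X)" using o' by (intro Q.is_iso_id)
    show "is_kernel Q Y P q"
    proof (rule Q.is_kernel_pushout_transfer[OF po' ker2 po o' _ _ _ m _ _ isoX iso2(2) v(1)])
      show "\<kappa> \<cdot>\<^bsub>Q\<^esub> v = idm Q X \<cdot>\<^bsub>Q\<^esub> cls k"
        unfolding v(2) using Q.cmp_id_left[of K X "cls k"] heart.cls_Mor[of K X k] by simp
      have qjh: "q2 \<cdot> (j2 \<cdot> h) = h" using assoc[of h j2 q2] by (simp del: assoc)
      show "\<eta> \<cdot>\<^bsub>Q\<^esub> v = cls q2 \<cdot>\<^bsub>Q\<^esub> cls b" unfolding h(4) b by (simp add: Q_cmp qjh)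
      show "cls k \<in> Mor Q K X" "cls b \<in> Mor Q K Y'" by (rule heart.cls_Mor; simp)+
    qed simp_all
  qed
qed

end

section \<open>Duality\<close>

definition op_bifun :: "('o, 'm, 'e) bifun \<Rightarrow> ('o, 'm, 'e) bifun" where
  "op_bifun E = \<lparr>Ext = (\<lambda>D A. Ext E A D), Emap = (\<lambda>g f. Emap E f g)\<rparr>"

text \<open>A sequence is stored as its pair of morphisms, so reversing the sequence is swapping the
  pair.\<close>

definition op_assignment :: "('o, 'm, 'e) seq_assignment \<Rightarrow> ('o, 'm, 'e) seq_assignment" where
  "op_assignment s D A \<delta> = prod.swap ` s A D \<delta>"

lemma op_bifun_simps [simp]:
  "Ext (op_bifun E) D A = Ext E A D" "Emap (op_bifun E) g f = Emap E f g"
  by (simp_all add: op_bifun_def)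

lemma push_op [simp]: "push (op_cat B) (op_bifun E) D f \<delta> = pull B E D f \<delta>"
  and pull_op [simp]: "pull (op_cat B) (op_bifun E) A g \<delta> = push B E A g \<delta>"
  by (simp_all add: push_def pull_def)

lemma ext_morphism_op:
  "ext_morphism (op_cat B) (op_bifun E) D A \<delta> D' A' \<delta>' f h \<longleftrightarrow> ext_morphism B E A' D' \<delta>' A D \<delta> h f"
  by (auto simp: ext_morphism_def)

lemma (in preadditive_category) seq_equiv_sym:
  assumes "((a, b), (a', b')) \<in> seq_equiv C A D" "A \<in> Obj C" "D \<in> Obj C"
  shows "((a', b'), (a, b)) \<in> seq_equiv C A D"
proof -
  obtain M M' g where o: "M \<in> Obj C" "M' \<in> Obj C"
    and m: "a \<in> Mor C A M" "b \<in> Mor C M D" "a' \<in> Mor C A M'" "b' \<in> Mor C M' D"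
    and g: "is_iso C M M' g" "g \<cdot> a = a'" "b' \<cdot> g = b"
    using assms(1) unfolding seq_equiv_def by blast
  obtain h where h: "mor g" "src g = M" "tgt g = M'" "mor h" "src h = M'" "tgt h = M"
      "h \<cdot> g = idm C M" "g \<cdot> h = idm C M'"
    using iso_inverse[OF g(1) o] by blast
  have "h \<cdot> g \<cdot> a = a" "b' \<cdot> (g \<cdot> h) = b'" using h m o assms(2,3) by (simp_all del: assoc)
  moreover have "h \<cdot> a' = h \<cdot> g \<cdot> a" "b \<cdot> h = b' \<cdot> (g \<cdot> h)"
    using h(1-6) m o assms(2,3) unfolding g(2,3)[symmetric] by simp_all
  moreover have "is_iso C M' M h" unfolding is_iso_def using h o by auto
  ultimately show ?thesis unfolding seq_equiv_def using o m by auto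
qed

text \<open>Dualising reverses the isomorphism of middle terms and gives the relation with its sides
  exchanged; symmetry restores the order.\<close>

lemma (in preadditive_category) seq_equiv_op:
  assumes "A \<in> Obj C" "D \<in> Obj C"
  shows "((a, b), (a', b')) \<in> seq_equiv (op_cat C) A D \<longleftrightarrow> ((b, a), (b', a')) \<in> seq_equiv C D A"
proof -
  have "((a, b), (a', b')) \<in> seq_equiv (op_cat C) A D \<longleftrightarrow> ((b', a'), (b, a)) \<in> seq_equiv C D A"
    unfolding seq_equiv_def by (simp add: is_iso_op) blast
  then show ?thesis using seq_equiv_sym assms by blast
qed

lemma (in preadditive_category) seq_equiv_op_class:
  assumes "A \<in> Obj C" "D \<in> Obj C"
  shows "seq_equiv (op_cat C) A D `` {(a, b)} = prod.swap ` (seq_equiv C D A `` {(b, a)})"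
proof (rule Set.set_eqI)
  fix x :: "'m \<times> 'm"
  obtain a' b' where x: "x = (a', b')" by (cases x)
  have "x \<in> seq_equiv (op_cat C) A D `` {(a, b)} \<longleftrightarrow> (b', a') \<in> seq_equiv C D A `` {(b, a)}"
    unfolding x by (simp add: seq_equiv_op[OF assms])
  also have "\<dots> \<longleftrightarrow> x \<in> prod.swap ` (seq_equiv C D A `` {(b, a)})"
    unfolding x by (metis (no_types, opaque_lifting) image_iff swap_simp swap_swap)
  finally show "x \<in> seq_equiv (op_cat C) A D `` {(a, b)} \<longleftrightarrow> x \<in> prod.swap ` (seq_equiv C D A `` {(b, a)})" .
qed

lemma (in preadditive_category) realised_by_op:
  "realised_by (op_cat C) (op_bifun E) (op_assignment s) \<delta> A a M b D \<longleftrightarrow> realised_by C E s \<delta> D b M a A"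
proof (cases "A \<in> Obj C \<and> D \<in> Obj C")
  case True
  then show ?thesis
    unfolding realised_by_def op_assignment_def
    by (auto simp: seq_equiv_op_class inj_image_eq_iff)
qed (auto simp: realised_by_def)

lemma biadditive_functor_op:
  assumes "biadditive_functor B E" shows "biadditive_functor (op_cat B) (op_bifun E)"
proof -
  interpret biadditive_functor B E by fact
  interpret op: additive_category "op_cat B"
    by (rule additive_category_op) (rule additive_category_axioms)
  show ?thesis
  proof (intro biadditive_functor.intro biadditive_functor_axioms.intro)
    show "additive_category (op_cat B)" by (rule op.additive_category_axioms)
  qed (simp_all add: ext_group Emap_hom Emap_id Emap_cmp
      Emap_add_left[unfolded mult_add] Emap_add_right[unfolded mult_add] del: Mor_iff op.Mor_iff mult_add op.mult_add)
qed

lemma extriangulated_category_op: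
  assumes "extriangulated_category B E s"
  shows "extriangulated_category (op_cat B) (op_bifun E) (op_assignment s)"
proof -
  interpret extriangulated_category B E s by fact
  interpret op: biadditive_functor "op_cat B" "op_bifun E"
    by (rule biadditive_functor_op) (rule biadditive_functor_axioms)
  note simps = realised_by_op ext_morphism_op op_cat_simps push_op pull_op op_bifun_simps
  show ?thesis
  proof
    fix D A \<delta> assume "D \<in> Obj (op_cat B)" "A \<in> Obj (op_cat B)" "\<delta> \<in> carrier (Ext (op_bifun E) D A)"
    then have o: "D \<in> Obj B" "A \<in> Obj B" "\<delta> \<in> ext A D" by simp_all
    obtain b M a where r: "real \<delta> D b M a A" using ex_realD[OF o(2,1,3)] by blast
    have "op_assignment s D A \<delta> = seq_equiv (op_cat B) A D `` {(a, b)}"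
      using r o unfolding realised_by_op[symmetric] by (simp add: realised_by_def)
    moreover have "(a, b) \<in> sequences (op_cat B) A D"
      using realD[OF r] by (auto simp: sequences_def)
    ultimately show "op_assignment s D A \<delta> \<in> sequences (op_cat B) A D // seq_equiv (op_cat B) A D"
      by (auto intro: quotientI)
  next
    fix \<delta> A a M b D \<delta>' A' a' M' b' D' f h
    assume "realised_by (op_cat B) (op_bifun E) (op_assignment s) \<delta> A a M b D"
      and "realised_by (op_cat B) (op_bifun E) (op_assignment s) \<delta>' A' a' M' b' D'"
      and "ext_morphism (op_cat B) (op_bifun E) D A \<delta> D' A' \<delta>' f h"
    then show "\<exists>g \<in> Mor (op_cat B) M M'. g \<cdot>\<^bsub>op_cat B\<^esub> a = a' \<cdot>\<^bsub>op_cat B\<^esub> f \<and> b' \<cdot>\<^bsub>op_cat B\<^esub> g = h \<cdot>\<^bsub>op_cat B\<^esub> b"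
      unfolding simps using s_realises[of \<delta>' D' b' M' a' A' \<delta> D b M a A h f] by metis
  next
    fix A D P i j p q
    assume "is_biproduct (op_cat B) A D P i j p q"
    then show "realised_by (op_cat B) (op_bifun E) (op_assignment s) \<one>\<^bsub>Ext (op_bifun E) D A\<^esub> A i P q D"
      unfolding simps is_biproduct_op using s_zero biproduct_commute by blast
  next
    fix \<delta> A a M b D \<delta>' A' a' M' b' D' AA iA iA' pA pA' MM iM iM' pM pM' DD iD iD' pD pD'
    assume "realised_by (op_cat B) (op_bifun E) (op_assignment s) \<delta> A a M b D"
      "realised_by (op_cat B) (op_bifun E) (op_assignment s) \<delta>' A' a' M' b' D'"
      "is_biproduct (op_cat B) A A' AA iA iA' pA pA'" "is_biproduct (op_cat B) M M' MM iM iM' pM pM'"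
      "is_biproduct (op_cat B) D D' DD iD iD' pD pD'"
    then have r: "real \<delta> D b M a A" "real \<delta>' D' b' M' a' A'"
      and b: "is_biproduct B A A' AA pA pA' iA iA'" "is_biproduct B M M' MM pM pM' iM iM'"
        "is_biproduct B D D' DD pD pD' iD iD'"
      unfolding simps is_biproduct_op by simp_all
    note [simp] = realD[OF r(1)] realD[OF r(2)] biproductD[OF b(1)] biproductD[OF b(2)] biproductD[OF b(3)]
    \<comment> \<open>The dual of the sum formula pushes and pulls in the other order, so the
      bifunctor law is needed before additivity applies.\<close>
    have "psh AA pD (pll D iA \<delta>) = pll DD iA (psh A pD \<delta>)"
      "psh AA pD' (pll D' iA' \<delta>') = pll DD iA' (psh A' pD' \<delta>')"
      by (subst push_pull; simp)+
    then show "realised_by (op_cat B) (op_bifun E) (op_assignment s)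
          (push (op_cat B) (op_bifun E) DD iA (pull (op_cat B) (op_bifun E) A pD \<delta>)
             \<otimes>\<^bsub>Ext (op_bifun E) DD AA\<^esub> push (op_cat B) (op_bifun E) DD iA' (pull (op_cat B) (op_bifun E) A' pD' \<delta>'))
          AA ((iM \<cdot>\<^bsub>op_cat B\<^esub> a \<cdot>\<^bsub>op_cat B\<^esub> pA) \<otimes>\<^bsub>Hom (op_cat B) AA MM\<^esub> (iM' \<cdot>\<^bsub>op_cat B\<^esub> a' \<cdot>\<^bsub>op_cat B\<^esub> pA'))
          MM ((iD \<cdot>\<^bsub>op_cat B\<^esub> b \<cdot>\<^bsub>op_cat B\<^esub> pM) \<otimes>\<^bsub>Hom (op_cat B) MM DD\<^esub> (iD' \<cdot>\<^bsub>op_cat B\<^esub> b' \<cdot>\<^bsub>op_cat B\<^esub> pM'))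
          DD"
      unfolding simps using s_sum[OF r b(3,2,1)] by simp
  next
    fix \<delta> A a M b D \<delta>' A' a' M' b' D' f g
    assume "realised_by (op_cat B) (op_bifun E) (op_assignment s) \<delta> A a M b D"
      "realised_by (op_cat B) (op_bifun E) (op_assignment s) \<delta>' A' a' M' b' D'"
      "f \<in> Mor (op_cat B) A A'" "g \<in> Mor (op_cat B) M M'" "g \<cdot>\<^bsub>op_cat B\<^esub> a = a' \<cdot>\<^bsub>op_cat B\<^esub> f"
    then show "\<exists>h. ext_morphism (op_cat B) (op_bifun E) D A \<delta> D' A' \<delta>' f h \<and> h \<cdot>\<^bsub>op_cat B\<^esub> b = b' \<cdot>\<^bsub>op_cat B\<^esub> g"
      unfolding simps using ET3_op[of \<delta>' D' b' M' a' A' \<delta> D b M a A g f] by metis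
  next
    fix \<delta> A a M b D \<delta>' A' a' M' b' D' g h
    assume "realised_by (op_cat B) (op_bifun E) (op_assignment s) \<delta> A a M b D"
      "realised_by (op_cat B) (op_bifun E) (op_assignment s) \<delta>' A' a' M' b' D'"
      "g \<in> Mor (op_cat B) M M'" "h \<in> Mor (op_cat B) D D'" "h \<cdot>\<^bsub>op_cat B\<^esub> b = b' \<cdot>\<^bsub>op_cat B\<^esub> g"
    then show "\<exists>f. ext_morphism (op_cat B) (op_bifun E) D A \<delta> D' A' \<delta>' f h \<and> g \<cdot>\<^bsub>op_cat B\<^esub> a = a' \<cdot>\<^bsub>op_cat B\<^esub> f"
      unfolding simps using ET3[of \<delta>' D' b' M' a' A' \<delta> D b M a A h g] by metis
  next
    fix \<delta> A a M a' D \<delta>' b N b' F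
    assume "realised_by (op_cat B) (op_bifun E) (op_assignment s) \<delta> A a M a' D"
      "realised_by (op_cat B) (op_bifun E) (op_assignment s) \<delta>' M b N b' F"
    then show "\<exists>G \<delta>'' c c' d e.
        realised_by (op_cat B) (op_bifun E) (op_assignment s) \<delta>'' A c N c' G \<and>
        d \<in> Mor (op_cat B) D G \<and> e \<in> Mor (op_cat B) G F \<and>
        c = b \<cdot>\<^bsub>op_cat B\<^esub> a \<and> c' \<cdot>\<^bsub>op_cat B\<^esub> b = d \<cdot>\<^bsub>op_cat B\<^esub> a' \<and> e \<cdot>\<^bsub>op_cat B\<^esub> c' = b' \<and>
        realised_by (op_cat B) (op_bifun E) (op_assignment s) (push (op_cat B) (op_bifun E) F a' \<delta>') D d G e F \<and>
        pull (op_cat B) (op_bifun E) A d \<delta>'' = \<delta> \<and>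
        push (op_cat B) (op_bifun E) G a \<delta>'' = pull (op_cat B) (op_bifun E) M e \<delta>'"
      unfolding simps by (rule ET4_op)
  next
    fix \<delta> D a' M a A \<delta>' F b' N b
    assume "realised_by (op_cat B) (op_bifun E) (op_assignment s) \<delta> D a' M a A"
      "realised_by (op_cat B) (op_bifun E) (op_assignment s) \<delta>' F b' N b M"
    then show "\<exists>G \<delta>'' c c' d e.
        realised_by (op_cat B) (op_bifun E) (op_assignment s) \<delta>'' G c' N c A \<and>
        d \<in> Mor (op_cat B) G D \<and> e \<in> Mor (op_cat B) F G \<and>
        c = a \<cdot>\<^bsub>op_cat B\<^esub> b \<and> b \<cdot>\<^bsub>op_cat B\<^esub> c' = a' \<cdot>\<^bsub>op_cat B\<^esub> d \<and> c' \<cdot>\<^bsub>op_cat B\<^esub> e = b' \<and>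
        realised_by (op_cat B) (op_bifun E) (op_assignment s) (pull (op_cat B) (op_bifun E) F a' \<delta>') F e G d D \<and>
        push (op_cat B) (op_bifun E) A d \<delta>'' = \<delta> \<and>
        pull (op_cat B) (op_bifun E) G a \<delta>'' = push (op_cat B) (op_bifun E) M e \<delta>'"
      unfolding simps by (rule ET4)
  qed
qed

context preadditive_category
begin

lemma Cone_op: "Cone (op_cat C) (op_bifun E) (op_assignment s) \<Y> \<X> = CoCone C E s \<X> \<Y>"
  and CoCone_op: "CoCone (op_cat C) (op_bifun E) (op_assignment s) \<Y> \<X> = Cone C E s \<X> \<Y>"
  unfolding Cone_def CoCone_def conflation_def realised_by_op op_cat_simps by blast+

lemma additive_summand_closed_op:
  assumes "additive_summand_closed C \<U>" shows "additive_summand_closed (op_cat C) \<U>"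
proof -
  have "full_subcategory (op_cat C) \<U> = op_cat (full_subcategory C \<U>)"
    by (simp add: full_subcategory_def op_cat_def)
  moreover have "closed_under_summands (op_cat C) \<U> \<longleftrightarrow> closed_under_summands C \<U>"
    unfolding closed_under_summands_def is_biproduct_op by blast
  ultimately show ?thesis
    using assms additive_category_op[of "full_subcategory C \<U>"]
    unfolding additive_summand_closed_def by simp
qed

lemma cotorsion_pair_op:
  assumes "cotorsion_pair C E s \<U> \<V>"
  shows "cotorsion_pair (op_cat C) (op_bifun E) (op_assignment s) \<V> \<U>"
  using assms additive_summand_closed_op
  unfolding cotorsion_pair_def Cone_op CoCone_op ext_vanish_def by auto

lemma twin_cotorsion_pair_op:
  assumes "twin_cotorsion_pair C E s \<S> \<T> \<U> \<V>"
  shows "twin_cotorsion_pair (op_cat C) (op_bifun E) (op_assignment s) \<V> \<U> \<T> \<S>"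
  using assms cotorsion_pair_op unfolding twin_cotorsion_pair_def ext_vanish_def by auto

end

lemma factoring_op: "factoring (op_cat B) \<W> X Y = factoring B \<W> Y X"
  by (auto simp: factoring_def)

text \<open>Reversal only exchanges the roles of the outer objects and of the two representatives,
  so the union in the definition of the composite is the same set.\<close>

lemma additive_quotient_op:
  "additive_quotient (op_cat B) \<H> \<W> = op_cat (additive_quotient B \<H> \<W>)"
proof -
  have "(\<lambda>\<Gamma> \<Phi>. \<Union>{factoring B \<W> Z X #>\<^bsub>Hom B Z X\<^esub> (f \<cdot>\<^bsub>B\<^esub> g) | X Y Z f g.
           X \<in> \<H> \<and> Y \<in> \<H> \<and> Z \<in> \<H> \<and> f \<in> \<Phi> \<inter> Mor B Y X \<and> g \<in> \<Gamma> \<inter> Mor B Z Y}) =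
        (\<lambda>\<Gamma> \<Phi>. \<Union>{factoring B \<W> X Z #>\<^bsub>Hom B X Z\<^esub> (g \<cdot>\<^bsub>B\<^esub> f) | X Y Z f g.
           X \<in> \<H> \<and> Y \<in> \<H> \<and> Z \<in> \<H> \<and> f \<in> \<Gamma> \<inter> Mor B X Y \<and> g \<in> \<Phi> \<inter> Mor B Y Z})"
    by (intro ext arg_cong[where f = Union] Collect_cong) blast
  then show ?thesis unfolding additive_quotient_def op_cat_def by (simp add: factoring_op[unfolded op_cat_def])
qed

theorem theorem4p2:
  fixes B :: "('o, 'm) cat"
    and E :: "('o, 'm, 'e) bifun"
    and s :: "('o, 'm, 'e) seq_assignment"
    and \<S> \<T> \<U> \<V> \<W> Bminus Bplus \<H> :: "'o set"
  assumes "extriangulated_category B E s"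
    and "twin_cotorsion_pair B E s \<S> \<T> \<U> \<V>"
    and "\<W> = \<T> \<inter> \<U>"
    and "Bminus = CoCone B E s \<W> \<S>"
    and "Bplus = Cone B E s \<V> \<W>"
    and "\<H> = Bminus \<inter> Bplus"
    and "\<H> = Bminus \<or> \<H> = Bplus"
  shows "quasi_abelian_category (additive_quotient B \<H> \<W>)"
  using assms(7)
proof
  assume H: "\<H> = Bminus"
  interpret extriangulated_category B E s by fact
  interpret T: twin_cotorsion B E s \<S> \<T> \<U> \<V> by unfold_locales (rule assms(2))
  have eq: "T.\<W> = \<W>" "T.Bminus = \<H>" "T.Bplus = Bplus"
    unfolding T.\<W>_def T.Bminus_def T.Bplus_def using assms(3-5) H by simp_all
  interpret T: twin_cotorsion_Bminus B E s \<S> \<T> \<U> \<V>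
    by unfold_locales (use eq assms(6) in auto)
  show ?thesis using T.heart_quasi_abelian unfolding eq .
next
  assume H: "\<H> = Bplus"
  interpret extriangulated_category B E s by fact
  interpret op: extriangulated_category "op_cat B" "op_bifun E" "op_assignment s"
    by (rule extriangulated_category_op) fact
  \<comment> \<open>In the opposite category \<open>(\<V>, \<U>)\<close> takes the place of
    \<open>(\<S>, \<T>)\<close>: \<open>\<W>\<close> is unchanged, while \<open>Bminus\<close> and
    \<open>Bplus\<close> trade places.\<close>
  interpret T: twin_cotorsion "op_cat B" "op_bifun E" "op_assignment s" \<V> \<U> \<T> \<S>
    by unfold_locales (rule twin_cotorsion_pair_op[OF assms(2)])
  have eq: "T.\<W> = \<W>" "T.Bminus = \<H>" "T.Bplus = Bminus"
    unfolding T.\<W>_def T.Bminus_def T.Bplus_def CoCone_op Cone_op using assms(3-5) H by (auto simp: Int_commute)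
  interpret T: twin_cotorsion_Bminus "op_cat B" "op_bifun E" "op_assignment s" \<V> \<U> \<T> \<S>
    by unfold_locales (use eq assms(6) in auto)
  \<comment> \<open>The heart formed in the opposite category is the opposite of the original heart,
    so one more dualisation returns to it.\<close>
  have "quasi_abelian_category (op_cat (additive_quotient (op_cat B) \<H> \<W>))"
    using quasi_abelian_category_op[OF T.heart_quasi_abelian] unfolding eq .
  then show ?thesis by (simp add: additive_quotient_op)
qed

end
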